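(* Let $(X,\mathcal E)$ and $(Y,\mathcal F)$ be uniformly locally finite coarse spaces. If their uniform Roe algebras are isomorphic as $C^*$-algebras, $C_u^*(X,\mathcal E)\cong C_u^*(Y,\mathcal F)$, then $(X,\mathcal E)$ and $(Y,\mathcal F)$ are bijectively coarsely equivalent.
   Context: A coarse structure on a set $X$ is a family $\mathcal E$ of subsets of $X\times X$ (called entourages) containing the diagonal $\Delta_X=\{(x,x):x\in X\}$ and closed under taking subsets, finite unions, inverses, and compositions; $(X,\mathcal E)$ is then a coarse space. No further assumption (countable generation, connectedness, countability of $X$) is made. For $E\subseteq X\times X$ and $x\in X$ put $E[x]=\{y\in X:(x,y)\in E\}$. The coarse space is uniformly locally finite if $N_E:=\sup_{x\in X}|E[x]|<\infty$ for every $E\in\mathcal E$. For a bounded operator $T\in B(\ell^2(X))$ its support is $\operatorname{supp}(T)=\{(x,x')\in X\times X:\langle T\delta_{x'},\delta_x\rangle\neq 0\}$, where $(\delta_x)_{x\in X}$ is the canonical orthonormal basis. The uniform Roe algebra $C_u^*(X,\mathcal E)$ is the operator-norm closure of $\{T\in B(\ell^2(X)):\operatorname{supp}(T)\in\mathcal E\}$. A map $h:X\to Y$ is controlled if $(h\times h)(E)\in\mathcal F$ for all $E\in\mathcal E$. The spaces $(X,\mathcal E)$ and $(Y,\mathcal F)$ are bijectively coarsely equivalent if there is a bijection $b:X\to Y$ such that both $b$ and $b^{-1}$ are controlled. *)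

theory Defs
  imports "HOL-Analysis.Analysis"
begin

section \<open>The complex Hilbert space of square-summable functions\<close>

typedef 'a ell2 = "{f :: 'a \<Rightarrow> complex. (\<lambda>x. (cmod (f x))\<^sup>2) summable_on UNIV}"
  morphisms coord Abs_ell2
  by (rule exI[of _ "\<lambda>_. 0"]) simp

setup_lifting type_definition_ell2

lemma coord_summable: "(\<lambda>x. (cmod (coord f x))\<^sup>2) summable_on UNIV"
  using coord[of f] by simp

lemma ell2_eqI: "(\<And>x. coord f x = coord g x) \<Longrightarrow> f = g"
  by (simp add: coord_inject[symmetric] ext)

lemma summable_square_scale:
  fixes f :: "'a \<Rightarrow> complex"
  assumes "(\<lambda>x. (cmod (f x))\<^sup>2) summable_on UNIV"
  shows "(\<lambda>x. (cmod (c * f x))\<^sup>2) summable_on UNIV"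
  using summable_on_cmult_right[OF assms, of "(cmod c)\<^sup>2"]
  by (simp add: norm_mult power_mult_distrib)

lemma summable_square_add:
  fixes f g :: "'a \<Rightarrow> complex"
  assumes f: "(\<lambda>x. (cmod (f x))\<^sup>2) summable_on UNIV"
    and g: "(\<lambda>x. (cmod (g x))\<^sup>2) summable_on UNIV"
  shows "(\<lambda>x. (cmod (f x + g x))\<^sup>2) summable_on UNIV"
proof (rule summable_on_comparison_test)
  show "(\<lambda>x. 2 * (cmod (f x))\<^sup>2 + 2 * (cmod (g x))\<^sup>2) summable_on UNIV"
    by (intro summable_on_add summable_on_cmult_right f g)
  fix x
  have "(cmod (f x + g x))\<^sup>2 \<le> (cmod (f x) + cmod (g x))\<^sup>2"
    by (intro power_mono norm_triangle_ineq) simp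
  also have "\<dots> \<le> 2 * (cmod (f x))\<^sup>2 + 2 * (cmod (g x))\<^sup>2"
    using sum_squares_bound[of "cmod (f x)" "cmod (g x)"]
    by (simp add: power2_sum)
  finally show "(cmod (f x + g x))\<^sup>2 \<le> 2 * (cmod (f x))\<^sup>2 + 2 * (cmod (g x))\<^sup>2" .
qed auto

lemma summable_coord_mult_cnj:
  "(\<lambda>x. coord f x * cnj (coord g x)) summable_on UNIV"
proof -
  have "(\<lambda>x. (cmod (coord f x))\<^sup>2 + (cmod (coord g x))\<^sup>2) summable_on UNIV"
    by (intro summable_on_add coord_summable)
  then have "(\<lambda>x. norm (coord f x * cnj (coord g x))) summable_on UNIV"
  proof (rule summable_on_comparison_test)
    fix x
    have *: "0 \<le> cmod (coord f x) * cmod (coord g x)" by simp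
    show "norm (coord f x * cnj (coord g x)) \<le> (cmod (coord f x))\<^sup>2 + (cmod (coord g x))\<^sup>2"
      using sum_squares_bound[of "cmod (coord f x)" "cmod (coord g x)"] *
      unfolding norm_mult complex_mod_cnj by linarith
  qed auto
  then show ?thesis by (rule abs_summable_summable)
qed

lift_definition scaleC :: "complex \<Rightarrow> 'a ell2 \<Rightarrow> 'a ell2" (infixr "*\<^sub>C" 75)
  is "\<lambda>c f x. c * f x"
  by (rule summable_square_scale)

text \<open>Linear in the first argument, conjugate-linear in the second.\<close>

definition cinner :: "'a ell2 \<Rightarrow> 'a ell2 \<Rightarrow> complex" where
  "cinner f g = (\<Sum>\<^sub>\<infinity>x. coord f x * cnj (coord g x))"

instantiation ell2 :: (type) real_inner
begin

lift_definition zero_ell2 :: "'a ell2" is "\<lambda>_. 0" by simp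

lift_definition plus_ell2 :: "'a ell2 \<Rightarrow> 'a ell2 \<Rightarrow> 'a ell2" is "\<lambda>f g x. f x + g x"
  by (rule summable_square_add)

lift_definition uminus_ell2 :: "'a ell2 \<Rightarrow> 'a ell2" is "\<lambda>f x. - f x" by simp

lift_definition minus_ell2 :: "'a ell2 \<Rightarrow> 'a ell2 \<Rightarrow> 'a ell2" is "\<lambda>f g x. f x - g x"
  subgoal for f g using summable_square_add[of f "\<lambda>x. - g x"] by simp
  done

definition scaleR_ell2 :: "real \<Rightarrow> 'a ell2 \<Rightarrow> 'a ell2" where
  "scaleR_ell2 r f = complex_of_real r *\<^sub>C f"

definition inner_ell2 :: "'a ell2 \<Rightarrow> 'a ell2 \<Rightarrow> real" where
  "inner_ell2 f g = Re (cinner f g)"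

definition norm_ell2 :: "'a ell2 \<Rightarrow> real" where
  "norm_ell2 f = sqrt (\<Sum>\<^sub>\<infinity>x. (cmod (coord f x))\<^sup>2)"

definition sgn_ell2 :: "'a ell2 \<Rightarrow> 'a ell2" where
  "sgn_ell2 f = inverse (norm f) *\<^sub>R f"

definition dist_ell2 :: "'a ell2 \<Rightarrow> 'a ell2 \<Rightarrow> real" where
  "dist_ell2 f g = norm (f - g)"

definition uniformity_ell2 :: "('a ell2 \<times> 'a ell2) filter" where
  "uniformity_ell2 = (INF e\<in>{0<..}. principal {(f, g). dist f g < e})"

definition open_ell2 :: "'a ell2 set \<Rightarrow> bool" where
  "open_ell2 U \<longleftrightarrow> (\<forall>f\<in>U. \<forall>\<^sub>F (f', g) in uniformity. f' = f \<longrightarrow> g \<in> U)"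

instance
proof
  fix f g h :: "'a ell2" and r s :: real
  have re: "inner f g = (\<Sum>\<^sub>\<infinity>x. Re (coord f x * cnj (coord g x)))" for f g :: "'a ell2"
    unfolding inner_ell2_def cinner_def by (rule infsum_Re[symmetric, OF summable_coord_mult_cnj])
  have ff: "inner f f = (\<Sum>\<^sub>\<infinity>x. (cmod (coord f x))\<^sup>2)" for f :: "'a ell2"
    unfolding re by (simp add: cmod_power2 flip: power2_eq_square)
  show "f + g + h = f + (g + h)" by (rule ell2_eqI) (simp add: plus_ell2.rep_eq)
  show "f + g = g + f" by (rule ell2_eqI) (simp add: plus_ell2.rep_eq)
  show "0 + f = f" by (rule ell2_eqI) (simp add: plus_ell2.rep_eq zero_ell2.rep_eq)
  show "- f + f = 0"
    by (rule ell2_eqI) (simp add: plus_ell2.rep_eq zero_ell2.rep_eq uminus_ell2.rep_eq)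
  show "f - g = f + - g"
    by (rule ell2_eqI) (simp add: plus_ell2.rep_eq minus_ell2.rep_eq uminus_ell2.rep_eq)
  show "r *\<^sub>R (f + g) = r *\<^sub>R f + r *\<^sub>R g"
    by (rule ell2_eqI) (simp add: scaleR_ell2_def plus_ell2.rep_eq scaleC.rep_eq algebra_simps)
  show "(r + s) *\<^sub>R f = r *\<^sub>R f + s *\<^sub>R f"
    by (rule ell2_eqI) (simp add: scaleR_ell2_def plus_ell2.rep_eq scaleC.rep_eq algebra_simps)
  show "r *\<^sub>R s *\<^sub>R f = (r * s) *\<^sub>R f"
    by (rule ell2_eqI) (simp add: scaleR_ell2_def scaleC.rep_eq)
  show "1 *\<^sub>R f = f" by (rule ell2_eqI) (simp add: scaleR_ell2_def scaleC.rep_eq)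
  show "dist f g = norm (f - g)" by (rule dist_ell2_def)
  show "sgn f = inverse (norm f) *\<^sub>R f" by (rule sgn_ell2_def)
  show "uniformity = (INF e\<in>{0<..}. principal {(f, g::'a ell2). dist f g < e})"
    by (rule uniformity_ell2_def)
  show "open U \<longleftrightarrow> (\<forall>f\<in>U. \<forall>\<^sub>F (f', g) in uniformity. f' = f \<longrightarrow> g \<in> U)" for U :: "'a ell2 set"
    by (rule open_ell2_def)
  show "inner f g = inner g f" unfolding re by (simp add: mult.commute)
  show "inner (f + g) h = inner f h + inner g h"
    unfolding inner_ell2_def cinner_def plus_ell2.rep_eq distrib_right
    by (simp add: infsum_add summable_coord_mult_cnj)
  show "inner (r *\<^sub>R f) g = r * inner f g"
    unfolding inner_ell2_def cinner_def scaleR_ell2_def scaleC.rep_eq mult.assoc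
    by (simp add: infsum_cmult_right')
  show "0 \<le> inner f f" unfolding ff by (rule infsum_nonneg) simp
  show "inner f f = 0 \<longleftrightarrow> f = 0"
  proof
    assume "inner f f = 0"
    then have "(cmod (coord f x))\<^sup>2 = 0" for x
      using nonneg_infsum_le_0D[of "\<lambda>x. (cmod (coord f x))\<^sup>2" UNIV x] coord_summable[of f]
      by (simp add: ff)
    then show "f = 0" by (intro ell2_eqI) (simp add: zero_ell2.rep_eq)
  next
    assume "f = 0"
    then show "inner f f = 0" by (simp add: ff zero_ell2.rep_eq)
  qed
  show "norm f = sqrt (inner f f)" by (simp add: ff norm_ell2_def)
qed

end

lift_definition delta :: "'a \<Rightarrow> 'a ell2"
  is "\<lambda>x y. if y = x then 1 else 0"
  by (rule finite_nonzero_values_imp_summable_on) (rule finite_subset[of _ "{_}"], auto split: if_splits)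


section \<open>Bounded operators on the Hilbert space of a set\<close>

text \<open>
  Isabelle's \<^typ>\<open>'a ell2 \<Rightarrow>\<^sub>L 'a ell2\<close> consists of the bounded \<^emph>\<open>real\<close>-linear maps,
  so complex homogeneity is required separately.  For a set \<open>X\<close> of elements of type \<open>'a\<close>, an operator on
  \<open>\<ell>\<^sup>2(X)\<close> is identified with its extension by zero on the orthogonal complement of \<open>\<ell>\<^sup>2(X)\<close>
  in \<open>\<ell>\<^sup>2('a)\<close>; this identification is a *-homomorphism and preserves the operator norm.
\<close>

definition clinear_op :: "('a ell2 \<Rightarrow>\<^sub>L 'b ell2) \<Rightarrow> bool" where
  "clinear_op T \<longleftrightarrow> (\<forall>c f. blinfun_apply T (c *\<^sub>C f) = c *\<^sub>C blinfun_apply T f)"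

definition bounded_ops :: "'a set \<Rightarrow> ('a ell2 \<Rightarrow>\<^sub>L 'a ell2) set" where
  "bounded_ops X = {T. clinear_op T \<and>
     (\<forall>f. \<forall>x. x \<notin> X \<longrightarrow> coord (blinfun_apply T f) x = 0) \<and>
     (\<forall>f. (\<forall>x\<in>X. coord f x = 0) \<longrightarrow> blinfun_apply T f = 0)}"

definition is_adjoint :: "('a ell2 \<Rightarrow>\<^sub>L 'a ell2) \<Rightarrow> ('a ell2 \<Rightarrow>\<^sub>L 'a ell2) \<Rightarrow> bool" where
  "is_adjoint S T \<longleftrightarrow> (\<forall>f g. cinner (blinfun_apply T f) g = cinner f (blinfun_apply S g))"

text \<open>Meaningful for complex-linear operators only; see \<open>adj_correct\<close> below.\<close>

definition adj :: "('a ell2 \<Rightarrow>\<^sub>L 'a ell2) \<Rightarrow> ('a ell2 \<Rightarrow>\<^sub>L 'a ell2)" where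
  "adj T = (THE S. is_adjoint S T)"

lemma scaleC_add: "c *\<^sub>C (f + g) = c *\<^sub>C f + c *\<^sub>C g"
  by (rule ell2_eqI) (simp add: plus_ell2.rep_eq scaleC.rep_eq algebra_simps)

lemma scaleC_scaleR: "c *\<^sub>C (r *\<^sub>R f) = r *\<^sub>R (c *\<^sub>C f)"
  by (rule ell2_eqI) (simp add: scaleR_ell2_def scaleC.rep_eq)

lemma norm_scaleC: "norm (c *\<^sub>C f) = cmod c * norm f"
  by (simp add: norm_ell2_def scaleC.rep_eq norm_mult power_mult_distrib infsum_cmult_right'
      real_sqrt_mult)

lemma bounded_linear_scaleC: "bounded_linear (\<lambda>f. c *\<^sub>C f)"
  by (rule bounded_linear_intro[where K = "cmod c"])
    (simp_all add: scaleC_add scaleC_scaleR norm_scaleC)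

definition scaleC_op :: "complex \<Rightarrow> ('a ell2 \<Rightarrow>\<^sub>L 'b ell2) \<Rightarrow> ('a ell2 \<Rightarrow>\<^sub>L 'b ell2)" where
  "scaleC_op c T = Blinfun (\<lambda>f. c *\<^sub>C blinfun_apply T f)"

lemma scaleC_op_apply: "blinfun_apply (scaleC_op c T) f = c *\<^sub>C blinfun_apply T f"
  unfolding scaleC_op_def
  by (subst bounded_linear_Blinfun_apply)
    (rule bounded_linear_compose[OF bounded_linear_scaleC blinfun.bounded_linear_right], rule refl)

lemma cinner_scaleC_left: "cinner (c *\<^sub>C f) g = c * cinner f g"
  by (simp add: cinner_def scaleC.rep_eq infsum_cmult_right' mult.assoc)

lemma cinner_add_left: "cinner (f + g) h = cinner f h + cinner g h"
  unfolding cinner_def plus_ell2.rep_eq distrib_right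
  by (rule infsum_add) (rule summable_coord_mult_cnj)+

lemma cinner_scaleR_left: "cinner (r *\<^sub>R f) g = r *\<^sub>R cinner f g"
  by (simp add: scaleR_ell2_def cinner_scaleC_left scaleR_conv_of_real)

lemma cnj_cinner: "cnj (cinner f g) = cinner g f"
  by (simp add: cinner_def flip: infsum_cnj) (simp add: mult.commute)

lemma cinner_add_right: "cinner h (f + g) = cinner h f + cinner h g"
  by (metis cnj_cinner cinner_add_left complex_cnj_add)

lemma cinner_scaleC_right: "cinner g (c *\<^sub>C f) = cnj c * cinner g f"
  by (metis cnj_cinner cinner_scaleC_left complex_cnj_mult)

lemma Re_cinner: "Re (cinner f g) = inner f g"
  by (simp add: inner_ell2_def)

lemma cmod_cinner_le: "cmod (cinner f g) \<le> norm f * norm g"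
proof (cases "cinner f g = 0")
  case False
  define u where "u = cnj (cinner f g) / cmod (cinner f g)"
  have u: "cmod u = 1" using False by (simp add: u_def norm_divide)
  have "cinner (u *\<^sub>C f) g = cmod (cinner f g)"
    using False by (simp add: u_def cinner_scaleC_left complex_norm_square[symmetric]
        power2_eq_square mult.commute[of "cnj _"])
  then have "cmod (cinner f g) = inner (u *\<^sub>C f) g" by (simp flip: Re_cinner)
  also have "\<dots> \<le> norm (u *\<^sub>C f) * norm g" by (rule norm_cauchy_schwarz)
  finally show ?thesis by (simp add: norm_scaleC u)
qed simp

lemma bounded_linear_cinner_left: "bounded_linear (\<lambda>f. cinner f g)"
  by (rule bounded_linear_intro[where K = "norm g"])
    (simp_all add: cinner_add_left cinner_scaleR_left cmod_cinner_le)

lemma cinner_delta_right: "cinner f (delta x) = coord f x"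
proof -
  have "cinner f (delta x) = (\<Sum>\<^sub>\<infinity>y\<in>{x}. coord f x)"
    unfolding cinner_def by (rule infsum_cong_neutral) (auto simp: delta.rep_eq)
  then show ?thesis by simp
qed

lemma cinner_delta_left: "cinner (delta x) f = cnj (coord f x)"
  by (metis cnj_cinner cinner_delta_right)

lemma coord_sum: "coord (sum h F) x = (\<Sum>y\<in>F. coord (h y) x)"
  by (induction F rule: infinite_finite_induct) (simp_all add: zero_ell2.rep_eq plus_ell2.rep_eq)

lemma coord_finite_expansion:
  assumes "finite F"
  shows "coord (\<Sum>y\<in>F. a y *\<^sub>C delta y) x = (if x \<in> F then a x else 0)"
proof -
  have "coord (\<Sum>y\<in>F. a y *\<^sub>C delta y) x = (\<Sum>y\<in>F. if x = y then a y else 0)"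
    unfolding coord_sum by (rule sum.cong) (auto simp: scaleC.rep_eq delta.rep_eq)
  then show ?thesis using assms by simp
qed

lemma norm_square_ell2: "(norm (f :: 'a ell2))\<^sup>2 = (\<Sum>\<^sub>\<infinity>x. (cmod (coord f x))\<^sup>2)"
  by (simp add: norm_ell2_def infsum_nonneg)

lemma norm_square_finite_expansion:
  assumes "finite F"
  shows "(norm (\<Sum>y\<in>F. a y *\<^sub>C delta y))\<^sup>2 = (\<Sum>y\<in>F. (cmod (a y))\<^sup>2)"
proof -
  have "(norm (\<Sum>y\<in>F. a y *\<^sub>C delta y))\<^sup>2 = (\<Sum>\<^sub>\<infinity>x\<in>F. (cmod (a x))\<^sup>2)"
    unfolding norm_square_ell2
    by (rule infsum_cong_neutral) (auto simp: coord_finite_expansion[OF assms])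
  then show ?thesis using assms by simp
qed

lemma has_sum_delta_expansion: "((\<lambda>x. coord f x *\<^sub>C delta x) has_sum f) UNIV"
proof -
  let ?s = "\<lambda>F. \<Sum>x\<in>F. coord f x *\<^sub>C delta x"
  let ?n = "\<lambda>x. (cmod (coord f x))\<^sup>2"
  have dist: "(dist (?s F) f)\<^sup>2 = (norm f)\<^sup>2 - sum ?n F" if F: "finite F" for F
  proof -
    have "(dist (?s F) f)\<^sup>2 = (\<Sum>\<^sub>\<infinity>x\<in>- F. ?n x)"
      unfolding dist_norm norm_square_ell2 minus_ell2.rep_eq coord_finite_expansion[OF F]
      by (rule infsum_cong_neutral) auto
    also have "infsum ?n UNIV = infsum ?n F + infsum ?n (- F)"
      using infsum_Un_disjoint[of ?n F "- F"] F summable_on_subset_banach[OF coord_summable[of f]]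
      by auto
    then have "(\<Sum>\<^sub>\<infinity>x\<in>- F. ?n x) = (norm f)\<^sup>2 - sum ?n F"
      using F by (simp add: norm_square_ell2)
    finally show ?thesis .
  qed
  have "(?n has_sum (norm f)\<^sup>2) UNIV"
    unfolding norm_square_ell2 by (rule has_sum_infsum[OF coord_summable])
  then have lim: "(sum ?n \<longlongrightarrow> (norm f)\<^sup>2) (finite_subsets_at_top UNIV)"
    by (simp add: has_sum_def)
  have "((\<lambda>F. sqrt ((norm f)\<^sup>2 - sum ?n F)) \<longlongrightarrow> sqrt ((norm f)\<^sup>2 - (norm f)\<^sup>2))
      (finite_subsets_at_top UNIV)"
    by (intro tendsto_intros lim)
  moreover have "\<forall>\<^sub>F F in finite_subsets_at_top UNIV. sqrt ((norm f)\<^sup>2 - sum ?n F) = dist (?s F) f"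
    by (rule eventually_finite_subsets_at_top_weakI) (simp flip: dist)
  ultimately have "((\<lambda>F. dist (?s F) f) \<longlongrightarrow> 0) (finite_subsets_at_top UNIV)"
    using Lim_transform_eventually by fastforce
  then show ?thesis unfolding has_sum_def by (subst tendsto_dist_iff)
qed

lemma adjoint_exists:
  assumes "clinear_op T"
  shows "\<exists>S. is_adjoint S T"
proof -
  let ?T = "blinfun_apply T"
  have T_scale: "?T (c *\<^sub>C f) = c *\<^sub>C ?T f" for c f
    using assms by (simp add: clinear_op_def)
  define a where "a g x = cinner g (?T (delta x))" for g x
  have bound: "(\<Sum>x\<in>F. (cmod (a g x))\<^sup>2) \<le> (norm T * norm g)\<^sup>2" if F: "finite F" for g F
  proof -
    define h where "h = (\<Sum>x\<in>F. a g x *\<^sub>C delta x)"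
    let ?N = "\<Sum>x\<in>F. (cmod (a g x))\<^sup>2"
    have h: "(norm h)\<^sup>2 = ?N"
      unfolding h_def by (rule norm_square_finite_expansion[OF F])
    have "cinner (?T h) g = (\<Sum>x\<in>F. a g x * cinner (?T (delta x)) g)"
      unfolding h_def blinfun.sum_right
        linear_sum[OF bounded_linear.linear[OF bounded_linear_cinner_left]]
      by (simp add: T_scale cinner_scaleC_left)
    also have "\<dots> = of_real ?N"
      unfolding of_real_sum
      by (rule sum.cong) (auto simp: a_def complex_norm_square cnj_cinner simp del: of_real_power)
    finally have "?N = cmod (cinner (?T h) g)"
      by (simp add: sum_nonneg del: of_real_sum)
    also have "\<dots> \<le> norm (?T h) * norm g" by (rule cmod_cinner_le)
    also have "\<dots> \<le> (norm T * norm h) * norm g"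
      by (intro mult_right_mono norm_blinfun) simp
    finally have "(norm h)\<^sup>2 \<le> (norm T * norm h) * norm g" by (simp only: h)
    then have "norm h * norm h \<le> norm h * (norm T * norm g)"
      by (simp add: power2_eq_square mult_ac)
    then have "norm h \<le> norm T * norm g"
      by (cases "norm h = 0") (auto simp: mult_le_cancel_left)
    then show ?thesis using h by (metis norm_ge_zero power_mono)
  qed
  have sq: "(\<lambda>x. (cmod (a g x))\<^sup>2) summable_on UNIV" for g
    by (rule nonneg_bdd_above_summable_on)
      (auto intro!: bdd_aboveI2[where M = "(norm T * norm g)\<^sup>2"] bound)
  define S where "S g = Abs_ell2 (a g)" for g
  have S: "coord (S g) x = a g x" for g x
    unfolding S_def using sq by (simp add: Abs_ell2_inverse)
  have "bounded_linear S"
  proof (rule bounded_linear_intro[where K = "norm T"])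
    show "S (f + g) = S f + S g" for f g
      by (rule ell2_eqI) (simp add: S plus_ell2.rep_eq a_def cinner_add_left)
    show "S (r *\<^sub>R f) = r *\<^sub>R S f" for r f
      by (rule ell2_eqI) (simp add: S scaleR_ell2_def scaleC.rep_eq a_def cinner_scaleC_left)
    have "(norm (S g))\<^sup>2 \<le> (norm T * norm g)\<^sup>2" for g
      unfolding norm_square_ell2 S by (rule infsum_le_finite_sums[OF sq]) (rule bound)
    then show "norm (S g) \<le> norm g * norm T" for g
      by (metis mult.commute mult_nonneg_nonneg norm_ge_zero power2_le_imp_le)
  qed
  moreover have "cinner (?T f) g = cinner f (S g)" for f g
  proof -
    have "bounded_linear (\<lambda>f. cinner (?T f) g)"
      by (rule bounded_linear_compose[OF bounded_linear_cinner_left blinfun.bounded_linear_right])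
    from has_sum_bounded_linear[OF this has_sum_delta_expansion[of f]]
    have "((\<lambda>x. coord f x * cnj (coord (S g) x)) has_sum cinner (?T f) g) UNIV"
      by (simp add: o_def T_scale cinner_scaleC_left S a_def cnj_cinner)
    then show ?thesis unfolding cinner_def[of f] by (simp add: infsumI)
  qed
  ultimately show ?thesis
    by (intro exI[of _ "Blinfun S"]) (simp add: is_adjoint_def bounded_linear_Blinfun_apply)
qed

lemma adjoint_unique:
  assumes "is_adjoint S T" and "is_adjoint S' T"
  shows "S = S'"
proof (rule blinfun_eqI, rule ell2_eqI)
  fix g x
  have "cinner (delta x) (blinfun_apply S g) = cinner (delta x) (blinfun_apply S' g)"
    using assms by (simp add: is_adjoint_def)
  then show "coord (blinfun_apply S g) x = coord (blinfun_apply S' g) x"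
    by (simp add: cinner_delta_left)
qed

lemma adj_correct: "clinear_op T \<Longrightarrow> is_adjoint (adj T) T"
  unfolding adj_def by (metis adjoint_exists adjoint_unique theI)


section \<open>Coarse spaces\<close>

locale coarse_space =
  fixes X :: "'a set" and \<E> :: "('a \<times> 'a) set set"
  assumes entourage_subset: "E \<in> \<E> \<Longrightarrow> E \<subseteq> X \<times> X"
    and diagonal: "Id_on X \<in> \<E>"
    and subset_closed: "E \<in> \<E> \<Longrightarrow> F \<subseteq> E \<Longrightarrow> F \<in> \<E>"
    and union_closed: "E \<in> \<E> \<Longrightarrow> F \<in> \<E> \<Longrightarrow> E \<union> F \<in> \<E>"
    and converse_closed: "E \<in> \<E> \<Longrightarrow> E\<inverse> \<in> \<E>"
    and comp_closed: "E \<in> \<E> \<Longrightarrow> F \<in> \<E> \<Longrightarrow> E O F \<in> \<E>"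

text \<open>The library's \<open>E `` {x}\<close> is \<open>E[x] = {y. (x, y) \<in> E}\<close>.\<close>

definition uniformly_locally_finite :: "'a set \<Rightarrow> ('a \<times> 'a) set set \<Rightarrow> bool" where
  "uniformly_locally_finite X \<E> \<longleftrightarrow>
     (\<forall>E\<in>\<E>. \<exists>N::nat. \<forall>x\<in>X. finite (E `` {x}) \<and> card (E `` {x}) \<le> N)"

definition controlled ::
    "('a \<times> 'a) set set \<Rightarrow> ('b \<times> 'b) set set \<Rightarrow> ('a \<Rightarrow> 'b) \<Rightarrow> bool" where
  "controlled \<E> \<F> h \<longleftrightarrow> (\<forall>E\<in>\<E>. map_prod h h ` E \<in> \<F>)"

definition bijectively_coarsely_equivalent ::
    "'a set \<Rightarrow> ('a \<times> 'a) set set \<Rightarrow> 'b set \<Rightarrow> ('b \<times> 'b) set set \<Rightarrow> bool" where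
  "bijectively_coarsely_equivalent X \<E> Y \<F> \<longleftrightarrow>
     (\<exists>b. bij_betw b X Y \<and> controlled \<E> \<F> b \<and> controlled \<F> \<E> (inv_into X b))"


section \<open>Uniform Roe algebras and their isomorphisms\<close>

definition supp :: "('a ell2 \<Rightarrow>\<^sub>L 'a ell2) \<Rightarrow> ('a \<times> 'a) set" where
  "supp T = {(x, x'). cinner (blinfun_apply T (delta x')) (delta x) \<noteq> 0}"

definition uniform_Roe_algebra ::
    "'a set \<Rightarrow> ('a \<times> 'a) set set \<Rightarrow> ('a ell2 \<Rightarrow>\<^sub>L 'a ell2) set" where
  "uniform_Roe_algebra X \<E> = closure {T \<in> bounded_ops X. supp T \<in> \<E>}"

text \<open>
  The topology on \<^typ>\<open>'a ell2 \<Rightarrow>\<^sub>L 'a ell2\<close> is that of the operator norm, and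
  \<open>bounded_ops X\<close> is closed in it.
\<close>

definition star_isomorphism ::
    "(('a ell2 \<Rightarrow>\<^sub>L 'a ell2) \<Rightarrow> ('b ell2 \<Rightarrow>\<^sub>L 'b ell2)) \<Rightarrow>
     ('a ell2 \<Rightarrow>\<^sub>L 'a ell2) set \<Rightarrow> ('b ell2 \<Rightarrow>\<^sub>L 'b ell2) set \<Rightarrow> bool" where
  "star_isomorphism \<Phi> A B \<longleftrightarrow> bij_betw \<Phi> A B \<and>
     (\<forall>S\<in>A. \<forall>T\<in>A. \<Phi> (S + T) = \<Phi> S + \<Phi> T) \<and>
     (\<forall>c. \<forall>T\<in>A. \<Phi> (scaleC_op c T) = scaleC_op c (\<Phi> T)) \<and>
     (\<forall>S\<in>A. \<forall>T\<in>A. \<Phi> (S o\<^sub>L T) = \<Phi> S o\<^sub>L \<Phi> T) \<and>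
     (\<forall>T\<in>A. \<Phi> (adj T) = adj (\<Phi> T))"

definition cstar_isomorphic ::
    "('a ell2 \<Rightarrow>\<^sub>L 'a ell2) set \<Rightarrow> ('b ell2 \<Rightarrow>\<^sub>L 'b ell2) set \<Rightarrow> bool" where
  "cstar_isomorphic A B \<longleftrightarrow> (\<exists>\<Phi>. star_isomorphism \<Phi> A B)"

end

theory Submission
  imports Defs "Jordan_Normal_Form.Determinant"
begin

text \<open>
  The rank one projection at \<open>x\<close> is mapped by the isomorphism \<open>\<Phi>\<close> to the one of a unit vector \<open>xi x\<close>.
  Every \<open>y\<close> admits an \<open>x\<close> for which the \<open>y\<close>-th coordinate of \<open>xi x\<close> is bounded below, uniformly, and
  symmetrically with \<open>x\<close> and \<open>y\<close> exchanged; relating points in this way transports entourages to entourages.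
  To choose the related points injectively, let \<open>f x\<close> be related to \<open>x\<close>.  The solution of the Kadison--Singer
  problem by Marcus, Spielman and Srivastava splits \<open>X\<close> into finitely many pieces \<open>C\<close> for which the vectors
  \<open>xi x\<close>, \<open>x \<in> C\<close>, are a small perturbation, uniformly in the coefficients of linear combinations, of the images
  of the normalised basis vectors at \<open>f x\<close> under \<open>\<Phi> (proj C)\<close>.  After the operators \<open>\<Phi> (proj C)\<close> are approximated by ones with
  support in an entourage, a dimension count yields Hall's condition for the relation of being close to \<open>f x\<close>, hence an
  injection close to \<open>f\<close>.  The Schroeder--Bernstein construction combines the injections of both directions.
\<close>

text \<open>Nothing provides one common entourage that serves to approximate the images of
  infinitely many rank one projections, while finitely many elements of the algebra do have one. So
  points receive finitely many colours, and only the operators \<open>\<Phi> (proj C)\<close> for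
  colour classes C are approximated. Sparse classes make every single perturbation vector short, but
  short vectors can add up; control of all linear combinations costs a paving, and there
  Kadison-Singer enters. The number of colours is then large and uncontrolled, yet the final
  estimate does not feel it, because perturbations of different classes lie in orthogonal ranges.

  The splitting works with p(z) = det (diag z - Gram matrix). Differentiating p(z)^2 once in every
  variable gives the sum, over all subsets U, of the characteristic polynomial of U times that of
  its complement, so positivity can be followed through one derivative at a time. For Bessel bound 1
  the start is 11/10, each derivative lowers its own coordinate by 1/4, and 17/20 is the
  difference.\<close>

section \<open>Mixed characteristic polynomials\<close>

text \<open>The determinant of the principal submatrix of \<open>diag z - H\<close> on \<open>S\<close>, padded by an identity block
  so that its size does not depend on \<open>S\<close>.\<close>

definition charmat :: "nat \<Rightarrow> (nat \<Rightarrow> nat \<Rightarrow> complex) \<Rightarrow> nat set \<Rightarrow> (nat \<Rightarrow> complex) \<Rightarrow> complex Matrix.mat" where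
  "charmat n H S z = Matrix.mat n n (\<lambda>(i, j). if i \<in> S \<and> j \<in> S then (if i = j then z i else 0) - H i j
     else if i = j then 1 else 0)"

definition cpm :: "nat \<Rightarrow> (nat \<Rightarrow> nat \<Rightarrow> complex) \<Rightarrow> nat set \<Rightarrow> (nat \<Rightarrow> complex) \<Rightarrow> complex" where
  "cpm n H S z = Determinant.det (charmat n H S z)"

lemma charmat_carrier: "charmat n H S z \<in> carrier_mat n n"
  by (simp add: charmat_def)

lemma cpm_empty: "cpm n H {} z = 1"
proof -
  have "charmat n H {} z = 1\<^sub>m n"
    by (rule eq_matI) (auto simp: charmat_def)
  then show ?thesis by (simp add: cpm_def)
qed

lemma charmat_upd_notin: "k \<notin> S \<Longrightarrow> charmat n H S (z(k := c)) = charmat n H S z"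
  by (rule eq_matI) (auto simp: charmat_def)

lemma cpm_upd_notin: "k \<notin> S \<Longrightarrow> cpm n H S (z(k := c)) = cpm n H S z"
  by (simp add: cpm_def charmat_upd_notin)

lemma cofactor_cong:
  assumes "A \<in> carrier_mat n n" "B \<in> carrier_mat n n" "i < n" "j < n"
    and "\<And>i' j'. i' < n \<Longrightarrow> j' < n \<Longrightarrow> i' \<noteq> i \<Longrightarrow> j' \<noteq> j \<Longrightarrow> A $$ (i', j') = B $$ (i', j')"
  shows "cofactor A i j = cofactor B i j"
proof -
  have "mat_delete A i j = mat_delete B i j"
    using assms by (intro eq_matI) (auto simp: mat_delete_def)
  then show ?thesis by (simp add: cofactor_def)
qed

text \<open>The minor does not see row and column k, so it is the same for \<open>S\<close>, where
  column k is the padding unit vector and Laplace expansion along it returns the whole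
  determinant.\<close>

lemma cofactor_charmat:
  assumes "k < n" "k \<notin> S"
  shows "cofactor (charmat n H (insert k S) z) k k = cpm n H S z"
proof -
  have "cpm n H S z = (\<Sum>i<n. charmat n H S z $$ (i, k) * cofactor (charmat n H S z) i k)"
    unfolding cpm_def by (rule laplace_expansion_column[OF charmat_carrier assms(1)])
  also have "\<dots> = (\<Sum>i<n. if i = k then cofactor (charmat n H S z) k k else 0)"
    using assms by (intro sum.cong) (auto simp: charmat_def)
  also have "\<dots> = cofactor (charmat n H S z) k k" using assms by simp
  also have "\<dots> = cofactor (charmat n H (insert k S) z) k k"
    using assms by (intro cofactor_cong[OF charmat_carrier charmat_carrier]) (auto simp: charmat_def)
  finally show ?thesis by simp
qed

text \<open>Only the entry at (k, k) contains \<open>z k\<close>, so the determinant is affine in it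
  and its slope is the complementary minor. Thus removing an index is partial
  differentiation.\<close>

lemma cpm_upd:
  assumes "k < n" "k \<notin> S"
  shows "cpm n H (insert k S) (z(k := c)) = cpm n H (insert k S) z + (c - z k) * cpm n H S z"
proof -
  let ?A = "charmat n H (insert k S) z" and ?B = "charmat n H (insert k S) (z(k := c))"
  have "cpm n H (insert k S) (z(k := c)) = (\<Sum>i<n. ?B $$ (i, k) * cofactor ?B i k)"
    unfolding cpm_def by (rule laplace_expansion_column[OF charmat_carrier assms(1)])
  also have "\<dots> = (\<Sum>i<n. ?A $$ (i, k) * cofactor ?A i k + (if i = k then (c - z k) * cofactor ?A k k else 0))"
  proof (rule sum.cong[OF refl])
    fix i assume i: "i \<in> {..<n}"
    have "cofactor ?B i k = cofactor ?A i k"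
      using assms i by (intro cofactor_cong[OF charmat_carrier charmat_carrier]) (auto simp: charmat_def)
    moreover have "?B $$ (i, k) = ?A $$ (i, k) + (if i = k then c - z k else 0)"
      using assms i by (auto simp: charmat_def)
    ultimately show "?B $$ (i, k) * cofactor ?B i k
        = ?A $$ (i, k) * cofactor ?A i k + (if i = k then (c - z k) * cofactor ?A k k else 0)"
      by (auto simp: algebra_simps)
  qed
  also have "\<dots> = (\<Sum>i<n. ?A $$ (i, k) * cofactor ?A i k) + (c - z k) * cofactor ?A k k"
    using assms by (simp add: sum.distrib)
  also have "(\<Sum>i<n. ?A $$ (i, k) * cofactor ?A i k) = cpm n H (insert k S) z"
    unfolding cpm_def by (rule laplace_expansion_column[OF charmat_carrier assms(1), symmetric])
  finally show ?thesis by (simp only: cofactor_charmat[OF assms])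
qed

text \<open>\<open>v\<close> is column k of the adjugate: matrix times adjugate is the determinant
  times the identity, and the diagonal entry of the adjugate at k is the minor on \<open>S\<close>.
  The identity rows of the padding force \<open>v\<close> to vanish off
  \<open>insert k S\<close>.\<close>

lemma cpm_adjugate:
  assumes k: "k < n" "k \<notin> S" and S: "S \<subseteq> {..<n}"
  obtains v where "v k = cpm n H S z" and "\<And>i. i \<notin> insert k S \<Longrightarrow> v i = 0"
    and "\<And>i. i \<in> insert k S \<Longrightarrow> z i * v i - (\<Sum>j\<in>insert k S. H i j * v j)
           = (if i = k then cpm n H (insert k S) z else 0)"
proof -
  let ?A = "charmat n H (insert k S) z"
  define v where "v i = (if i < n then cofactor ?A k i else 0)" for i
  have eq: "(\<Sum>j<n. ?A $$ (i, j) * v j) = (if i = k then cpm n H (insert k S) z else 0)" if i: "i < n" for i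
  proof -
    have "(\<Sum>j<n. ?A $$ (i, j) * v j) = (?A * adj_mat ?A) $$ (i, k)"
      using i k charmat_carrier[of n H "insert k S" z]
      by (auto simp: times_mat_def scalar_prod_def adj_mat_def v_def lessThan_atLeast0 intro!: sum.cong)
    also have "\<dots> = (if i = k then cpm n H (insert k S) z else 0)"
      unfolding adj_mat(2)[OF charmat_carrier] using i k by (simp add: cpm_def)
    finally show ?thesis .
  qed
  have off: "v i = 0" if "i \<notin> insert k S" for i
  proof (cases "i < n")
    case True
    have "(\<Sum>j<n. ?A $$ (i, j) * v j) = (\<Sum>j<n. if j = i then v j else 0)"
      using True that by (intro sum.cong) (auto simp: charmat_def)
    with eq[OF True] True that show ?thesis by auto
  qed (simp add: v_def)
  show ?thesis
  proof (rule that[of v])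
    show "v k = cpm n H S z" using k by (simp add: v_def cofactor_charmat)
    show "v i = 0" if "i \<notin> insert k S" for i using off that .
    show "z i * v i - (\<Sum>j\<in>insert k S. H i j * v j) = (if i = k then cpm n H (insert k S) z else 0)"
      if i: "i \<in> insert k S" for i
    proof -
      have fin: "finite S" using S finite_subset by blast
      have lt: "j < n" if "j \<in> insert k S" for j using that S k by auto
      have "(\<Sum>j<n. ?A $$ (i, j) * v j) = (\<Sum>j\<in>insert k S. ?A $$ (i, j) * v j)"
        using S k off by (intro sum.mono_neutral_right) auto
      also have "\<dots> = (\<Sum>j\<in>insert k S. (if j = i then z i * v i else 0) - H i j * v j)"
      proof (rule sum.cong[OF refl])
        fix j assume j: "j \<in> insert k S"
        have "?A $$ (i, j) = (if i = j then z i else 0) - H i j"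
          unfolding charmat_def index_mat(1)[OF lt[OF i] lt[OF j]] using i j by simp
        then show "?A $$ (i, j) * v j = (if j = i then z i * v i else 0) - H i j * v j"
          by (simp add: left_diff_distrib)
      qed
      also have "\<dots> = z i * v i - (\<Sum>j\<in>insert k S. H i j * v j)"
        using fin i by (simp add: sum_subtractf sum.delta del: sum.insert)
      finally show ?thesis using eq[of i] i S k by auto
    qed
  qed
qed

section \<open>Gram matrices and the form of the characteristic matrix\<close>

lemma cinner_sum_left: "cinner (sum h F) g = (\<Sum>i\<in>F. cinner (h i) g)"
  by (rule linear_sum[OF bounded_linear.linear[OF bounded_linear_cinner_left]])

lemma cinner_sum_right: "cinner g (sum h F) = (\<Sum>i\<in>F. cinner g (h i))"
  by (metis (mono_tags, lifting) cinner_sum_left cnj_cinner cnj_sum sum.cong)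

lemma cinner_self: "cinner f f = complex_of_real ((norm f)\<^sup>2)"
proof -
  have "cnj (cinner f f) = cinner f f" by (rule cnj_cinner)
  then have "cinner f f = complex_of_real (Re (cinner f f))"
    by (metis Reals_cnj_iff of_real_Re)
  then show ?thesis by (simp add: Re_cinner power2_norm_eq_inner)
qed

text \<open>The order of the indices is that of the matrix acting on coefficient vectors: row i
  applied to \<open>a\<close> is the inner product of the combination
  \<open>\<Sum>j. a j *\<^sub>C \<tau> j\<close> with \<open>\<tau> i\<close>.\<close>

definition gram :: "(nat \<Rightarrow> 'a ell2) \<Rightarrow> nat \<Rightarrow> nat \<Rightarrow> complex" where
  "gram \<tau> i j = cinner (\<tau> j) (\<tau> i)"

text \<open>The sesquilinear form of \<open>diag z - gram \<tau>\<close> on \<open>T\<close>. In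
  this shape the Gram part is visibly real on the diagonal, so the imaginary part of
  \<open>zform \<tau> T z a a\<close> depends on \<open>z\<close> and the moduli of \<open>a\<close>
  alone.\<close>

definition zform :: "(nat \<Rightarrow> 'a ell2) \<Rightarrow> nat set \<Rightarrow> (nat \<Rightarrow> complex) \<Rightarrow> (nat \<Rightarrow> complex) \<Rightarrow> (nat \<Rightarrow> complex) \<Rightarrow> complex" where
  "zform \<tau> T z a b = (\<Sum>i\<in>T. z i * a i * cnj (b i)) - cinner (\<Sum>i\<in>T. a i *\<^sub>C \<tau> i) (\<Sum>i\<in>T. b i *\<^sub>C \<tau> i)"

lemma zform_gram:
  "zform \<tau> T z a b = (\<Sum>i\<in>T. cnj (b i) * (z i * a i - (\<Sum>j\<in>T. gram \<tau> i j * a j)))"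
proof -
  have "cinner (\<Sum>i\<in>T. a i *\<^sub>C \<tau> i) (\<Sum>i\<in>T. b i *\<^sub>C \<tau> i)
      = (\<Sum>i\<in>T. cnj (b i) * (\<Sum>j\<in>T. gram \<tau> i j * a j))"
    unfolding cinner_sum_right cinner_scaleC_right
    by (simp add: cinner_sum_left cinner_scaleC_left gram_def mult.commute)
  then show ?thesis
    by (simp add: zform_def sum_subtractf right_diff_distrib mult_ac)
qed

lemma zform_self:
  "zform \<tau> T z a a = (\<Sum>i\<in>T. z i * complex_of_real ((cmod (a i))\<^sup>2))
     - complex_of_real ((norm (\<Sum>i\<in>T. a i *\<^sub>C \<tau> i))\<^sup>2)"
  by (simp add: zform_def cinner_self mult.assoc complex_norm_square del: of_real_power)

lemma cpm_gram_adjugate: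
  assumes k: "k < n" "k \<notin> S" and S: "S \<subseteq> {..<n}"
  obtains v where "v k = cpm n (gram \<tau>) S z" and "\<And>i. i \<notin> insert k S \<Longrightarrow> v i = 0"
    and "\<And>b. zform \<tau> (insert k S) z v b = cnj (b k) * cpm n (gram \<tau>) (insert k S) z"
proof -
  have fin: "finite S" using S finite_subset by blast
  obtain v where v: "v k = cpm n (gram \<tau>) S z" "\<And>i. i \<notin> insert k S \<Longrightarrow> v i = 0"
    "\<And>i. i \<in> insert k S \<Longrightarrow> z i * v i - (\<Sum>j\<in>insert k S. gram \<tau> i j * v j)
           = (if i = k then cpm n (gram \<tau>) (insert k S) z else 0)"
    by (rule cpm_adjugate[OF k S, of "gram \<tau>" z]) blast
  have "zform \<tau> (insert k S) z v b = (\<Sum>i\<in>insert k S. if i = k then cnj (b k) * cpm n (gram \<tau>) (insert k S) z else 0)" for b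
    unfolding zform_gram by (rule sum.cong) (auto simp: v(3) simp del: sum.insert)
  then have "zform \<tau> (insert k S) z v b = cnj (b k) * cpm n (gram \<tau>) (insert k S) z" for b
    using fin by (simp del: sum.insert)
  with v(1,2) show ?thesis by (rule that)
qed

text \<open>Evaluated at the adjugate vector \<open>v\<close>, the form equals the product in
  question. Its imaginary part is the sum of \<open>Im (z i) * (cmod (v i))\<^sup>2\<close>, and
  index k contributes a positive term because \<open>v k\<close> is the nonzero minor.\<close>

lemma cpm_ratio_Im_pos:
  assumes k: "k < n" "k \<notin> S" and S: "S \<subseteq> {..<n}" and z: "\<And>i. Im (z i) > 0"
    and nz: "cpm n (gram \<tau>) S z \<noteq> 0"
  shows "Im (cpm n (gram \<tau>) (insert k S) z * cnj (cpm n (gram \<tau>) S z)) > 0"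
proof -
  have fin: "finite (insert k S)" using S finite_subset by blast
  obtain v where v: "v k = cpm n (gram \<tau>) S z"
    "\<And>b. zform \<tau> (insert k S) z v b = cnj (b k) * cpm n (gram \<tau>) (insert k S) z"
    by (rule cpm_gram_adjugate[OF k S, of \<tau> z]) blast
  have "0 < Im (z k) * (cmod (v k))\<^sup>2" using z nz v by simp
  also have "\<dots> \<le> (\<Sum>i\<in>insert k S. Im (z i) * (cmod (v i))\<^sup>2)"
    using fin z
    by (intro member_le_sum[where f = "\<lambda>i. Im (z i) * (cmod (v i))\<^sup>2"])
      (simp_all add: mult_nonneg_nonneg less_imp_le)
  also have "\<dots> = Im (zform \<tau> (insert k S) z v v)"
    by (simp add: zform_self del: of_real_power)
  finally show ?thesis by (simp add: v mult.commute)
qed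

lemma cpm_stable:
  assumes "S \<subseteq> {..<n}" and z: "\<And>i. Im (z i) > 0"
  shows "cpm n (gram \<tau>) S z \<noteq> 0"
proof -
  have "finite S" using assms(1) finite_subset by blast
  then show ?thesis using assms(1)
  proof (induction S rule: finite_induct)
    case (insert k S)
    then have "Im (cpm n (gram \<tau>) (insert k S) z * cnj (cpm n (gram \<tau>) S z)) > 0"
      using z by (intro cpm_ratio_Im_pos) auto
    then show ?case by auto
  qed (simp add: cpm_empty)
qed

section \<open>Mixed polynomials as functions of a single variable\<close>

text \<open>The mixed characteristic polynomial of a random splitting of \<open>J\<close>, with the items of \<open>S1\<close>
  and \<open>S2\<close> already assigned to the first and the second part.\<close>

definition mixed :: "(nat set \<Rightarrow> (nat \<Rightarrow> complex) \<Rightarrow> complex) \<Rightarrow> nat set \<Rightarrow> nat set \<Rightarrow> nat set \<Rightarrow>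
    (nat \<Rightarrow> complex) \<Rightarrow> (nat \<Rightarrow> complex) \<Rightarrow> complex" where
  "mixed g J S1 S2 z w = (\<Sum>U\<in>Pow J. g (S1 \<union> U) z * g (S2 \<union> (J - U)) w)"

lemma mixed_empty: "mixed g {} S1 S2 z w = g S1 z * g S2 w"
  by (simp add: mixed_def)

lemma mixed_insert:
  assumes "finite J" "k \<notin> J"
  shows "mixed g (insert k J) S1 S2 z w = mixed g J (insert k S1) S2 z w + mixed g J S1 (insert k S2) z w"
proof -
  have inj: "inj_on (insert k) (Pow J)" using assms(2) by (auto simp: inj_on_def)
  have "mixed g (insert k J) S1 S2 z w
      = (\<Sum>U\<in>Pow J. g (S1 \<union> U) z * g (S2 \<union> (insert k J - U)) w)
        + (\<Sum>U\<in>insert k ` Pow J. g (S1 \<union> U) z * g (S2 \<union> (insert k J - U)) w)"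
    unfolding mixed_def Pow_insert using assms by (intro sum.union_disjoint) auto
  also have "(\<Sum>U\<in>insert k ` Pow J. g (S1 \<union> U) z * g (S2 \<union> (insert k J - U)) w)
      = (\<Sum>U\<in>Pow J. g (S1 \<union> insert k U) z * g (S2 \<union> (insert k J - insert k U)) w)"
    by (simp add: sum.reindex[OF inj])
  also have "\<dots> = mixed g J (insert k S1) S2 z w"
    unfolding mixed_def
  proof (rule sum.cong[OF refl])
    fix U assume "U \<in> Pow J"
    then have "insert k J - insert k U = J - U" "S1 \<union> insert k U = insert k S1 \<union> U" using assms by auto
    then show "g (S1 \<union> insert k U) z * g (S2 \<union> (insert k J - insert k U)) w
      = g (insert k S1 \<union> U) z * g (S2 \<union> (J - U)) w" by simp
  qed
  also have "(\<Sum>U\<in>Pow J. g (S1 \<union> U) z * g (S2 \<union> (insert k J - U)) w) = mixed g J S1 (insert k S2) z w"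
    unfolding mixed_def
  proof (rule sum.cong[OF refl])
    fix U assume "U \<in> Pow J"
    then have "S2 \<union> (insert k J - U) = insert k S2 \<union> (J - U)" using assms by auto
    then show "g (S1 \<union> U) z * g (S2 \<union> (insert k J - U)) w
      = g (S1 \<union> U) z * g (insert k S2 \<union> (J - U)) w" by simp
  qed
  finally show ?thesis by simp
qed

text \<open>The barrier argument sees determinants only through these facts. By \<open>g_upd\<close>
  the derivative of \<open>g (insert k S)\<close> in variable k is \<open>g S\<close>, so all
  iterated partial derivatives stay inside the family.\<close>

locale stable_family =
  fixes n :: nat and g :: "nat set \<Rightarrow> (nat \<Rightarrow> complex) \<Rightarrow> complex"
  assumes g_upd_notin: "\<And>k S z c. k \<notin> S \<Longrightarrow> g S (z(k := c)) = g S z"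
    and g_upd: "\<And>k S z c. k < n \<Longrightarrow> k \<notin> S \<Longrightarrow> g (insert k S) (z(k := c)) = g (insert k S) z + (c - z k) * g S z"
    and g_stable: "\<And>S z. S \<subseteq> {..<n} \<Longrightarrow> (\<And>i. Im (z i) > 0) \<Longrightarrow> g S z \<noteq> 0"
begin

abbreviation "Q \<equiv> mixed g"

lemma Q_upd1:
  assumes "k < n" "k \<notin> J" "k \<notin> S1"
  shows "Q J (insert k S1) S2 (z(k := c)) w = Q J (insert k S1) S2 z w + (c - z k) * Q J S1 S2 z w"
proof -
  have "g (insert k S1 \<union> U) (z(k := c)) = g (insert k S1 \<union> U) z + (c - z k) * g (S1 \<union> U) z"
    if "U \<in> Pow J" for U
    using g_upd[of k "S1 \<union> U" z c] assms that by auto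
  then have "Q J (insert k S1) S2 (z(k := c)) w = (\<Sum>U\<in>Pow J. g (insert k S1 \<union> U) z * g (S2 \<union> (J - U)) w
      + (c - z k) * (g (S1 \<union> U) z * g (S2 \<union> (J - U)) w))"
    unfolding mixed_def by (intro sum.cong refl) (simp del: fun_upd_apply Un_insert_left add: ring_distribs)
  then show ?thesis by (simp add: mixed_def sum.distrib sum_distrib_left)
qed

lemma Q_upd2:
  assumes "k < n" "k \<notin> J" "k \<notin> S2"
  shows "Q J S1 (insert k S2) z (w(k := c)) = Q J S1 (insert k S2) z w + (c - w k) * Q J S1 S2 z w"
proof -
  have "g (insert k S2 \<union> U) (w(k := c)) = g (insert k S2 \<union> U) w + (c - w k) * g (S2 \<union> U) w"
    if "U \<in> Pow J" for U
    using g_upd[of k "S2 \<union> U" w c] assms that by auto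
  then have "g (insert k S2 \<union> (J - U)) (w(k := c)) = g (insert k S2 \<union> (J - U)) w + (c - w k) * g (S2 \<union> (J - U)) w"
    if "U \<in> Pow J" for U by blast
  then have "Q J S1 (insert k S2) z (w(k := c)) = (\<Sum>U\<in>Pow J. g (S1 \<union> U) z * g (insert k S2 \<union> (J - U)) w
      + (c - w k) * (g (S1 \<union> U) z * g (S2 \<union> (J - U)) w))"
    unfolding mixed_def by (intro sum.cong refl) (simp del: fun_upd_apply Un_insert_left add: ring_distribs)
  then show ?thesis by (simp add: mixed_def sum.distrib sum_distrib_left)
qed

lemma Q_upd1_notin: "k \<notin> J \<Longrightarrow> k \<notin> S1 \<Longrightarrow> Q J S1 S2 (z(k := c)) w = Q J S1 S2 z w"
  unfolding mixed_def by (intro sum.cong refl arg_cong2[where f = "(*)"] g_upd_notin) auto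

lemma Q_upd2_notin: "k \<notin> J \<Longrightarrow> k \<notin> S2 \<Longrightarrow> Q J S1 S2 z (w(k := c)) = Q J S1 S2 z w"
  unfolding mixed_def by (intro sum.cong refl arg_cong2[where f = "(*)"] g_upd_notin) auto

end

text \<open>The zero \<open>z - a / d\<close> of the affine function must avoid the open upper half
  plane, so the imaginary part of \<open>a / d\<close> is at least that of \<open>z\<close>.\<close>

lemma affine_nonzero_Im_pos:
  assumes nz: "\<And>c. Im c > 0 \<Longrightarrow> a + (c - z) * d \<noteq> 0" and z: "Im z > 0" and d: "d \<noteq> 0"
  shows "Im (a * cnj d) > 0"
proof -
  have "a + ((z - a / d) - z) * d = 0" using d by simp
  then have "Im (z - a / d) \<le> 0" using nz by (metis not_le)
  define e where "e = a / d"
  have "Im e > 0" using z \<open>Im (z - a / d) \<le> 0\<close> by (simp add: e_def)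
  moreover have "a * cnj d = e * complex_of_real ((cmod d)\<^sup>2)"
    using d by (simp add: e_def complex_norm_square del: of_real_power)
  ultimately show ?thesis using d by (simp del: of_real_power)
qed

lemma nonpos_of_quadratic_limit:
  fixes a w :: real
  assumes "\<And>t. t > 0 \<Longrightarrow> a * t\<^sup>2 + w \<le> 0"
  shows "w \<le> 0"
proof (rule tendsto_upperbound)
  have "((\<lambda>t. a * t\<^sup>2 + w) \<longlongrightarrow> a * 0\<^sup>2 + w) (at_right 0)" by (intro tendsto_intros)
  then show "((\<lambda>t. a * t\<^sup>2 + w) \<longlongrightarrow> w) (at_right 0)" by simp
  show "\<forall>\<^sub>F t in at_right 0. a * t\<^sup>2 + w \<le> 0"
    using assms by (auto simp: eventually_at_right_less intro: eventually_mono[OF eventually_at_right_less[of 0]])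
qed simp

text \<open>The coefficients are the 2x2 minors of the two coefficient rows. After division by t
  they become, for t tending to 0, the Wronskian N' p - N p' at s of the quadratics N (primed
  coefficients) and p (unprimed).\<close>

lemma Im_quadratics:
  fixes a b c a' b' c' s t :: real
  shows "Im ((complex_of_real a' * (Complex s t)\<^sup>2 + complex_of_real b' * Complex s t + complex_of_real c')
      * cnj (complex_of_real a * (Complex s t)\<^sup>2 + complex_of_real b * Complex s t + complex_of_real c))
    = t * ((a' * b - b' * a) * (s\<^sup>2 + t\<^sup>2) + 2 * (a' * c - c' * a) * s + (b' * c - c' * b))"
  by (simp add: power2_eq_square algebra_simps)

text \<open>As a comparison of quotients, for N with the primed and p with the unprimed
  coefficients: N'(u - d) / p'(u - d) is at most N(u) / p(u). The hypothesis \<open>W\<close> says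
  that the Wronskian N' p - N p' is nowhere positive, which is the case d = 0. For d > 0 an error
  linear in d appears, and the bound on d, half of the Newton step p / p', keeps it below the
  Wronskian.\<close>

lemma barrier_quadratics:
  fixes a b c a' b' c' u d :: real
  defines "A \<equiv> a' * b - b' * a" and "B \<equiv> a' * c - c' * a" and "C \<equiv> b' * c - c' * b"
  assumes W: "\<And>s. A * s\<^sup>2 + 2 * B * s + C \<le> 0"
    and a: "a > 0" and P: "a * u\<^sup>2 + b * u + c > 0" and P': "2 * a * u + b > 0"
    and d: "0 \<le> d" "2 * d * (2 * a * u + b) \<le> a * u\<^sup>2 + b * u + c"
  shows "(2 * a' * (u - d) + b') * (a * u\<^sup>2 + b * u + c) \<le> (a' * u\<^sup>2 + b' * u + c') * (2 * a * (u - d) + b)"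
proof -
  define p where "p = a * u\<^sup>2 + b * u + c"
  define p' where "p' = 2 * a * u + b"
  define w where "w = A * u\<^sup>2 + 2 * B * u + C"
  define q where "q = A * u + B"
  have eq: "(a' * u\<^sup>2 + b' * u + c') * (2 * a * (u - d) + b) - (2 * a' * (u - d) + b') * p = - w + 2 * d * q"
    unfolding w_def q_def p_def A_def B_def C_def by (simp add: algebra_simps power2_eq_square)
  have idn: "q * p' = A * p + a * w"
    unfolding w_def q_def p_def p'_def A_def B_def C_def by (simp add: algebra_simps power2_eq_square)
  have w0: "w \<le> 0" unfolding w_def by (rule W)
  have p0: "p > 0" and p'0: "p' > 0" and d': "2 * d * p' \<le> p"
    using P P' d by (simp_all add: p_def p'_def)
  have "- w + 2 * d * q \<ge> 0"
  proof (cases "q \<ge> 0")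
    case True
    then have "2 * d * q \<ge> 0" using d by simp
    with w0 show ?thesis by linarith
  next
    case False
    then have q: "q < 0" by simp
    \<comment> \<open>A nonnegative leading coefficient is incompatible with \<open>W\<close>: for A
      = 0 the linear term must vanish, so that q = 0, and for A > 0 the value at the point
      \<open>t\<close> below is positive.\<close>
    have A: "A < 0"
    proof (rule ccontr)
      assume "\<not> A < 0"
      then have "A * p \<ge> 0" using p0 by simp
      show False
      proof (cases "A = 0")
        case True
        then have "2 * B * ((1 - C) / (2 * B)) + C \<le> 0" if "B \<noteq> 0" using W[of "(1 - C) / (2 * B)"] by simp
        then have "B = 0" by (cases "B = 0") auto
        with True q show False by (simp add: q_def)
      next
        case False
        with \<open>\<not> A < 0\<close> have A0: "A > 0" by simp
        define t where "t = 1 + \<bar>B\<bar> / A * 2 + \<bar>C\<bar> / A"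
        have t1: "t \<ge> 1" using A0 by (simp add: t_def)
        have "A * t = A + 2 * \<bar>B\<bar> + \<bar>C\<bar>" using A0 by (simp add: t_def field_simps)
        then have "A * t\<^sup>2 = (A + 2 * \<bar>B\<bar> + \<bar>C\<bar>) * t" by (simp add: power2_eq_square)
        also have "\<dots> = A * t + 2 * \<bar>B\<bar> * t + \<bar>C\<bar> * t" by (simp add: algebra_simps)
        finally have "A * t\<^sup>2 + 2 * B * t + C = A * t + 2 * (\<bar>B\<bar> + B) * t + (\<bar>C\<bar> * t + C)" by (simp add: algebra_simps)
        moreover have "A * t > 0" "2 * (\<bar>B\<bar> + B) * t \<ge> 0" using A0 t1 by auto
        moreover have "\<bar>C\<bar> * 1 \<le> \<bar>C\<bar> * t" using t1 by (intro mult_left_mono) auto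
        ultimately show False using W[of t] by linarith
      qed
    qed
    \<comment> \<open>The vertex of the concave parabola gives the discriminant inequality, from
      which \<open>A * w\<close> dominates the square of \<open>q\<close>.\<close>
    have "A * (- B / A)\<^sup>2 + 2 * B * (- B / A) + C \<le> 0" by (rule W)
    moreover have "A * (- B / A)\<^sup>2 + 2 * B * (- B / A) + C = C - B\<^sup>2 / A"
      using A by (simp add: field_simps power2_eq_square)
    ultimately have C: "C \<le> B\<^sup>2 / A" by simp
    have Aw: "A * w \<ge> q\<^sup>2"
    proof -
      have "A * w - q\<^sup>2 = A * C - B\<^sup>2" by (simp add: w_def q_def algebra_simps power2_eq_square)
      moreover have "A * C \<ge> A * (B\<^sup>2 / A)" using A C by (intro mult_left_mono_neg) auto
      ultimately show ?thesis using A by simp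
    qed
    have "q * p' \<le> A * p" using idn w0 a by (simp add: mult_nonneg_nonpos)
    then have "q * (q * p') \<ge> q * (A * p)" using q by (intro mult_left_mono_neg) auto
    then have "A * (q * p) \<le> q\<^sup>2 * p'" by (simp add: power2_eq_square mult_ac)
    also have "\<dots> \<le> A * w * p'" using Aw p'0 by (intro mult_right_mono) auto
    finally have "A * (q * p) \<le> A * (w * p')" by (simp add: mult_ac)
    then have 1: "w * p' \<le> q * p" using A by simp
    have "q * p \<le> q * (2 * d * p')" using q d' by (intro mult_left_mono_neg) auto
    with 1 have "w * p' \<le> (2 * d * q) * p'" by (simp add: mult_ac)
    then have "w \<le> 2 * d * q" using p'0 by simp
    then show ?thesis by simp
  qed
  with eq show ?thesis unfolding p_def by linarith
qed

section \<open>Stability of mixed polynomials and signs of their ratios\<close>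

context stable_family
begin

lemma Q_insert_J: "finite J \<Longrightarrow> k \<notin> J \<Longrightarrow> Q (insert k J) S1 S2 z w = Q J (insert k S1) S2 z w + Q J S1 (insert k S2) z w"
  by (rule mixed_insert)

lemma Q_ratio1_aux:
  assumes k: "k < n" "k \<notin> J" "k \<notin> S1" and z: "\<And>i. Im (z i) > 0"
    and nz: "\<And>z. (\<And>i. Im (z i) > 0) \<Longrightarrow> Q J (insert k S1) S2 z w \<noteq> 0" "Q J S1 S2 z w \<noteq> 0"
  shows "Im (Q J (insert k S1) S2 z w * cnj (Q J S1 S2 z w)) > 0"
proof (rule affine_nonzero_Im_pos[where z = "z k"])
  fix c :: complex assume "Im c > 0"
  then have "Q J (insert k S1) S2 (z(k := c)) w \<noteq> 0" using z by (intro nz) auto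
  then show "Q J (insert k S1) S2 z w + (c - z k) * Q J S1 S2 z w \<noteq> 0"
    by (simp only: Q_upd1[OF k] not_False_eq_True)
qed (use z nz in auto)

lemma Q_ratio2_aux:
  assumes k: "k < n" "k \<notin> J" "k \<notin> S2" and w: "\<And>i. Im (w i) > 0"
    and nz: "\<And>w. (\<And>i. Im (w i) > 0) \<Longrightarrow> Q J S1 (insert k S2) z w \<noteq> 0" "Q J S1 S2 z w \<noteq> 0"
  shows "Im (Q J S1 (insert k S2) z w * cnj (Q J S1 S2 z w)) > 0"
proof (rule affine_nonzero_Im_pos[where z = "w k"])
  fix c :: complex assume "Im c > 0"
  then have "Q J S1 (insert k S2) z (w(k := c)) \<noteq> 0" using w by (intro nz) auto
  then show "Q J S1 (insert k S2) z w + (c - w k) * Q J S1 S2 z w \<noteq> 0"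
    by (simp only: Q_upd2[OF k] not_False_eq_True)
qed (use w nz in auto)

text \<open>The two summands in \<open>Q_insert_J\<close> cannot cancel: divided by \<open>Q J S1 S2\<close>, both lie in the upper half plane.\<close>

lemma Q_stable:
  assumes "J \<subseteq> {..<n}" "S1 \<subseteq> {..<n}" "S2 \<subseteq> {..<n}" "S1 \<inter> J = {}" "S2 \<inter> J = {}"
    and "\<And>i. Im (z i) > 0" "\<And>i. Im (w i) > 0"
  shows "Q J S1 S2 z w \<noteq> 0"
proof -
  have "finite J" using assms(1) finite_subset by blast
  then show ?thesis using assms
  proof (induction J arbitrary: S1 S2 z w rule: finite_induct)
    case (insert k J)
    have *: "Q J T1 T2 z w \<noteq> 0" if "T1 \<subseteq> {..<n}" "T2 \<subseteq> {..<n}" "T1 \<inter> J = {}" "T2 \<inter> J = {}"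
      "\<And>i. Im (z i) > 0" "\<And>i. Im (w i) > 0" for T1 T2 z w
      using insert.prems insert.IH that by auto
    have "Im (Q J (insert k S1) S2 z w * cnj (Q J S1 S2 z w)) > 0"
      using insert.prems insert.hyps by (intro Q_ratio1_aux *) auto
    moreover have "Im (Q J S1 (insert k S2) z w * cnj (Q J S1 S2 z w)) > 0"
      using insert.prems insert.hyps by (intro Q_ratio2_aux *) auto
    ultimately have "Im (Q (insert k J) S1 S2 z w * cnj (Q J S1 S2 z w)) > 0"
      using insert.hyps by (simp add: Q_insert_J ring_distribs)
    then show ?case by auto
  qed (simp add: mixed_empty g_stable)
qed

lemma Q_ratio1:
  assumes "J \<subseteq> {..<n}" "S1 \<subseteq> {..<n}" "S2 \<subseteq> {..<n}" "S1 \<inter> J = {}" "S2 \<inter> J = {}"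
    and "\<And>i. Im (z i) > 0" "\<And>i. Im (w i) > 0" and "k < n" "k \<notin> J" "k \<notin> S1"
  shows "Im (Q J (insert k S1) S2 z w * cnj (Q J S1 S2 z w)) > 0"
  using assms by (intro Q_ratio1_aux Q_stable) auto

lemma Q_ratio2:
  assumes "J \<subseteq> {..<n}" "S1 \<subseteq> {..<n}" "S2 \<subseteq> {..<n}" "S1 \<inter> J = {}" "S2 \<inter> J = {}"
    and "\<And>i. Im (z i) > 0" "\<And>i. Im (w i) > 0" and "k < n" "k \<notin> J" "k \<notin> S2"
  shows "Im (Q J S1 (insert k S2) z w * cnj (Q J S1 S2 z w)) > 0"
  using assms by (intro Q_ratio2_aux Q_stable) auto

lemma Q_ratio:
  assumes "J \<subseteq> {..<n}" "S1 \<subseteq> {..<n}" "S2 \<subseteq> {..<n}" "S1 \<inter> J = {}" "S2 \<inter> J = {}"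
    and "\<And>i. Im (z i) > 0" "\<And>i. Im (w i) > 0" and "k < n" "k \<notin> J" "k \<notin> S1" "k \<notin> S2"
  shows "Im (Q (insert k J) S1 S2 z w * cnj (Q J S1 S2 z w)) > 0"
proof -
  have "finite J" using assms(1) finite_subset by blast
  then show ?thesis
    using Q_ratio1[of J S1 S2 z w k] Q_ratio2[of J S1 S2 z w k] assms by (simp add: Q_insert_J ring_distribs)
qed

text \<open>With equal arguments the first factor is the derivative in variable k of the second, so
  this is the sign of a logarithmic derivative. It holds since, relative to the second factor, each
  of the two summands from \<open>Q_insert_J\<close> is the reciprocal of a ratio in the upper half
  plane.\<close>

lemma Q_dlog:
  assumes "J \<subseteq> {..<n}" "S \<subseteq> {..<n}" "S \<inter> J = {}" and z: "\<And>i. Im (z i) > 0" and k: "k < n" "k \<notin> J" "k \<notin> S"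
  shows "Im (Q (insert k J) S S z z * cnj (Q J (insert k S) (insert k S) z z)) < 0"
proof -
  have "finite J" using assms(1) finite_subset by blast
  moreover have "Im (Q J (insert k S) (insert k S) z z * cnj (Q J S (insert k S) z z)) > 0"
    using assms by (intro Q_ratio1) auto
  moreover have "Im (Q J (insert k S) (insert k S) z z * cnj (Q J (insert k S) S z z)) > 0"
    using assms by (intro Q_ratio2) auto
  ultimately show ?thesis
    using k by (simp add: Q_insert_J ring_distribs mult.commute)
qed

text \<open>Variable k occurs once in each factor, hence quadratically when both arguments agree.
  Comparing the two formulas shows that moving k into \<open>J\<close> is differentiation in that
  variable.\<close>

lemma Q_quadratic:
  fixes z :: "nat \<Rightarrow> complex"
  assumes J: "J \<subseteq> {..<n}" and k: "k < n" "k \<notin> J" "k \<notin> S"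
  defines "z0 \<equiv> z(k := 0)"
  shows "Q J (insert k S) (insert k S) (z(k := c)) (z(k := c))
      = Q J S S z z * c\<^sup>2 + Q (insert k J) S S z0 z0 * c + Q J (insert k S) (insert k S) z0 z0"
    and "Q (insert k J) S S (z(k := c)) (z(k := c)) = 2 * Q J S S z z * c + Q (insert k J) S S z0 z0"
proof -
  have fin: "finite J" using J finite_subset by blast
  have z: "z(k := c) = z0(k := c)" by (simp add: z0_def)
  have zk: "z0 k = 0" by (simp add: z0_def)
  have eq: "Q J S S z0 z0 = Q J S S z z"
    unfolding z0_def using k by (simp add: Q_upd1_notin Q_upd2_notin del: fun_upd_apply)
  show "Q J (insert k S) (insert k S) (z(k := c)) (z(k := c))
      = Q J S S z z * c\<^sup>2 + Q (insert k J) S S z0 z0 * c + Q J (insert k S) (insert k S) z0 z0"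
    unfolding z eq[symmetric] Q_upd1[OF k] Q_upd2[OF k] Q_insert_J[OF fin k(2)] zk
    by (simp add: algebra_simps power2_eq_square)
  have "Q J (insert k S) S (z0(k := c)) (z0(k := c)) = Q J (insert k S) S z0 z0 + c * Q J S S z0 z0"
    unfolding Q_upd2_notin[OF k(2,3)] Q_upd1[OF k] zk by simp
  moreover have "Q J S (insert k S) (z0(k := c)) (z0(k := c)) = Q J S (insert k S) z0 z0 + c * Q J S S z0 z0"
    unfolding Q_upd1_notin[OF k(2,3)] Q_upd2[OF k] zk by simp
  ultimately show "Q (insert k J) S S (z(k := c)) (z(k := c)) = 2 * Q J S S z z * c + Q (insert k J) S S z0 z0"
    unfolding z eq[symmetric] Q_insert_J[OF fin k(2)] by (simp add: algebra_simps)
qed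

end

section \<open>Barrier points and interlacing\<close>

text \<open>The quotient h is real on the real ray and has nonnegative imaginary part above it. At a
  real point the vertical derivative of \<open>Im h\<close> equals the real part of h', and it
  cannot be negative because \<open>Im h\<close> starts from 0.\<close>

lemma pick_function_mono:
  fixes p q :: "complex \<Rightarrow> complex" and \<rho> x y :: real
  assumes hol: "p holomorphic_on UNIV" "q holomorphic_on UNIV"
    and real: "\<And>x::real. Im (p (of_real x)) = 0" "\<And>x::real. Im (q (of_real x)) = 0"
    and upper: "\<And>z. Im z > 0 \<Longrightarrow> Im (p z * cnj (q z)) \<ge> 0"
    and nz: "\<And>x::real. x \<ge> \<rho> \<Longrightarrow> q (of_real x) \<noteq> 0"
    and xy: "\<rho> \<le> x" "x \<le> y"
  shows "Re (p (of_real x)) / Re (q (of_real x)) \<le> Re (p (of_real y)) / Re (q (of_real y))"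
proof -
  define h where "h z = p z / q z" for z
  have hr: "h (of_real x) = of_real (Re (p (of_real x)) / Re (q (of_real x)))" for x
    by (simp add: h_def complex_eq_iff real Re_divide Im_divide power2_eq_square)
  have up: "Im (h z) \<ge> 0" if "Im z > 0" for z
  proof -
    have "Im (h z) = Im (p z * cnj (q z)) / (cmod (q z))\<^sup>2"
      by (simp add: h_def Im_divide cmod_power2)
    then show ?thesis using upper[OF that] by simp
  qed
  have der: "\<exists>D. ((\<lambda>x. Re (h (of_real x))) has_real_derivative D) (at u) \<and> D \<ge> 0" if u: "u \<ge> \<rho>" for u
  proof -
    have "p field_differentiable at (of_real u)" "q field_differentiable at (of_real u)"
      using hol by (auto simp: holomorphic_on_def)
    then have "h field_differentiable at (of_real u)"
      unfolding h_def using nz[OF u] by (intro field_differentiable_divide)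
    then obtain D where D: "(h has_field_derivative D) (at (of_real u))"
      by (auto simp: field_differentiable_def)
    have 1: "((\<lambda>x. Re (h (of_real x))) has_real_derivative Re D) (at u)"
      by (rule has_field_derivative_Re[OF has_vector_derivative_real_field[OF D]])
    have "((\<lambda>z. h (of_real u + \<i> * z)) has_field_derivative D * \<i>) (at (of_real 0))"
      by (rule DERIV_chain2[where f = h]) (use D in \<open>auto intro!: derivative_eq_intros\<close>)
    from has_field_derivative_Im[OF has_vector_derivative_real_field[OF this]]
    have 2: "((\<lambda>t. Im (h (of_real u + \<i> * of_real t))) has_real_derivative Re D) (at 0)" by simp
    have "Re D \<ge> 0"
    proof (rule ccontr)
      assume "\<not> Re D \<ge> 0"
      then obtain d where d: "d > 0"
        "\<And>s. s > 0 \<Longrightarrow> s < d \<Longrightarrow> Im (h (of_real u + \<i> * of_real (0 + s))) < Im (h (of_real u + \<i> * of_real 0))"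
        using DERIV_neg_dec_right[OF 2] by auto
      have "Im (h (of_real u + \<i> * of_real (0 + d / 2))) < Im (h (of_real u + \<i> * of_real 0))"
        using d by (intro d(2)) auto
      also have "\<dots> = 0" by (simp add: hr)
      finally show False using up[of "of_real u + \<i> * of_real (0 + d / 2)"] d by simp
    qed
    with 1 show ?thesis by blast
  qed
  have "Re (h (of_real x)) \<le> Re (h (of_real y))"
    by (rule DERIV_nonneg_imp_nondecreasing[OF xy(2)]) (use der xy in force)
  then show ?thesis unfolding hr by simp
qed

locale real_stable_family = stable_family +
  assumes g_line: "\<And>S a b. S \<subseteq> {..<n} \<Longrightarrow> (\<lambda>x. g S (\<lambda>i. a i + x * b i)) holomorphic_on UNIV"
    and g_cnj: "\<And>S z. S \<subseteq> {..<n} \<Longrightarrow> g S (\<lambda>i. cnj (z i)) = cnj (g S z)"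
begin

definition R :: "nat set \<Rightarrow> nat set \<Rightarrow> nat set \<Rightarrow> (nat \<Rightarrow> real) \<Rightarrow> real" where
  "R J S1 S2 x = Re (Q J S1 S2 (\<lambda>i. of_real (x i)) (\<lambda>i. of_real (x i)))"

lemma Q_line:
  assumes "J \<subseteq> {..<n}" "S1 \<subseteq> {..<n}" "S2 \<subseteq> {..<n}"
  shows "(\<lambda>x. Q J S1 S2 (\<lambda>i. a i + x * b i) (\<lambda>i. a i + x * b i)) holomorphic_on UNIV"
  unfolding mixed_def using assms by (intro holomorphic_intros g_line) auto

lemma Q_cnj:
  assumes "J \<subseteq> {..<n}" "S1 \<subseteq> {..<n}" "S2 \<subseteq> {..<n}"
  shows "Q J S1 S2 (\<lambda>i. cnj (z i)) (\<lambda>i. cnj (w i)) = cnj (Q J S1 S2 z w)"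
proof -
  have "g (S1 \<union> U) (\<lambda>i. cnj (z i)) * g (S2 \<union> (J - U)) (\<lambda>i. cnj (w i))
      = cnj (g (S1 \<union> U) z * g (S2 \<union> (J - U)) w)" if "U \<in> Pow J" for U
    using g_cnj[of "S1 \<union> U" z] g_cnj[of "S2 \<union> (J - U)" w] assms that by auto
  then show ?thesis unfolding mixed_def by simp
qed

lemma Q_real:
  assumes "J \<subseteq> {..<n}" "S1 \<subseteq> {..<n}" "S2 \<subseteq> {..<n}"
  shows "Q J S1 S2 (\<lambda>i. of_real (x i)) (\<lambda>i. of_real (x i)) = of_real (R J S1 S2 x)"
proof -
  have "Im (Q J S1 S2 (\<lambda>i. of_real (x i)) (\<lambda>i. of_real (x i))) = 0"
    using Q_cnj[OF assms, of "\<lambda>i. of_real (x i)" "\<lambda>i. of_real (x i)"] by (simp add: complex_eq_iff)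
  then show ?thesis by (simp add: R_def complex_eq_iff)
qed

lemma R_insert: "finite J \<Longrightarrow> k \<notin> J \<Longrightarrow> R (insert k J) S1 S2 x = R J (insert k S1) S2 x + R J S1 (insert k S2) x"
  by (simp add: R_def Q_insert_J)

text \<open>Shift all variables by \<open>\<i> * t\<close> and let t tend to 0: real arguments
  become admissible at the price of strictness.\<close>

lemma Q_dlog_closure:
  assumes J: "J \<subseteq> {..<n}" "S \<subseteq> {..<n}" "S \<inter> J = {}" and z: "\<And>i. Im (z i) \<ge> 0"
    and k: "k < n" "k \<notin> J" "k \<notin> S"
  shows "Im (Q (insert k J) S S z z * cnj (Q J (insert k S) (insert k S) z z)) \<le> 0"
proof -
  define f where "f x = Q (insert k J) S S (\<lambda>i. z i + x * \<i>) (\<lambda>i. z i + x * \<i>)" for x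
  define h where "h x = Q J (insert k S) (insert k S) (\<lambda>i. z i + x * \<i>) (\<lambda>i. z i + x * \<i>)" for x
  have "f holomorphic_on UNIV" "h holomorphic_on UNIV"
    unfolding f_def h_def using J k by (auto intro!: Q_line[of _ _ _ z "\<lambda>_. \<i>"])
  then have cont: "continuous_on UNIV f" "continuous_on UNIV h" by (auto intro: holomorphic_on_imp_continuous_on)
  have "continuous_on UNIV (\<lambda>t::real. Im (f (of_real t) * cnj (h (of_real t))))"
    by (intro continuous_intros continuous_on_compose2[OF cont(1)] continuous_on_compose2[OF cont(2)]) auto
  then have "((\<lambda>t::real. Im (f (of_real t) * cnj (h (of_real t)))) \<longlongrightarrow> Im (f (of_real 0) * cnj (h (of_real 0)))) (at_right 0)"
    unfolding continuous_on_def by (blast intro: tendsto_within_subset)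
  then have "Im (f (of_real 0) * cnj (h (of_real 0))) \<le> 0"
  proof (rule tendsto_upperbound)
    have "Im (f (of_real t) * cnj (h (of_real t))) \<le> 0" if "t > 0" for t :: real
      unfolding f_def h_def using J k z that
      by (intro less_imp_le Q_dlog) (auto intro: add_nonneg_pos)
    then show "\<forall>\<^sub>F t in at_right 0. Im (f (of_real t) * cnj (h (of_real t))) \<le> 0"
      by (auto intro: eventually_mono[OF eventually_at_right_less[of 0]])
  qed simp
  then show ?thesis by (simp add: f_def h_def)
qed

lemma R_quadratic:
  fixes x :: "nat \<Rightarrow> real"
  assumes J: "J \<subseteq> {..<n}" "S \<subseteq> {..<n}" "S \<inter> J = {}" and k: "k < n" "k \<notin> J" "k \<notin> S"
  defines "a \<equiv> R J S S x" and "b \<equiv> R (insert k J) S S (x(k := 0))"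
    and "c \<equiv> R J (insert k S) (insert k S) (x(k := 0))"
    and "w \<equiv> \<lambda>u i. (if i = k then u else complex_of_real (x i))"
  shows "Q J (insert k S) (insert k S) (w u) (w u) = of_real a * u\<^sup>2 + of_real b * u + of_real c"
    and "Q (insert k J) S S (w u) (w u) = 2 * of_real a * u + of_real b"
    and "R J (insert k S) (insert k S) (x(k := v)) = a * v\<^sup>2 + b * v + c"
    and "R (insert k J) S S (x(k := v)) = 2 * a * v + b"
    and "R J S S (x(k := v)) = a"
proof -
  have w: "w u = (\<lambda>i. of_real (x i))(k := u)" for u by (auto simp: w_def)
  have w0: "(\<lambda>i. of_real (x i))(k := 0) = (\<lambda>i. complex_of_real ((x(k := 0)) i))" by auto
  have Qa: "Q J S S (\<lambda>i. of_real (x i)) (\<lambda>i. of_real (x i)) = of_real a"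
    unfolding a_def using J by (intro Q_real)
  have Qb: "Q (insert k J) S S (\<lambda>i. complex_of_real ((x(k := 0)) i)) (\<lambda>i. complex_of_real ((x(k := 0)) i)) = of_real b"
    unfolding b_def using J k by (intro Q_real) auto
  have Qc: "Q J (insert k S) (insert k S) (\<lambda>i. complex_of_real ((x(k := 0)) i)) (\<lambda>i. complex_of_real ((x(k := 0)) i)) = of_real c"
    unfolding c_def using J k by (intro Q_real) auto
  show 1: "Q J (insert k S) (insert k S) (w u) (w u) = of_real a * u\<^sup>2 + of_real b * u + of_real c" for u
    unfolding w Q_quadratic(1)[OF J(1) k] Qa w0 Qb Qc by simp
  show 2: "Q (insert k J) S S (w u) (w u) = 2 * of_real a * u + of_real b" for u
    unfolding w Q_quadratic(2)[OF J(1) k] Qa w0 Qb by simp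
  have wv: "(\<lambda>i. complex_of_real ((x(k := v)) i)) = w (of_real v)" for v by (auto simp: w_def)
  show "R J (insert k S) (insert k S) (x(k := v)) = a * v\<^sup>2 + b * v + c"
    unfolding R_def wv 1 by simp
  show "R (insert k J) S S (x(k := v)) = 2 * a * v + b"
    unfolding R_def wv 2 by simp
  have "w (of_real v) = (\<lambda>i. of_real (x i))(k := of_real v)" by (rule w)
  then show "R J S S (x(k := v)) = a"
    unfolding R_def wv using k Qa by (simp add: Q_upd1_notin Q_upd2_notin del: fun_upd_apply)
qed

end

section \<open>Barrier points under differentiation\<close>

context real_stable_family
begin

text \<open>Freeze all variables but k at real values and put s + it there. The sign of the
  logarithmic derivative in j turns, through \<open>Im_quadratics\<close> and t tending to 0, into
  the sign of a Wronskian in k: where defined, the logarithmic derivative in j does not increase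
  with \<open>x k\<close>. Unprimed coefficients belong to the polynomial, primed ones to its
  derivative in j.\<close>

lemma R_wronskian:
  fixes x :: "nat \<Rightarrow> real"
  assumes J: "J \<subseteq> {..<n}" "S \<subseteq> {..<n}" "S \<inter> J = {}"
    and k: "k < n" "k \<notin> J" "k \<notin> S" and j: "j < n" "j \<notin> J" "j \<notin> S" "j \<noteq> k"
  defines "a \<equiv> R J (insert j S) (insert j S) x" and "b \<equiv> R (insert k J) (insert j S) (insert j S) (x(k := 0))"
    and "c \<equiv> R J (insert k (insert j S)) (insert k (insert j S)) (x(k := 0))"
    and "a' \<equiv> R (insert j J) S S x" and "b' \<equiv> R (insert k (insert j J)) S S (x(k := 0))"
    and "c' \<equiv> R (insert j J) (insert k S) (insert k S) (x(k := 0))"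
  shows "(a' * b - b' * a) * s\<^sup>2 + 2 * (a' * c - c' * a) * s + (b' * c - c' * b) \<le> 0"
proof (rule nonpos_of_quadratic_limit[where a = "a' * b - b' * a"])
  fix t :: real assume t: "t > 0"
  define w where "w = (\<lambda>i. if i = k then Complex s t else complex_of_real (x i))"
  have comm: "insert j (insert k S) = insert k (insert j S)" by auto
  have "Im (Q (insert j J) (insert k S) (insert k S) w w
      * cnj (Q J (insert j (insert k S)) (insert j (insert k S)) w w)) \<le> 0"
    using J k j t by (intro Q_dlog_closure) (auto simp: w_def)
  moreover have "Q (insert j J) (insert k S) (insert k S) w w = of_real a' * (Complex s t)\<^sup>2 + of_real b' * Complex s t + of_real c'"
    unfolding w_def a'_def b'_def c'_def using J k j by (intro R_quadratic(1)) auto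
  moreover have "Q J (insert k (insert j S)) (insert k (insert j S)) w w = of_real a * (Complex s t)\<^sup>2 + of_real b * Complex s t + of_real c"
    unfolding w_def a_def b_def c_def using J k j by (intro R_quadratic(1)) auto
  ultimately have "t * ((a' * b - b' * a) * (s\<^sup>2 + t\<^sup>2) + 2 * (a' * c - c' * a) * s + (b' * c - c' * b)) \<le> 0"
    unfolding comm by (simp only: Im_quadratics)
  then have "(a' * b - b' * a) * (s\<^sup>2 + t\<^sup>2) + 2 * (a' * c - c' * a) * s + (b' * c - c' * b) \<le> 0"
    using t by (simp add: mult_le_0_iff)
  then show "(a' * b - b' * a) * t\<^sup>2 + ((a' * b - b' * a) * s\<^sup>2 + 2 * (a' * c - c' * a) * s + (b' * c - c' * b)) \<le> 0"
    by (simp add: algebra_simps)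
qed

text \<open>Real rootedness in one variable. The argument of \<open>R_wronskian\<close> is repeated
  with the derivative in k itself, whose coefficients are 0, 2a, b; at the critical point -b / (2a)
  the Wronskian inequality is the discriminant inequality.\<close>

lemma R_discriminant:
  fixes x :: "nat \<Rightarrow> real"
  assumes J: "J \<subseteq> {..<n}" "S \<subseteq> {..<n}" "S \<inter> J = {}" and k: "k < n" "k \<notin> J" "k \<notin> S"
  defines "a \<equiv> R J S S x" and "b \<equiv> R (insert k J) S S (x(k := 0))"
    and "c \<equiv> R J (insert k S) (insert k S) (x(k := 0))"
  assumes a: "a > 0"
  shows "4 * a * c \<le> b\<^sup>2"
proof -
  define s where "s = - b / (2 * a)"
  have wr: "(0 * b - (2 * a) * a) * s\<^sup>2 + 2 * (0 * c - b * a) * s + ((2 * a) * c - b * b) \<le> 0"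
  proof (rule nonpos_of_quadratic_limit[where a = "0 * b - (2 * a) * a"])
    fix t :: real assume t: "t > 0"
    define w where "w = (\<lambda>i. if i = k then Complex s t else complex_of_real (x i))"
    have "Im (Q (insert k J) S S w w * cnj (Q J (insert k S) (insert k S) w w)) \<le> 0"
      using J k t by (intro Q_dlog_closure) (auto simp: w_def)
    moreover have "Q (insert k J) S S w w = of_real 0 * (Complex s t)\<^sup>2 + of_real (2 * a) * Complex s t + of_real b"
      using R_quadratic(2)[OF J k, where x = x and u = "Complex s t"] by (simp add: w_def a_def b_def)
    moreover have "Q J (insert k S) (insert k S) w w = of_real a * (Complex s t)\<^sup>2 + of_real b * Complex s t + of_real c"
      unfolding w_def a_def b_def c_def using J k by (intro R_quadratic(1)) auto
    ultimately have "t * ((0 * b - (2 * a) * a) * (s\<^sup>2 + t\<^sup>2) + 2 * (0 * c - b * a) * s + ((2 * a) * c - b * b)) \<le> 0"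
      by (simp only: Im_quadratics)
    then have "(0 * b - (2 * a) * a) * (s\<^sup>2 + t\<^sup>2) + 2 * (0 * c - b * a) * s + ((2 * a) * c - b * b) \<le> 0"
      using t by (meson mult_pos_pos not_le)
    then show "(0 * b - (2 * a) * a) * t\<^sup>2 + ((0 * b - (2 * a) * a) * s\<^sup>2 + 2 * (0 * c - b * a) * s + ((2 * a) * c - b * b)) \<le> 0"
      by (simp add: algebra_simps)
  qed
  have as: "a * s = - b / 2" using a by (simp add: s_def)
  have "(0 * b - (2 * a) * a) * s\<^sup>2 + 2 * (0 * c - b * a) * s = - 2 * (a * s) * (a * s) - 2 * b * (a * s)"
    by (simp add: power2_eq_square)
  also have "\<dots> = b * b / 2" unfolding as by simp
  finally have "b * b / 2 + ((2 * a) * c - b * b) \<le> 0" using wr by linarith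
  then show ?thesis by (simp add: power2_eq_square)
qed

text \<open>The second clause bounds a logarithmic derivative, since
  \<open>R (insert j J) S S\<close> is the derivative in variable j of
  \<open>R J (insert j S) (insert j S)\<close>. Quantifying over all \<open>S\<close> also makes the
  leading coefficients in single variables positive. The bound is 2 because the argument starts from
  a square, and each factor contributes 1.\<close>

definition above_roots :: "nat set \<Rightarrow> (nat \<Rightarrow> real) \<Rightarrow> bool" where
  "above_roots J b \<longleftrightarrow> (\<forall>S x. S \<subseteq> {..<n} \<longrightarrow> S \<inter> J = {} \<longrightarrow> (\<forall>i<n. b i \<le> x i) \<longrightarrow>
     R J S S x > 0 \<and> (\<forall>j. j < n \<longrightarrow> j \<notin> J \<longrightarrow> j \<notin> S \<longrightarrow>
       R (insert j J) S S x \<le> 2 * R J (insert j S) (insert j S) x))"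

text \<open>Differentiating in the \<open>k\<close>-th variable averages the two roots in that variable, which moves
  the larger one down by at least half its distance to the barrier point.\<close>

lemma above_roots_step:
  assumes J: "J \<subseteq> {..<n}" and k: "k < n" "k \<notin> J" and above: "above_roots J b"
  shows "above_roots (insert k J) (b(k := b k - 1/4))"
  unfolding above_roots_def
proof (intro allI impI conjI)
  fix S x assume S: "S \<subseteq> {..<n}" "S \<inter> insert k J = {}" and x: "\<forall>i<n. (b(k := b k - 1/4)) i \<le> x i"
  have fin: "finite J" using J finite_subset by blast
  have SJ: "S \<inter> J = {}" "k \<notin> S" using S by auto
  have pos: "R J T T y > 0" if "T \<subseteq> {..<n}" "T \<inter> J = {}" "\<And>i. i < n \<Longrightarrow> b i \<le> y i" for T y
    using above that unfolding above_roots_def by blast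
  have bar: "R (insert j J) T T y \<le> 2 * R J (insert j T) (insert j T) y"
    if "T \<subseteq> {..<n}" "T \<inter> J = {}" "\<And>i. i < n \<Longrightarrow> b i \<le> y i" "j < n" "j \<notin> J" "j \<notin> T" for T y j
    using above that unfolding above_roots_def by blast
  \<comment> \<open>Raising coordinate k by 1/4 leads back to a point above the old barrier, where
    the hypothesis applies; the derivative is to be controlled at \<open>u - 1/4\<close>.\<close>
  define u where "u = x k + 1/4"
  have xb: "b i \<le> (x(k := v)) i" if "v \<ge> u" "i < n" for v i
    using x[rule_format, of i] that by (auto simp: u_def split: if_splits)
  have xk: "x = x(k := u - 1/4)" unfolding u_def by (rule ext) simp
  have key: "a > 0 \<and> a * u\<^sup>2 + b0 * u + c > 0 \<and> 2 * a * u + b0 > 0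
      \<and> 2 * a * u + b0 \<le> 2 * (a * u\<^sup>2 + b0 * u + c) \<and> 2 * a * (u - 1/4) + b0 > 0"
    if T: "T \<subseteq> {..<n}" "T \<inter> J = {}" "k \<notin> T" and a: "a = R J T T x"
      and b0: "b0 = R (insert k J) T T (x(k := 0))" and c: "c = R J (insert k T) (insert k T) (x(k := 0))"
    for T a b0 c
  proof -
    note q = R_quadratic[OF J T(1,2) k T(3), where x = x, folded a b0 c]
    have "R J T T (x(k := u)) > 0" by (rule pos[OF T(1,2) xb[OF order_refl]])
    then have a0: "a > 0" by (simp only: q(5))
    have P: "a * v\<^sup>2 + b0 * v + c > 0" if "v \<ge> u" for v
    proof -
      have "R J (insert k T) (insert k T) (x(k := v)) > 0"
        by (rule pos[OF _ _ xb[OF that]]) (use T k in auto)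
      then show ?thesis by (simp only: q(3))
    qed
    have bu: "2 * a * u + b0 \<le> 2 * (a * u\<^sup>2 + b0 * u + c)"
    proof -
      have "R (insert k J) T T (x(k := u)) \<le> 2 * R J (insert k T) (insert k T) (x(k := u))"
        by (rule bar[OF T(1,2) xb[OF order_refl] k T(3)])
      then show ?thesis by (simp only: q(3,4))
    qed
    have disc: "4 * a * c \<le> b0\<^sup>2"
      using R_discriminant[OF J T(1,2) k T(3), where x = x, folded a b0 c] a0 by simp
    have sq: "4 * a * (a * u\<^sup>2 + b0 * u + c) \<le> (2 * a * u + b0)\<^sup>2"
      using disc by (simp add: power2_eq_square algebra_simps)
    have p': "2 * a * u + b0 > 0"
    proof (rule ccontr)
      assume "\<not> 2 * a * u + b0 > 0"
      then have "u \<le> - b0 / (2 * a)" using a0 by (simp add: field_simps)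
      from P[OF this] have "a * (b0 / (2 * a))\<^sup>2 - b0 * (b0 / (2 * a)) + c > 0" by simp
      moreover have "a * (b0 / (2 * a))\<^sup>2 - b0 * (b0 / (2 * a)) = - (b0\<^sup>2 / (4 * a))"
        using a0 by (simp add: power2_eq_square)
      ultimately have "b0\<^sup>2 / (4 * a) < c" by linarith
      then show False using disc a0 by (simp add: field_simps)
    qed
    \<comment> \<open>Write p for the quadratic in variable k. Real rootedness 4 a p \<le> p'^2 and
      the barrier bound p' \<le> 2 p give 2 a \<le> p' at u. As p'' = 2 a, the derivative is still
      positive at \<open>u - 1/4\<close>.\<close>
    have "2 * a * (2 * a * u + b0) \<le> 2 * a * (2 * (a * u\<^sup>2 + b0 * u + c))"
      using bu a0 by (intro mult_left_mono) auto
    also have "\<dots> = 4 * a * (a * u\<^sup>2 + b0 * u + c)" by simp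
    also have "\<dots> \<le> (2 * a * u + b0) * (2 * a * u + b0)" using sq by (simp add: power2_eq_square)
    finally have "2 * a \<le> 2 * a * u + b0" using p' by simp
    then have "2 * a * (u - 1/4) + b0 > 0" using a0 by (simp add: algebra_simps)
    with a0 P[OF order_refl] p' bu show ?thesis by blast
  qed
  show "R (insert k J) S S x > 0"
  proof -
    have "R (insert k J) S S (x(k := u - 1/4)) = 2 * R J S S x * (u - 1/4) + R (insert k J) S S (x(k := 0))"
      by (rule R_quadratic(4)[OF J S(1) SJ(1) k SJ(2)])
    moreover have "2 * R J S S x * (u - 1/4) + R (insert k J) S S (x(k := 0)) > 0"
      using key[OF S(1) SJ refl refl refl] by blast
    ultimately have "R (insert k J) S S (x(k := u - 1/4)) > 0" by linarith
    then show ?thesis by (simp only: xk[symmetric])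
  qed
  fix j assume j: "j < n" "j \<notin> insert k J" "j \<notin> S"
  let ?jS = "insert j S"
  define a where "a = R J ?jS ?jS x"
  define b0 where "b0 = R (insert k J) ?jS ?jS (x(k := 0))"
  define c where "c = R J (insert k ?jS) (insert k ?jS) (x(k := 0))"
  define a' where "a' = R (insert j J) S S x"
  define b' where "b' = R (insert k (insert j J)) S S (x(k := 0))"
  define c' where "c' = R (insert j J) (insert k S) (insert k S) (x(k := 0))"
  have jS: "?jS \<subseteq> {..<n}" "?jS \<inter> J = {}" "k \<notin> ?jS" using S SJ j by auto
  have jJ: "insert j J \<subseteq> {..<n}" "S \<inter> insert j J = {}" "k \<notin> insert j J" using J SJ j k by auto
  note q = R_quadratic[OF J jS(1,2) k jS(3), where x = x, folded a_def b0_def c_def]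
  note q' = R_quadratic[OF jJ(1) S(1) jJ(2) k(1) jJ(3) SJ(2), where x = x, folded a'_def b'_def c'_def]
  have kp: "a > 0" "a * u\<^sup>2 + b0 * u + c > 0" "2 * a * u + b0 > 0"
     "2 * a * u + b0 \<le> 2 * (a * u\<^sup>2 + b0 * u + c)" "2 * a * (u - 1/4) + b0 > 0"
    using key[OF jS a_def b0_def c_def] by blast+
  have W: "(a' * b0 - b' * a) * s\<^sup>2 + 2 * (a' * c - c' * a) * s + (b' * c - c' * b0) \<le> 0" for s
    unfolding a_def b0_def c_def a'_def b'_def c'_def
    using J S SJ k j by (intro R_wronskian) auto
  \<comment> \<open>For d = 1/4 the requirement 2 d p' \<le> p of \<open>barrier_quadratics\<close>
    is exactly the barrier bound p' \<le> 2 p; this fixes the step length.\<close>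
  have main: "(2 * a' * (u - 1/4) + b') * (a * u\<^sup>2 + b0 * u + c) \<le> (a' * u\<^sup>2 + b' * u + c') * (2 * a * (u - 1/4) + b0)"
    by (rule barrier_quadratics[OF W]) (use kp in auto)
  have comm: "insert j (insert k S) = insert k ?jS" "insert k (insert j J) = insert j (insert k J)" by auto
  have "R (insert j J) (insert k S) (insert k S) (x(k := u)) \<le> 2 * R J (insert k ?jS) (insert k ?jS) (x(k := u))"
    unfolding comm(1)[symmetric] by (rule bar[OF _ _ xb[OF order_refl]]) (use S SJ j k in auto)
  then have "a' * u\<^sup>2 + b' * u + c' \<le> 2 * (a * u\<^sup>2 + b0 * u + c)" by (simp only: q(3) q'(3))
  then have "(a' * u\<^sup>2 + b' * u + c') * (2 * a * (u - 1/4) + b0) \<le> 2 * (a * u\<^sup>2 + b0 * u + c) * (2 * a * (u - 1/4) + b0)"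
    using kp by (intro mult_right_mono) auto
  from order_trans[OF main this]
  have "(2 * a' * (u - 1/4) + b') * (a * u\<^sup>2 + b0 * u + c) \<le> (2 * (2 * a * (u - 1/4) + b0)) * (a * u\<^sup>2 + b0 * u + c)"
    by (simp only: mult_ac)
  then have "2 * a' * (u - 1/4) + b' \<le> 2 * (2 * a * (u - 1/4) + b0)" using kp(2) by (rule mult_right_le_imp_le)
  then have "R (insert k (insert j J)) S S (x(k := u - 1/4)) \<le> 2 * R (insert k J) ?jS ?jS (x(k := u - 1/4))"
    by (simp only: q(4) q'(4))
  then show "R (insert j (insert k J)) S S x \<le> 2 * R (insert k J) ?jS ?jS x"
    by (simp only: xk[symmetric] comm)
qed

lemma above_roots_all:
  assumes "J \<subseteq> {..<n}" and "above_roots {} (\<lambda>_. t)"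
  shows "above_roots J (\<lambda>i. if i \<in> J then t - 1/4 else t)"
proof -
  have "finite J" using assms(1) finite_subset by blast
  then show ?thesis using assms(1)
  proof (induction J rule: finite_induct)
    case (insert k J)
    then have IH: "above_roots J (\<lambda>i. if i \<in> J then t - 1/4 else t)" by simp
    have "above_roots (insert k J) ((\<lambda>i. if i \<in> J then t - 1/4 else t)(k := (if k \<in> J then t - 1/4 else t) - 1/4))"
      by (rule above_roots_step[OF _ _ _ IH]) (use insert in auto)
    moreover have "(\<lambda>i. if i \<in> J then t - 1/4 else t)(k := (if k \<in> J then t - 1/4 else t) - 1/4)
        = (\<lambda>i. if i \<in> insert k J then t - 1/4 else t)"
      using insert.hyps by auto
    ultimately show ?case by (simp only:)
  qed (use assms(2) in simp)
qed

end

text \<open>On the ray from \<rho> the function - d / q has no poles and increases by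
  \<open>pick_function_mono\<close>. So d / q decreases there, and being positive far to the right
  it is positive on the whole ray.\<close>

lemma interlacer_pos:
  fixes d q :: "complex \<Rightarrow> complex" and \<rho> t x :: real
  assumes hol: "d holomorphic_on UNIV" "q holomorphic_on UNIV"
    and re: "\<And>x::real. Im (d (of_real x)) = 0" "\<And>x::real. Im (q (of_real x)) = 0"
    and upper: "\<And>z. Im z > 0 \<Longrightarrow> Im (q z * cnj (d z)) > 0"
    and pos: "\<And>x::real. x \<ge> \<rho> \<Longrightarrow> Re (q (of_real x)) > 0"
    and big: "\<And>x::real. x \<ge> t \<Longrightarrow> Re (d (of_real x)) > 0"
    and x: "x \<ge> \<rho>"
  shows "Re (d (of_real x)) > 0"
proof -
  define y where "y = max x t"
  have dq: "Im ((- d z) * cnj (q z)) \<ge> 0" if "Im z > 0" for z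
    using upper[OF that] by (simp add: algebra_simps)
  have "Re (- d (of_real x)) / Re (q (of_real x)) \<le> Re (- d (of_real y)) / Re (q (of_real y))"
  proof (rule pick_function_mono[of "\<lambda>z. - d z" q])
    show "(\<lambda>z. - d z) holomorphic_on UNIV" using hol by (intro holomorphic_intros)
    show "q (of_real u) \<noteq> 0" if "u \<ge> \<rho>" for u using pos[OF that] by auto
  qed (use hol dq x re in \<open>auto simp: y_def\<close>)
  then have "Re (d (of_real y)) / Re (q (of_real y)) \<le> Re (d (of_real x)) / Re (q (of_real x))" by simp
  moreover have "Re (d (of_real y)) > 0" "Re (q (of_real y)) > 0" "Re (q (of_real x)) > 0"
    using big[of y] pos[of y] pos[OF x] x by (auto simp: y_def)
  ultimately show ?thesis by (meson divide_pos_pos less_le_trans zero_less_divide_iff less_asym)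
qed

section \<open>Selection of one splitting from the sum\<close>

context real_stable_family
begin

lemma Q_diagonal_holomorphic:
  assumes "J \<subseteq> {..<n}" "S1 \<subseteq> {..<n}" "S2 \<subseteq> {..<n}"
  shows "(\<lambda>z. Q J S1 S2 (\<lambda>_. z) (\<lambda>_. z)) holomorphic_on UNIV"
  using Q_line[OF assms, of "\<lambda>_. 0" "\<lambda>_. 1"] by simp

text \<open>The polynomial \<open>Q J S1 S2\<close> is a common interlacer of the two summands of \<open>Q (insert k J) S1 S2\<close>.\<close>

lemma mixed_select:
  fixes \<rho> t :: real
  assumes J: "J \<subseteq> {..<n}" "S1 \<subseteq> {..<n}" "S2 \<subseteq> {..<n}" "S1 \<inter> J = {}" "S2 \<inter> J = {}"
    and k: "k < n" "k \<notin> J" "k \<notin> S1" "k \<notin> S2"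
    and pos: "\<And>x. x \<ge> \<rho> \<Longrightarrow> R (insert k J) S1 S2 (\<lambda>_. x) > 0"
    and big: "\<And>x. x \<ge> t \<Longrightarrow> R J S1 S2 (\<lambda>_. x) > 0"
  shows "(\<forall>x\<ge>\<rho>. R J (insert k S1) S2 (\<lambda>_. x) > 0) \<or> (\<forall>x\<ge>\<rho>. R J S1 (insert k S2) (\<lambda>_. x) > 0)"
proof -
  have fin: "finite J" using J finite_subset by blast
  define d where "d z = Q J S1 S2 (\<lambda>_. z) (\<lambda>_. z)" for z
  define q where "q z = Q (insert k J) S1 S2 (\<lambda>_. z) (\<lambda>_. z)" for z
  define q1 where "q1 z = Q J (insert k S1) S2 (\<lambda>_. z) (\<lambda>_. z)" for z
  define q2 where "q2 z = Q J S1 (insert k S2) (\<lambda>_. z) (\<lambda>_. z)" for z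
  define rd where "rd x = R J S1 S2 (\<lambda>_. x)" for x
  define rq where "rq x = R (insert k J) S1 S2 (\<lambda>_. x)" for x
  define r1 where "r1 x = R J (insert k S1) S2 (\<lambda>_. x)" for x
  define r2 where "r2 x = R J S1 (insert k S2) (\<lambda>_. x)" for x
  have hol: "d holomorphic_on UNIV" "q holomorphic_on UNIV" "q1 holomorphic_on UNIV" "q2 holomorphic_on UNIV"
    unfolding d_def q_def q1_def q2_def using J k by (auto intro!: Q_diagonal_holomorphic)
  have re: "d (of_real x) = of_real (rd x)" "q (of_real x) = of_real (rq x)"
     "q1 (of_real x) = of_real (r1 x)" "q2 (of_real x) = of_real (r2 x)" for x
    unfolding d_def q_def q1_def q2_def rd_def rq_def r1_def r2_def
    using J k by (auto intro!: Q_real[where x = "\<lambda>_. x"])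
  have sum: "rq x = r1 x + r2 x" for x
    unfolding rq_def r1_def r2_def by (rule R_insert[OF fin k(2)])
  have up: "Im (q z * cnj (d z)) > 0" "Im (q1 z * cnj (d z)) > 0" "Im (q2 z * cnj (d z)) > 0" if "Im z > 0" for z
    unfolding d_def q_def q1_def q2_def using J k that
    by (blast intro: Q_ratio, blast intro: Q_ratio1, blast intro: Q_ratio2)
  have rdpos: "rd x > 0" if x: "x \<ge> \<rho>" for x
  proof -
    have "Re (d (of_real x)) > 0"
    proof (rule interlacer_pos[OF hol(1,2)])
      show "Re (q (of_real u)) > 0" if "u \<ge> \<rho>" for u using pos[OF that] by (simp add: re rq_def)
      show "Re (d (of_real u)) > 0" if "u \<ge> t" for u using big[OF that] by (simp add: re rd_def)
    qed (use up x in \<open>auto simp: re\<close>)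
    then show ?thesis by (simp add: re)
  qed
  have mono1: "r1 \<rho> / rd \<rho> \<le> r1 x / rd x" if x: "x \<ge> \<rho>" for x
  proof -
    have "Re (q1 (of_real \<rho>)) / Re (d (of_real \<rho>)) \<le> Re (q1 (of_real x)) / Re (d (of_real x))"
    proof (rule pick_function_mono)
      show "d (of_real u) \<noteq> 0" if "u \<ge> \<rho>" for u using rdpos[OF that] by (simp add: re)
      show "0 \<le> Im (q1 z * cnj (d z))" if "Im z > 0" for z using up(2)[OF that] by (rule less_imp_le)
    qed (use hol x in \<open>auto simp: re\<close>)
    then show ?thesis by (simp add: re)
  qed
  have mono2: "r2 \<rho> / rd \<rho> \<le> r2 x / rd x" if x: "x \<ge> \<rho>" for x
  proof -
    have "Re (q2 (of_real \<rho>)) / Re (d (of_real \<rho>)) \<le> Re (q2 (of_real x)) / Re (d (of_real x))"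
    proof (rule pick_function_mono)
      show "d (of_real u) \<noteq> 0" if "u \<ge> \<rho>" for u using rdpos[OF that] by (simp add: re)
      show "0 \<le> Im (q2 z * cnj (d z))" if "Im z > 0" for z using up(3)[OF that] by (rule less_imp_le)
    qed (use hol x in \<open>auto simp: re\<close>)
    then show ?thesis by (simp add: re)
  qed
  \<comment> \<open>At \<rho> one summand is positive because the sum is. Its quotient by the
    positive interlacer increases, so it stays positive to the right.\<close>
  have "r1 \<rho> > 0 \<or> r2 \<rho> > 0" using pos[of \<rho>] sum[of \<rho>] by (auto simp: rq_def)
  then show ?thesis
  proof
    assume 1: "r1 \<rho> > 0"
    have "r1 x > 0" if "x \<ge> \<rho>" for x
    proof -
      have "0 < r1 \<rho> / rd \<rho>" using 1 rdpos by simp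
      also have "\<dots> \<le> r1 x / rd x" by (rule mono1[OF that])
      finally show ?thesis using rdpos[OF that] by (simp add: zero_less_divide_iff)
    qed
    then show ?thesis by (simp add: r1_def)
  next
    assume 2: "r2 \<rho> > 0"
    have "r2 x > 0" if "x \<ge> \<rho>" for x
    proof -
      have "0 < r2 \<rho> / rd \<rho>" using 2 rdpos by simp
      also have "\<dots> \<le> r2 x / rd x" by (rule mono2[OF that])
      finally show ?thesis using rdpos[OF that] by (simp add: zero_less_divide_iff)
    qed
    then show ?thesis by (simp add: r2_def)
  qed
qed

lemma R_empty:
  assumes "S1 \<subseteq> {..<n}" "S2 \<subseteq> {..<n}"
  shows "R {} S1 S2 x = Re (g S1 (\<lambda>i. of_real (x i))) * Re (g S2 (\<lambda>i. of_real (x i)))"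
proof -
  have "Im (g S (\<lambda>i. of_real (x i))) = 0" if "S \<subseteq> {..<n}" for S
    using g_cnj[OF that, of "\<lambda>i. of_real (x i)"] by (simp add: complex_eq_iff)
  then show ?thesis using assms by (simp add: R_def mixed_empty)
qed

lemma R_pos:
  assumes big: "\<And>S. S \<subseteq> {..<n} \<Longrightarrow> Re (g S (\<lambda>i. of_real (x i))) > 0"
    and "J \<subseteq> {..<n}" "S1 \<subseteq> {..<n}" "S2 \<subseteq> {..<n}" "S1 \<inter> J = {}" "S2 \<inter> J = {}"
  shows "R J S1 S2 x > 0"
proof -
  have "finite J" using assms(2) finite_subset by blast
  then show ?thesis using assms(2-)
  proof (induction J arbitrary: S1 S2 rule: finite_induct)
    case empty
    then show ?case using big by (simp add: R_empty)
  next
    case (insert k J)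
    have "R J (insert k S1) S2 x > 0" using insert.prems insert.hyps by (intro insert.IH) auto
    moreover have "R J S1 (insert k S2) x > 0" using insert.prems insert.hyps by (intro insert.IH) auto
    ultimately show ?case using insert.hyps by (simp add: R_insert)
  qed
qed

text \<open>The method of conditional expectations: items are assigned one after the other, and
  \<open>mixed_select\<close> always leaves an assignment that preserves positivity from \<rho>
  on.\<close>

lemma mixed_select_all:
  fixes \<rho> t :: real
  assumes J: "J \<subseteq> {..<n}" "S1 \<subseteq> {..<n}" "S2 \<subseteq> {..<n}" "S1 \<inter> J = {}" "S2 \<inter> J = {}"
    and pos: "\<And>x. x \<ge> \<rho> \<Longrightarrow> R J S1 S2 (\<lambda>_. x) > 0"
    and big: "\<And>S x. S \<subseteq> {..<n} \<Longrightarrow> x \<ge> t \<Longrightarrow> Re (g S (\<lambda>_. of_real x)) > 0"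
  shows "\<exists>U\<subseteq>J. \<forall>x\<ge>\<rho>. R {} (S1 \<union> U) (S2 \<union> (J - U)) (\<lambda>_. x) > 0"
proof -
  have "finite J" using assms(1) finite_subset by blast
  then show ?thesis using J pos
  proof (induction J arbitrary: S1 S2 rule: finite_induct)
    case (insert k J)
    have "(\<forall>x\<ge>\<rho>. R J (insert k S1) S2 (\<lambda>_. x) > 0) \<or> (\<forall>x\<ge>\<rho>. R J S1 (insert k S2) (\<lambda>_. x) > 0)"
    proof (rule mixed_select[where t = t])
      show "R J S1 S2 (\<lambda>_. x) > 0" if "x \<ge> t" for x
        by (rule R_pos) (use insert.prems insert.hyps big that in auto)
    qed (use insert.prems insert.hyps in auto)
    then show ?case
    proof
      assume "\<forall>x\<ge>\<rho>. R J (insert k S1) S2 (\<lambda>_. x) > 0"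
      then have "\<exists>U\<subseteq>J. \<forall>x\<ge>\<rho>. R {} (insert k S1 \<union> U) (S2 \<union> (J - U)) (\<lambda>_. x) > 0"
        using insert.prems insert.hyps by (intro insert.IH) auto
      then obtain U where U: "U \<subseteq> J" "\<forall>x\<ge>\<rho>. R {} (insert k S1 \<union> U) (S2 \<union> (J - U)) (\<lambda>_. x) > 0" by blast
      moreover have "S1 \<union> insert k U = insert k S1 \<union> U" "insert k J - insert k U = J - U" using insert.hyps by auto
      ultimately show ?case by (intro exI[of _ "insert k U"]) auto
    next
      assume "\<forall>x\<ge>\<rho>. R J S1 (insert k S2) (\<lambda>_. x) > 0"
      then have "\<exists>U\<subseteq>J. \<forall>x\<ge>\<rho>. R {} (S1 \<union> U) (insert k S2 \<union> (J - U)) (\<lambda>_. x) > 0"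
        using insert.prems insert.hyps by (intro insert.IH) auto
      then obtain U where U: "U \<subseteq> J" "\<forall>x\<ge>\<rho>. R {} (S1 \<union> U) (insert k S2 \<union> (J - U)) (\<lambda>_. x) > 0" by blast
      moreover have "S2 \<union> (insert k J - U) = insert k S2 \<union> (J - U)" using U insert.hyps by auto
      ultimately show ?case by (intro exI[of _ U]) auto
    qed
  qed auto
qed

lemma above_rootsD:
  "above_roots J b \<Longrightarrow> S \<subseteq> {..<n} \<Longrightarrow> S \<inter> J = {} \<Longrightarrow> (\<And>i. i < n \<Longrightarrow> b i \<le> x i) \<Longrightarrow> R J S S x > 0"
  unfolding above_roots_def by blast

text \<open>For \<open>J = {}\<close> the polynomial is the square of \<open>g S\<close>, with
  logarithmic derivative 2 \<open>g S\<close> / \<open>g (insert j S)\<close> after adding j, and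
  \<open>ratio\<close> bounds this by 2. Differentiating in all variables lowers every coordinate by
  1/4 and produces the sum over all splittings, from which one summand is selected.\<close>

lemma exists_partition_positive:
  fixes t :: real
  assumes big: "\<And>S x. S \<subseteq> {..<n} \<Longrightarrow> (\<And>i. i < n \<Longrightarrow> x i \<ge> t) \<Longrightarrow> Re (g S (\<lambda>i. of_real (x i))) > 0"
    and ratio: "\<And>S x j. S \<subseteq> {..<n} \<Longrightarrow> (\<And>i. i < n \<Longrightarrow> x i \<ge> t) \<Longrightarrow> j < n \<Longrightarrow> j \<notin> S \<Longrightarrow>
      Re (g S (\<lambda>i. of_real (x i))) \<le> Re (g (insert j S) (\<lambda>i. of_real (x i)))"
  shows "\<exists>U\<subseteq>{..<n}. \<forall>x\<ge>t - 1/4. Re (g U (\<lambda>_. of_real x)) * Re (g ({..<n} - U) (\<lambda>_. of_real x)) > 0"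
proof -
  have "above_roots {} (\<lambda>_. t)"
    unfolding above_roots_def
  proof (intro allI impI conjI)
    fix S and x :: "nat \<Rightarrow> real" assume S: "S \<subseteq> {..<n}" and x: "\<forall>i<n. t \<le> x i"
    then show "R {} S S x > 0" using big[of S x] by (simp add: R_empty)
    fix j assume j: "j < n" "j \<notin> S"
    have jS: "insert j S \<subseteq> {..<n}" using S j by auto
    have "R {j} S S x = 2 * (Re (g (insert j S) (\<lambda>i. of_real (x i))) * Re (g S (\<lambda>i. of_real (x i))))"
      using S jS R_insert[of "{}" j S S x] by (simp add: R_empty)
    also have "\<dots> \<le> 2 * (Re (g (insert j S) (\<lambda>i. of_real (x i))) * Re (g (insert j S) (\<lambda>i. of_real (x i))))"
      using ratio[OF S _ j, of x] big[OF jS, of x] x by (intro mult_left_mono) (auto intro: less_imp_le)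
    also have "\<dots> = 2 * R {} (insert j S) (insert j S) x" using jS by (simp add: R_empty)
    finally show "R {j} S S x \<le> 2 * R {} (insert j S) (insert j S) x" .
  qed
  then have "R {..<n} {} {} (\<lambda>_. x) > 0" if "x \<ge> t - 1/4" for x
    by (rule above_rootsD[OF above_roots_all[OF order_refl]]) (use that in auto)
  then have "\<exists>U\<subseteq>{..<n}. \<forall>x\<ge>t - 1/4. R {} ({} \<union> U) ({} \<union> ({..<n} - U)) (\<lambda>_. x) > 0"
    using big by (intro mixed_select_all[where t = t]) auto
  then obtain U where U: "U \<subseteq> {..<n}" "\<forall>x\<ge>t - 1/4. R {} U ({..<n} - U) (\<lambda>_. x) > 0" by auto
  then show ?thesis by (intro exI[of _ U]) (auto simp: R_empty)
qed

end

section \<open>Splitting and paving of Bessel families\<close>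

lemma gram_hermitian: "gram \<tau> j i = cnj (gram \<tau> i j)"
  by (simp add: gram_def cnj_cinner)

lemma cpm_holomorphic: "(\<lambda>x. cpm n H S (\<lambda>i. a i + x * b i)) holomorphic_on UNIV"
proof -
  define e where "e i j x = (if i \<in> S \<and> j \<in> S then (if i = j then a i + x * b i else 0) - H i j
     else if i = j then 1 else 0)" for i j x
  have e: "e i j holomorphic_on UNIV" for i j
    unfolding e_def by (cases "i \<in> S \<and> j \<in> S"; cases "i = j") (auto intro!: holomorphic_intros)
  have "cpm n H S (\<lambda>i. a i + x * b i) = (\<Sum>p | p permutes {0..<n}. signof p * (\<Prod>i=0..<n. e i (p i) x))" for x
    unfolding cpm_def det_def'[OF charmat_carrier]
  proof (intro sum.cong refl arg_cong2[where f = "(*)"] prod.cong)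
    fix p i assume "p \<in> {p. p permutes {0..<n}}" "i \<in> {0..<n}"
    then have "i < n" "p i < n" using permutes_in_image[of p "{0..<n}" i] by auto
    then show "charmat n H S (\<lambda>i. a i + x * b i) $$ (i, p i) = e i (p i) x"
      by (simp add: charmat_def e_def)
  qed
  then show ?thesis using e by (auto intro!: holomorphic_intros)
qed

text \<open>A Gram matrix is Hermitian, so conjugating all entries amounts to conjugating
  \<open>z\<close> and transposing, and determinants ignore the transposition.\<close>

lemma cpm_cnj: "cpm n (gram \<tau>) S (\<lambda>i. cnj (z i)) = cnj (cpm n (gram \<tau>) S z)"
proof -
  let ?A = "charmat n (gram \<tau>) S (\<lambda>i. cnj (z i))" and ?B = "charmat n (gram \<tau>) S z"
  have "cpm n (gram \<tau>) S (\<lambda>i. cnj (z i)) = Determinant.det (transpose_mat ?A)"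
    by (simp add: cpm_def det_transpose[OF charmat_carrier])
  also have "\<dots> = (\<Sum>p | p permutes {0..<n}. signof p * (\<Prod>i=0..<n. transpose_mat ?A $$ (i, p i)))"
    by (rule det_def') (simp add: charmat_carrier)
  also have "\<dots> = (\<Sum>p | p permutes {0..<n}. cnj (signof p * (\<Prod>i=0..<n. ?B $$ (i, p i))))"
  proof (rule sum.cong[OF refl])
    fix p assume p: "p \<in> {p. p permutes {0..<n}}"
    have "transpose_mat ?A $$ (i, p i) = cnj (?B $$ (i, p i))" if "i \<in> {0..<n}" for i
    proof -
      have "i < n" "p i < n" using permutes_in_image[of p "{0..<n}" i] p that by auto
      then show ?thesis
        using gram_hermitian[of \<tau> "p i" i] by (auto simp: charmat_def)
    qed
    then show "signof p * (\<Prod>i=0..<n. transpose_mat ?A $$ (i, p i)) = cnj (signof p * (\<Prod>i=0..<n. ?B $$ (i, p i)))"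
      by (simp add: sign_def)
  qed
  also have "\<dots> = cnj (cpm n (gram \<tau>) S z)"
    unfolding cpm_def det_def'[OF charmat_carrier] by simp
  finally show ?thesis .
qed

lemma real_stable_family_gram: "real_stable_family n (cpm n (gram \<tau>))"
  by unfold_locales (simp_all only: cpm_upd_notin cpm_upd cpm_stable cpm_holomorphic cpm_cnj not_False_eq_True)

lemma zform_add_left: "zform \<tau> T z (\<lambda>i. a i + c * v i) b = zform \<tau> T z a b + c * zform \<tau> T z v b"
proof -
  have "(\<Sum>i\<in>T. (a i + c * v i) *\<^sub>C \<tau> i) = (\<Sum>i\<in>T. a i *\<^sub>C \<tau> i) + c *\<^sub>C (\<Sum>i\<in>T. v i *\<^sub>C \<tau> i)"
    by (rule ell2_eqI) (simp add: coord_sum plus_ell2.rep_eq scaleC.rep_eq sum.distrib sum_distrib_left algebra_simps)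
  then show ?thesis
    by (simp add: zform_def cinner_add_left cinner_scaleC_left sum.distrib sum_distrib_left algebra_simps)
qed

lemma zform_cnj:
  "zform \<tau> T (\<lambda>i. complex_of_real (x i)) b a = cnj (zform \<tau> T (\<lambda>i. complex_of_real (x i)) a b)"
  by (simp add: zform_def cnj_cinner mult_ac)

text \<open>Sylvester's criterion, by completing the square with the adjugate vector.\<close>

lemma zform_nonneg_of_minors:
  fixes x :: "nat \<Rightarrow> real"
  assumes "S \<subseteq> {..<n}" and pos: "\<And>T. T \<subseteq> S \<Longrightarrow> Re (cpm n (gram \<tau>) T (\<lambda>i. of_real (x i))) > 0"
  shows "Re (zform \<tau> S (\<lambda>i. of_real (x i)) w w) \<ge> 0"
proof -
  let ?z = "\<lambda>i. complex_of_real (x i)"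
  have "finite S" using assms(1) finite_subset by blast
  then show ?thesis using assms
  proof (induction S arbitrary: w rule: finite_induct)
    case (insert k S)
    have k: "k < n" and S: "S \<subseteq> {..<n}" using insert.prems by auto
    let ?g = "cpm n (gram \<tau>) S ?z" and ?h = "cpm n (gram \<tau>) (insert k S) ?z"
    have re: "?g = of_real (Re ?g)" "?h = of_real (Re ?h)"
      using cpm_cnj[of n \<tau> S ?z] cpm_cnj[of n \<tau> "insert k S" ?z] by (simp_all add: complex_eq_iff)
    have gp: "Re ?g > 0" "Re ?h > 0" using insert.prems(2) by auto
    obtain v where v: "v k = ?g" "\<And>i. i \<notin> insert k S \<Longrightarrow> v i = 0"
      "\<And>b. zform \<tau> (insert k S) ?z v b = cnj (b k) * ?h"
      by (rule cpm_gram_adjugate[OF k insert.hyps(2) S, of \<tau> ?z]) blast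
    define c where "c = w k / ?g"
    define u where "u i = w i + (- c) * v i" for i
    have uk: "u k = 0" using gp re by (auto simp: u_def c_def v(1))
    have wu: "w = (\<lambda>i. u i + c * v i)" by (auto simp: u_def)
    have uu: "zform \<tau> (insert k S) ?z u u = zform \<tau> S ?z u u"
      using insert.hyps uk by (simp add: zform_def zero_ell2.rep_eq scaleC.rep_eq, subst (1 2) ell2_eqI[of "0 *\<^sub>C \<tau> k" 0])
        (auto simp: scaleC.rep_eq zero_ell2.rep_eq)
    have vu: "zform \<tau> (insert k S) ?z v u = 0" by (simp add: v(3) uk)
    have uv: "zform \<tau> (insert k S) ?z u v = 0" using vu zform_cnj[of \<tau> "insert k S" x u v] by simp
    have vv: "zform \<tau> (insert k S) ?z v v = of_real (Re ?g * Re ?h)"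
      using re by (metis v(1,3) complex_cnj_complex_of_real of_real_mult)
    have wv: "zform \<tau> (insert k S) ?z w v = c * of_real (Re ?g * Re ?h)"
      by (subst wu) (simp add: zform_add_left uv vv)
    have wu': "zform \<tau> (insert k S) ?z w u = zform \<tau> S ?z u u"
      by (subst wu) (simp add: zform_add_left uu vu)
    have "zform \<tau> (insert k S) ?z w w = cnj (zform \<tau> (insert k S) ?z (\<lambda>i. u i + c * v i) w)"
      using zform_cnj[of \<tau> "insert k S" x w w] wu by simp
    also have "\<dots> = zform \<tau> (insert k S) ?z w u + cnj c * zform \<tau> (insert k S) ?z w v"
      using zform_cnj[of \<tau> "insert k S" x u w] zform_cnj[of \<tau> "insert k S" x v w]
      by (simp add: zform_add_left)
    also have "\<dots> = zform \<tau> S ?z u u + of_real ((cmod c)\<^sup>2 * (Re ?g * Re ?h))"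
      unfolding wu' wv by (simp add: complex_norm_square mult_ac del: of_real_power)
    finally have "Re (zform \<tau> (insert k S) ?z w w) = Re (zform \<tau> S ?z u u) + (cmod c)\<^sup>2 * (Re ?g * Re ?h)" by simp
    moreover have "Re (zform \<tau> S ?z u u) \<ge> 0" using insert.prems by (intro insert.IH) auto
    ultimately show ?case using gp by (simp add: add_nonneg_nonneg)
  qed (simp add: zform_def cinner_self)
qed

text \<open>The synthesis operator, which sends coefficients to linear combinations, has squared
  norm at most K; equivalently K bounds the Gram matrix. Only finite subfamilies are tested, which
  suits compactness arguments.\<close>

definition bessel :: "real \<Rightarrow> 'i set \<Rightarrow> ('i \<Rightarrow> 'a ell2) \<Rightarrow> bool" where
  "bessel K A \<tau> \<longleftrightarrow> (\<forall>F w. finite F \<longrightarrow> F \<subseteq> A \<longrightarrow>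
     (norm (\<Sum>i\<in>F. w i *\<^sub>C \<tau> i))\<^sup>2 \<le> K * (\<Sum>i\<in>F. (cmod (w i))\<^sup>2))"

lemma besselD: "bessel K A \<tau> \<Longrightarrow> finite F \<Longrightarrow> F \<subseteq> A \<Longrightarrow>
    (norm (\<Sum>i\<in>F. w i *\<^sub>C \<tau> i))\<^sup>2 \<le> K * (\<Sum>i\<in>F. (cmod (w i))\<^sup>2)"
  by (simp add: bessel_def)

lemma besselI: "(\<And>F w. finite F \<Longrightarrow> F \<subseteq> A \<Longrightarrow>
    (norm (\<Sum>i\<in>F. w i *\<^sub>C \<tau> i))\<^sup>2 \<le> K * (\<Sum>i\<in>F. (cmod (w i))\<^sup>2)) \<Longrightarrow> bessel K A \<tau>"
  by (simp add: bessel_def)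

lemma bessel_subset: "bessel K A \<tau> \<Longrightarrow> B \<subseteq> A \<Longrightarrow> bessel K B \<tau>"
  by (auto simp: bessel_def)

text \<open>With a the modulus of \<open>v k\<close> and s the norm of the other coefficients, the
  combination has norm at most a/20 + s. The constants 11/10 and 1/20 are such that 11/10 (a^2 +
  s^2) - (a/20 + s)^2 - a^2 is a positive definite form in a and s.\<close>

lemma zform_lower_bound:
  fixes x :: "nat \<Rightarrow> real"
  assumes b: "bessel 1 {..<n} \<tau>" and small: "norm (\<tau> k) \<le> 1/20"
    and S: "S \<subseteq> {..<n}" "k < n" "k \<notin> S" and x: "\<And>i. i < n \<Longrightarrow> x i \<ge> 11/10"
  shows "(cmod (v k))\<^sup>2 \<le> Re (zform \<tau> (insert k S) (\<lambda>i. of_real (x i)) v v)"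
proof -
  have fin: "finite S" using S finite_subset by blast
  define a where "a = cmod (v k)"
  define s where "s = sqrt (\<Sum>i\<in>S. (cmod (v i))\<^sup>2)"
  have s2: "s\<^sup>2 = (\<Sum>i\<in>S. (cmod (v i))\<^sup>2)" by (simp add: s_def sum_nonneg)
  have s0: "s \<ge> 0" by (simp add: s_def sum_nonneg)
  have "(norm (\<Sum>i\<in>S. v i *\<^sub>C \<tau> i))\<^sup>2 \<le> s\<^sup>2"
    using besselD[OF b fin S(1), of v] s2 by simp
  then have "norm (\<Sum>i\<in>S. v i *\<^sub>C \<tau> i) \<le> s" using s0 by (rule power2_le_imp_le)
  moreover have "norm (v k *\<^sub>C \<tau> k) \<le> a * (1/20)"
    unfolding norm_scaleC a_def using small by (intro mult_left_mono) auto
  moreover have "norm (\<Sum>i\<in>insert k S. v i *\<^sub>C \<tau> i) \<le> norm (v k *\<^sub>C \<tau> k) + norm (\<Sum>i\<in>S. v i *\<^sub>C \<tau> i)"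
    using fin S by (simp add: norm_triangle_ineq)
  ultimately have "norm (\<Sum>i\<in>insert k S. v i *\<^sub>C \<tau> i) \<le> a / 20 + s" by simp
  then have 1: "(norm (\<Sum>i\<in>insert k S. v i *\<^sub>C \<tau> i))\<^sup>2 \<le> (a / 20 + s)\<^sup>2" by (rule power_mono) simp
  have "11/10 * (a\<^sup>2 + s\<^sup>2) = 11/10 * (\<Sum>i\<in>insert k S. (cmod (v i))\<^sup>2)"
    using fin S by (simp add: a_def s2)
  also have "\<dots> = (\<Sum>i\<in>insert k S. 11/10 * (cmod (v i))\<^sup>2)" by (rule sum_distrib_left)
  also have "\<dots> \<le> (\<Sum>i\<in>insert k S. x i * (cmod (v i))\<^sup>2)"
    using x S by (intro sum_mono mult_right_mono) auto
  finally have 2: "11/10 * (a\<^sup>2 + s\<^sup>2) \<le> (\<Sum>i\<in>insert k S. x i * (cmod (v i))\<^sup>2)" .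
  have "11/10 * (a\<^sup>2 + s\<^sup>2) - (a / 20 + s)\<^sup>2 - a\<^sup>2 = (s - a / 2)\<^sup>2 / 10 + 29 / 400 * a\<^sup>2"
    by (simp add: power2_eq_square field_simps)
  moreover have "(s - a / 2)\<^sup>2 / 10 + 29 / 400 * a\<^sup>2 \<ge> 0" by simp
  ultimately have "a\<^sup>2 \<le> 11/10 * (a\<^sup>2 + s\<^sup>2) - (a / 20 + s)\<^sup>2"
    by linarith
  also have "\<dots> \<le> (\<Sum>i\<in>insert k S. x i * (cmod (v i))\<^sup>2) - (norm (\<Sum>i\<in>insert k S. v i *\<^sub>C \<tau> i))\<^sup>2"
    using 1 2 by linarith
  also have "\<dots> = Re (zform \<tau> (insert k S) (\<lambda>i. of_real (x i)) v v)"
    by (simp add: zform_self del: of_real_power sum.insert)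
  finally show ?thesis by (simp add: a_def)
qed

text \<open>Insert the adjugate vector into \<open>zform_lower_bound\<close>: with a the minor and b
  the larger determinant, \<open>v k\<close> is a and the form is a b, whence a^2 \<le> a b. So
  above 11/10 the logarithmic derivative of the determinant in each variable is at most 1.\<close>

lemma cpm_ge_minor:
  fixes x :: "nat \<Rightarrow> real"
  assumes b: "bessel 1 {..<n} \<tau>" and small: "\<And>i. i < n \<Longrightarrow> norm (\<tau> i) \<le> 1/20"
    and S: "S \<subseteq> {..<n}" "k < n" "k \<notin> S" and x: "\<And>i. i < n \<Longrightarrow> x i \<ge> 11/10"
    and pos: "Re (cpm n (gram \<tau>) S (\<lambda>i. of_real (x i))) > 0"
  shows "Re (cpm n (gram \<tau>) S (\<lambda>i. of_real (x i))) \<le> Re (cpm n (gram \<tau>) (insert k S) (\<lambda>i. of_real (x i)))"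
proof -
  let ?z = "\<lambda>i. complex_of_real (x i)"
  let ?g = "cpm n (gram \<tau>) S ?z" and ?h = "cpm n (gram \<tau>) (insert k S) ?z"
  define a b where "a = Re ?g" and "b = Re ?h"
  have ab: "?g = of_real a" "?h = of_real b"
    using cpm_cnj[of n \<tau> S ?z] cpm_cnj[of n \<tau> "insert k S" ?z] by (simp_all add: complex_eq_iff a_def b_def)
  obtain v where v: "v k = ?g" "\<And>b. zform \<tau> (insert k S) ?z v b = cnj (b k) * ?h"
    by (rule cpm_gram_adjugate[OF S(2,3,1), of \<tau> ?z]) blast
  have "(cmod (v k))\<^sup>2 \<le> Re (zform \<tau> (insert k S) ?z v v)"
    using S x by (intro zform_lower_bound[OF b small]) auto
  then have "a * a \<le> a * b" by (simp add: v ab power2_eq_square)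
  then show ?thesis using pos by (simp add: ab)
qed

lemma cpm_pos:
  fixes x :: "nat \<Rightarrow> real"
  assumes b: "bessel 1 {..<n} \<tau>" and small: "\<And>i. i < n \<Longrightarrow> norm (\<tau> i) \<le> 1/20"
    and S: "S \<subseteq> {..<n}" and x: "\<And>i. i < n \<Longrightarrow> x i \<ge> 11/10"
  shows "Re (cpm n (gram \<tau>) S (\<lambda>i. of_real (x i))) > 0"
proof -
  have "finite S" using S finite_subset by blast
  then show ?thesis using S
  proof (induction S rule: finite_induct)
    case (insert k S)
    then have "Re (cpm n (gram \<tau>) S (\<lambda>i. of_real (x i))) > 0" by simp
    moreover from this have "Re (cpm n (gram \<tau>) S (\<lambda>i. of_real (x i))) \<le> Re (cpm n (gram \<tau>) (insert k S) (\<lambda>i. of_real (x i)))"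
      using insert by (intro cpm_ge_minor[OF b small _ _ _ x]) auto
    ultimately show ?case by linarith
  qed (simp add: cpm_empty)
qed

text \<open>Cauchy interlacing: on the diagonal the ratio of the determinant to its principal minor
  maps the upper half plane into itself, so \<open>interlacer_pos\<close> applies. The minor is
  positive from 11/10 on by \<open>cpm_pos\<close>.\<close>

lemma cpm_diagonal_minor_pos:
  assumes b: "bessel 1 {..<n} \<tau>" and small: "\<And>i. i < n \<Longrightarrow> norm (\<tau> i) \<le> 1/20"
    and S: "insert k S \<subseteq> {..<n}" "k \<notin> S"
    and pos: "\<And>x::real. x \<ge> \<rho> \<Longrightarrow> Re (cpm n (gram \<tau>) (insert k S) (\<lambda>_. of_real x)) > 0" and x: "x \<ge> \<rho>"
  shows "Re (cpm n (gram \<tau>) S (\<lambda>_. of_real x)) > 0"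
proof (rule interlacer_pos[where q = "\<lambda>z. cpm n (gram \<tau>) (insert k S) (\<lambda>_. z)" and d = "\<lambda>z. cpm n (gram \<tau>) S (\<lambda>_. z)"
      and \<rho> = \<rho> and t = "11/10"])
  show "(\<lambda>z. cpm n (gram \<tau>) S (\<lambda>_. z)) holomorphic_on UNIV" "(\<lambda>z. cpm n (gram \<tau>) (insert k S) (\<lambda>_. z)) holomorphic_on UNIV"
    using cpm_holomorphic[of n "gram \<tau>" _ "\<lambda>_. 0" "\<lambda>_. 1"] by simp_all
  show "Im (cpm n (gram \<tau>) S (\<lambda>_. of_real x)) = 0" "Im (cpm n (gram \<tau>) (insert k S) (\<lambda>_. of_real x)) = 0" for x
    using cpm_cnj[of n \<tau> _ "\<lambda>_. of_real x"] by (simp_all add: complex_eq_iff)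
  show "0 < Im (cpm n (gram \<tau>) (insert k S) (\<lambda>_. z) * cnj (cpm n (gram \<tau>) S (\<lambda>_. z)))" if "Im z > 0" for z
    using S that by (intro cpm_ratio_Im_pos cpm_stable) auto
  show "0 < Re (cpm n (gram \<tau>) S (\<lambda>_. of_real y))" if "y \<ge> 11/10" for y
    using S that by (intro cpm_pos[OF b small, where x = "\<lambda>_. y"]) auto
qed (use pos x in auto)

lemma cpm_minors_pos:
  assumes b: "bessel 1 {..<n} \<tau>" and small: "\<And>i. i < n \<Longrightarrow> norm (\<tau> i) \<le> 1/20"
    and S: "S \<subseteq> {..<n}" and T: "T \<subseteq> S"
    and pos: "\<And>x::real. x \<ge> \<rho> \<Longrightarrow> Re (cpm n (gram \<tau>) S (\<lambda>_. of_real x)) > 0" and x: "x \<ge> \<rho>"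
  shows "Re (cpm n (gram \<tau>) T (\<lambda>_. of_real x)) > 0"
proof -
  have "finite S" using S finite_subset by blast
  then have "finite (S - T)" by simp
  then show ?thesis using T x
  proof (induction "S - T" arbitrary: T x rule: finite_induct)
    case empty
    then have "T = S" by auto
    then show ?case using pos empty by simp
  next
    case (insert k D)
    have k: "k \<in> S" "k \<notin> T" using insert.hyps by auto
    show ?case
    proof (rule cpm_diagonal_minor_pos[OF b small, where k = k and \<rho> = \<rho>])
      show "0 < Re (cpm n (gram \<tau>) (insert k T) (\<lambda>_. of_real y))" if "y \<ge> \<rho>" for y
        using insert k that by (intro insert.hyps(3)) auto
    qed (use insert k S in auto)
  qed
qed

text \<open>Separates the product of the two characteristic polynomials: a sign change of one factor
  would be a zero of the product.\<close>

lemma pos_factor_of_product: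
  fixes f h :: "real \<Rightarrow> real"
  assumes cont: "continuous_on UNIV f" and prod: "\<And>x. x \<ge> \<rho> \<Longrightarrow> f x * h x > 0" and big: "\<And>x. x \<ge> t \<Longrightarrow> f x > 0"
    and x: "x \<ge> \<rho>"
  shows "f x > 0"
proof (rule ccontr)
  assume "\<not> f x > 0"
  then have fx: "f x \<le> 0" by simp
  define m where "m = max x t"
  have "f m > 0" by (rule big) (simp add: m_def)
  have xm: "x \<le> m" by (simp add: m_def)
  have "\<exists>y\<ge>x. y \<le> m \<and> f y = 0"
    by (rule IVT'[OF fx less_imp_le[OF \<open>f m > 0\<close>] xm continuous_on_subset[OF cont]]) simp
  then obtain y where "x \<le> y" "f y = 0" by blast
  then show False using prod[of y] x by simp
qed

text \<open>The barrier descends from 11/10 by 1/4 to 17/20. There the characteristic polynomial of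
  each part is positive together with all its principal minors, and Sylvester's criterion turns this
  into the bound 17/20 for the Gram matrix.\<close>

lemma bessel_split_nat:
  fixes \<tau> :: "nat \<Rightarrow> 'a ell2"
  assumes b: "bessel 1 {..<n} \<tau>" and small: "\<And>i. i < n \<Longrightarrow> norm (\<tau> i) \<le> 1/20"
  shows "\<exists>U\<subseteq>{..<n}. bessel (17/20) U \<tau> \<and> bessel (17/20) ({..<n} - U) \<tau>"
proof -
  let ?g = "cpm n (gram \<tau>)"
  interpret real_stable_family n ?g by (rule real_stable_family_gram)
  have "\<exists>U\<subseteq>{..<n}. \<forall>x\<ge>11/10 - 1/4. Re (?g U (\<lambda>_. of_real x)) * Re (?g ({..<n} - U) (\<lambda>_. of_real x)) > 0"
  proof (rule exists_partition_positive)
    show pos: "Re (?g S (\<lambda>i. of_real (x i))) > 0" if "S \<subseteq> {..<n}" "\<And>i. i < n \<Longrightarrow> 11/10 \<le> x i" for S x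
      by (rule cpm_pos[OF b small that])
    show "Re (?g S (\<lambda>i. of_real (x i))) \<le> Re (?g (insert j S) (\<lambda>i. of_real (x i)))"
      if "S \<subseteq> {..<n}" "\<And>i. i < n \<Longrightarrow> 11/10 \<le> x i" "j < n" "j \<notin> S" for S x j
      using that by (intro cpm_ge_minor[OF b small] pos) auto
  qed
  then obtain U where U: "U \<subseteq> {..<n}"
    "\<And>x::real. x \<ge> 17/20 \<Longrightarrow> Re (?g U (\<lambda>_. of_real x)) * Re (?g ({..<n} - U) (\<lambda>_. of_real x)) > 0" by auto
  have cont: "continuous_on UNIV (\<lambda>x::real. Re (?g S (\<lambda>_. of_real x)))" for S
  proof -
    have "(\<lambda>z. ?g S (\<lambda>_. z)) holomorphic_on UNIV"
      using cpm_holomorphic[of n "gram \<tau>" _ "\<lambda>_. 0" "\<lambda>_. 1"] by simp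
    then have c: "continuous_on UNIV (\<lambda>z. ?g S (\<lambda>_. z))" by (rule holomorphic_on_imp_continuous_on)
    have "continuous_on UNIV (\<lambda>x::real. ?g S (\<lambda>_. of_real x))"
      by (rule continuous_on_compose2[OF c continuous_on_of_real_id]) simp
    then show ?thesis by (rule continuous_on_Re)
  qed
  have bes: "bessel (17/20) S \<tau>" if S: "S \<subseteq> {..<n}" and p: "\<And>x::real. x \<ge> 17/20 \<Longrightarrow> Re (?g S (\<lambda>_. of_real x)) > 0" for S
  proof (rule besselI)
    fix F w assume F: "finite F" "F \<subseteq> S"
    have "Re (zform \<tau> F (\<lambda>_. of_real (17/20)) w w) \<ge> 0"
    proof (rule zform_nonneg_of_minors)
      show "0 < Re (?g T (\<lambda>_. of_real (17/20)))" if "T \<subseteq> F" for T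
        using S F that by (intro cpm_minors_pos[OF b small S _ p, where \<rho> = "17/20"]) auto
    qed (use S F in auto)
    then show "(norm (\<Sum>i\<in>F. w i *\<^sub>C \<tau> i))\<^sup>2 \<le> 17/20 * (\<Sum>i\<in>F. (cmod (w i))\<^sup>2)"
      by (simp add: zform_self sum_distrib_left del: of_real_power)
  qed
  have big: "Re (?g S (\<lambda>_. of_real x)) > 0" if "S \<subseteq> {..<n}" "x \<ge> 11/10" for S and x :: real
    by (rule cpm_pos[OF b small that(1), where x = "\<lambda>_. x"]) (use that in auto)
  have "Re (?g U (\<lambda>_. of_real x)) > 0" if "x \<ge> 17/20" for x :: real
    by (rule pos_factor_of_product[where t = "11/10", OF cont U(2) big[OF U(1)] that])
  moreover have "Re (?g ({..<n} - U) (\<lambda>_. of_real x)) > 0" if "x \<ge> 17/20" for x :: real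
  proof (rule pos_factor_of_product[where t = "11/10", OF cont _ big that])
    show "Re (?g ({..<n} - U) (\<lambda>_. of_real y)) * Re (?g U (\<lambda>_. of_real y)) > 0" if "y \<ge> 17/20" for y :: real
      using U(2)[OF that] by (simp only: mult.commute)
  qed auto
  ultimately have "bessel (17/20) U \<tau>" "bessel (17/20) ({..<n} - U) \<tau>"
    using U by (auto intro!: bes)
  then show ?thesis using U by blast
qed

section \<open>Passage to arbitrary bounds and index sets\<close>

lemma bessel_reindex:
  assumes "inj_on h B"
  shows "bessel K (h ` B) \<tau> \<longleftrightarrow> bessel K B (\<tau> \<circ> h)"
proof
  assume L: "bessel K (h ` B) \<tau>"
  show "bessel K B (\<tau> \<circ> h)"
  proof (rule besselI)
    fix F w assume F: "finite F" "F \<subseteq> B"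
    have inj: "inj_on h F" using assms F(2) by (rule inj_on_subset)
    have "(norm (\<Sum>i\<in>h ` F. (w \<circ> the_inv_into F h) i *\<^sub>C \<tau> i))\<^sup>2 \<le> K * (\<Sum>i\<in>h ` F. (cmod ((w \<circ> the_inv_into F h) i))\<^sup>2)"
      using F by (intro besselD[OF L]) auto
    then show "(norm (\<Sum>i\<in>F. w i *\<^sub>C (\<tau> \<circ> h) i))\<^sup>2 \<le> K * (\<Sum>i\<in>F. (cmod (w i))\<^sup>2)"
      by (simp add: sum.reindex[OF inj] the_inv_into_f_f[OF inj])
  qed
next
  assume R: "bessel K B (\<tau> \<circ> h)"
  show "bessel K (h ` B) \<tau>"
  proof (rule besselI)
    fix F w assume F: "finite F" "F \<subseteq> h ` B"
    then obtain G where G: "G \<subseteq> B" "F = h ` G" by (meson subset_imageE)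
    have inj: "inj_on h G" using assms G(1) by (rule inj_on_subset)
    have fG: "finite G" using F G inj by (simp add: finite_image_iff)
    show "(norm (\<Sum>i\<in>F. w i *\<^sub>C \<tau> i))\<^sup>2 \<le> K * (\<Sum>i\<in>F. (cmod (w i))\<^sup>2)"
      using besselD[OF R fG G(1), of "w \<circ> h"] by (simp add: G(2) sum.reindex[OF inj])
  qed
qed

lemma sum_scaleC_right: "(\<Sum>i\<in>F. w i *\<^sub>C (c *\<^sub>C \<tau> i)) = c *\<^sub>C (\<Sum>i\<in>F. w i *\<^sub>C \<tau> i)"
  by (rule ell2_eqI) (simp add: coord_sum scaleC.rep_eq sum_distrib_left mult_ac)

lemma bessel_scale:
  assumes "bessel K A \<tau>"
  shows "bessel ((cmod c)\<^sup>2 * K) A (\<lambda>i. c *\<^sub>C \<tau> i)"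
proof (rule besselI)
  fix F w assume "finite F" "F \<subseteq> A"
  then have "(cmod c)\<^sup>2 * (norm (\<Sum>i\<in>F. w i *\<^sub>C \<tau> i))\<^sup>2 \<le> (cmod c)\<^sup>2 * (K * (\<Sum>i\<in>F. (cmod (w i))\<^sup>2))"
    by (intro mult_left_mono besselD[OF assms]) auto
  then show "(norm (\<Sum>i\<in>F. w i *\<^sub>C (c *\<^sub>C \<tau> i)))\<^sup>2 \<le> (cmod c)\<^sup>2 * K * (\<Sum>i\<in>F. (cmod (w i))\<^sup>2)"
    by (simp add: sum_scaleC_right norm_scaleC power_mult_distrib mult_ac)
qed

text \<open>Rescaling by 1 / sqrt K reduces to bound 1; the squared norms may be at most K / 400
  because 400 is the square of 20.\<close>

lemma bessel_split_finite:
  fixes \<tau> :: "'i \<Rightarrow> 'a ell2"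
  assumes A: "finite A" and b: "bessel K A \<tau>" and K: "K > 0"
    and small: "\<And>i. i \<in> A \<Longrightarrow> (norm (\<tau> i))\<^sup>2 \<le> K / 400"
  shows "\<exists>U\<subseteq>A. bessel (17/20 * K) U \<tau> \<and> bessel (17/20 * K) (A - U) \<tau>"
proof -
  obtain h where h: "bij_betw h {..<card A} A"
    using ex_bij_betw_nat_finite[OF A] by (auto simp: atLeast0LessThan)
  have inj: "inj_on h {..<card A}" and im: "h ` {..<card A} = A" using h by (auto simp: bij_betw_def)
  define c where "c = complex_of_real (1 / sqrt K)"
  have c2: "(cmod c)\<^sup>2 = 1 / K" using K by (simp add: c_def norm_divide power_divide)
  define \<sigma> where "\<sigma> i = c *\<^sub>C \<tau> (h i)" for i
  have \<tau>\<sigma>: "\<tau> (h i) = complex_of_real (sqrt K) *\<^sub>C \<sigma> i" for i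
    using K by (intro ell2_eqI) (simp add: \<sigma>_def scaleC.rep_eq c_def)
  have "bessel K {..<card A} (\<lambda>i. \<tau> (h i))" using b bessel_reindex[OF inj, of K \<tau>] by (simp add: im o_def)
  from bessel_scale[OF this, of c] have b1: "bessel 1 {..<card A} \<sigma>"
    using K c2 unfolding \<sigma>_def by simp
  have "norm (\<sigma> i) \<le> 1/20" if "i < card A" for i
  proof -
    have "(norm (\<sigma> i))\<^sup>2 = (norm (\<tau> (h i)))\<^sup>2 / K"
      by (simp add: \<sigma>_def norm_scaleC power_mult_distrib c2)
    also have "\<dots> \<le> (K / 400) / K" using that im K by (intro divide_right_mono small) auto
    also have "\<dots> = (1/20)\<^sup>2" using K by (simp add: power2_eq_square)
    finally show ?thesis by (rule power2_le_imp_le) simp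
  qed
  from bessel_split_nat[OF b1 this] obtain U where U: "U \<subseteq> {..<card A}"
    "bessel (17/20) U \<sigma>" "bessel (17/20) ({..<card A} - U) \<sigma>" by blast
  have scale_back: "bessel (17/20 * K) (h ` V) \<tau>" if V: "V \<subseteq> {..<card A}" "bessel (17/20) V \<sigma>" for V
  proof -
    have "bessel ((cmod (complex_of_real (sqrt K)))\<^sup>2 * (17/20)) V (\<lambda>i. complex_of_real (sqrt K) *\<^sub>C \<sigma> i)"
      by (rule bessel_scale[OF V(2)])
    then have "bessel (17/20 * K) V (\<tau> \<circ> h)"
      using K by (simp add: \<tau>\<sigma>[symmetric] o_def mult.commute)
    then show ?thesis using bessel_reindex[OF inj_on_subset[OF inj V(1)]] by blast
  qed
  have diff: "h ` ({..<card A} - U) = A - h ` U"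
    using inj_on_image_set_diff[OF inj, of "{..<card A}" U] U(1) im by auto
  have "h ` U \<subseteq> A" using U(1) im by blast
  moreover have "bessel (17/20 * K) (h ` U) \<tau>" by (rule scale_back[OF U(1,2)])
  moreover have "bessel (17/20 * K) (A - h ` U) \<tau>" using scale_back[OF _ U(3)] diff by auto
  ultimately show ?thesis by blast
qed

text \<open>Tychonoff's theorem for the product of two-point spaces over \<open>A\<close>. By
  \<open>loc\<close> each constraint is a finite union of cylinders and hence closed;
  \<open>mono\<close> and \<open>ex\<close> give the finite intersection property.\<close>

lemma subset_compactness:
  fixes good :: "'i set \<Rightarrow> 'i set \<Rightarrow> bool"
  assumes mono: "\<And>F G B. good G B \<Longrightarrow> F \<subseteq> G \<Longrightarrow> good F B"
    and loc: "\<And>F B B'. good F B \<Longrightarrow> B \<inter> F = B' \<inter> F \<Longrightarrow> good F B'"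
    and ex: "\<And>F. finite F \<Longrightarrow> F \<subseteq> A \<Longrightarrow> \<exists>B. good F B"
  shows "\<exists>B\<subseteq>A. \<forall>F. finite F \<longrightarrow> F \<subseteq> A \<longrightarrow> good F B"
proof -
  define X :: "('i \<Rightarrow> bool) topology" where "X = product_topology (\<lambda>_. discrete_topology UNIV) A"
  have comp: "compact_space X"
    unfolding X_def by (auto simp: compact_space_product_topology compact_space_discrete_topology)
  have top: "topspace X = (\<Pi>\<^sub>E i\<in>A. UNIV)" by (simp add: X_def)
  define C where "C F = {f \<in> topspace X. good F {i \<in> A. f i}}" for F
  have closed: "closedin X (C F)" if F: "finite F" "F \<subseteq> A" for F
  proof -
    define cyl where "cyl E = {f \<in> topspace X. \<forall>i\<in>F. f i = (i \<in> E)}" for E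
    have "closedin X {f \<in> topspace X. f i \<in> {b}}" if "i \<in> A" for i b
      by (rule closedin_continuous_map_preimage[where Y = "discrete_topology UNIV"])
        (auto simp: X_def that intro!: continuous_map_product_projection)
    then have cl: "closedin X {f \<in> topspace X. f i = b}" if "i \<in> A" for i b using that by simp
    have "cyl E = topspace X \<inter> (\<Inter>i\<in>F. {f \<in> topspace X. f i = (i \<in> E)})" for E by (auto simp: cyl_def)
    then have "closedin X (cyl E)" for E
    proof (cases "F = {}")
      case False
      have "cyl E = (\<Inter>i\<in>F. {f \<in> topspace X. f i = (i \<in> E)})" using False by (auto simp: cyl_def)
      then show ?thesis using False F by (simp only:) (rule closedin_Inter, auto intro!: cl)
    qed (simp add: cyl_def)
    moreover have "C F = (\<Union>E\<in>{E \<in> Pow F. good F E}. cyl E)"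
    proof (intro equalityI subsetI)
      fix f assume f: "f \<in> C F"
      then have "good F ({i \<in> A. f i} \<inter> F)" by (auto simp: C_def intro: loc)
      moreover have "f \<in> cyl ({i \<in> A. f i} \<inter> F)" using f F by (auto simp: C_def cyl_def)
      ultimately show "f \<in> (\<Union>E\<in>{E \<in> Pow F. good F E}. cyl E)" by blast
    next
      fix f assume "f \<in> (\<Union>E\<in>{E \<in> Pow F. good F E}. cyl E)"
      then obtain E where E: "E \<subseteq> F" "good F E" "f \<in> cyl E" by blast
      have "E \<inter> F = {i \<in> A. f i} \<inter> F" using E F by (auto simp: cyl_def)
      with E(2) have "good F {i \<in> A. f i}" by (rule loc)
      then show "f \<in> C F" using E by (auto simp: C_def cyl_def)
    qed
    ultimately show ?thesis using F by (auto intro!: closedin_Union)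
  qed
  have nonempty: "C F \<noteq> {}" if F: "finite F" "F \<subseteq> A" for F
  proof -
    obtain B where B: "good F B" using ex[OF F] by blast
    define f where "f = (\<lambda>i\<in>A. i \<in> B)"
    have "B \<inter> F = {i \<in> A. f i} \<inter> F" using F by (auto simp: f_def)
    with B have "good F {i \<in> A. f i}" by (rule loc)
    then have "f \<in> C F" by (simp add: C_def top f_def)
    then show ?thesis by blast
  qed
  have "\<Inter>(C ` {F. finite F \<and> F \<subseteq> A}) \<noteq> {}"
  proof -
    have "\<Inter>\<F> \<noteq> {}" if \<F>: "finite \<F>" "\<F> \<subseteq> C ` {F. finite F \<and> F \<subseteq> A}" for \<F>
    proof -
      obtain G where G: "finite G" "G \<subseteq> {F. finite F \<and> F \<subseteq> A}" "\<F> = C ` G"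
        using finite_subset_image[OF \<F>] by blast
      have "C (\<Union>G) \<subseteq> \<Inter>\<F>" unfolding G(3) C_def using mono by blast
      moreover have "C (\<Union>G) \<noteq> {}" using G by (intro nonempty) auto
      ultimately show ?thesis by blast
    qed
    moreover have "\<forall>D\<in>C ` {F. finite F \<and> F \<subseteq> A}. closedin X D" using closed by auto
    ultimately show ?thesis
      using comp[unfolded compact_space_fip, rule_format, of "C ` {F. finite F \<and> F \<subseteq> A}"] by simp
  qed
  then obtain f where "f \<in> \<Inter>(C ` {F. finite F \<and> F \<subseteq> A})" by blast
  then have "\<forall>F. finite F \<longrightarrow> F \<subseteq> A \<longrightarrow> good F {i \<in> A. f i}" by (auto simp: C_def)
  then show ?thesis by (intro exI[of _ "{i \<in> A. f i}"]) auto
qed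

lemma bessel_split:
  fixes \<tau> :: "'i \<Rightarrow> 'a ell2"
  assumes b: "bessel K A \<tau>" and K: "K > 0"
    and small: "\<And>i. i \<in> A \<Longrightarrow> (norm (\<tau> i))\<^sup>2 \<le> K / 400"
  shows "\<exists>U\<subseteq>A. bessel (17/20 * K) U \<tau> \<and> bessel (17/20 * K) (A - U) \<tau>"
proof -
  let ?good = "\<lambda>F B. bessel (17/20 * K) (F \<inter> B) \<tau> \<and> bessel (17/20 * K) (F - B) \<tau>"
  have "\<exists>U\<subseteq>A. \<forall>F. finite F \<longrightarrow> F \<subseteq> A \<longrightarrow> ?good F U"
  proof (rule subset_compactness)
    show "?good F B" if "?good G B" "F \<subseteq> G" for F G B
      using that by (meson bessel_subset Diff_mono Int_mono order_refl)
    show "?good F B'" if "?good F B" "B \<inter> F = B' \<inter> F" for F B B'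
    proof -
      have "F \<inter> B = F \<inter> B'" "F - B = F - B'" using that(2) by auto
      then show ?thesis using that(1) by simp
    qed
    show "\<exists>B. ?good F B" if F: "finite F" "F \<subseteq> A" for F
    proof -
      have "\<exists>U\<subseteq>F. bessel (17/20 * K) U \<tau> \<and> bessel (17/20 * K) (F - U) \<tau>"
        using F small by (intro bessel_split_finite bessel_subset[OF b] K) auto
      then obtain U where "U \<subseteq> F" "bessel (17/20 * K) U \<tau>" "bessel (17/20 * K) (F - U) \<tau>" by blast
      then show ?thesis by (intro exI[of _ U]) (simp add: Int_absorb1)
    qed
  qed
  then obtain U where U: "U \<subseteq> A" "\<And>F. finite F \<Longrightarrow> F \<subseteq> A \<Longrightarrow> ?good F U" by blast
  have "bessel (17/20 * K) U \<tau>"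
  proof (rule besselI)
    fix F w assume F: "finite F" "F \<subseteq> U"
    then have "bessel (17/20 * K) (F \<inter> U) \<tau>" "F \<inter> U = F" using U by auto
    then have bF: "bessel (17/20 * K) F \<tau>" by simp
    show "(norm (\<Sum>i\<in>F. w i *\<^sub>C \<tau> i))\<^sup>2 \<le> 17/20 * K * (\<Sum>i\<in>F. (cmod (w i))\<^sup>2)"
      by (rule besselD[OF bF F(1) order_refl])
  qed
  moreover have "bessel (17/20 * K) (A - U) \<tau>"
  proof (rule besselI)
    fix F w assume F: "finite F" "F \<subseteq> A - U"
    then have "bessel (17/20 * K) (F - U) \<tau>" "F - U = F" using U by auto
    then have bF: "bessel (17/20 * K) F \<tau>" by simp
    show "(norm (\<Sum>i\<in>F. w i *\<^sub>C \<tau> i))\<^sup>2 \<le> 17/20 * K * (\<Sum>i\<in>F. (cmod (w i))\<^sup>2)"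
      by (rule besselD[OF bF F(1) order_refl])
  qed
  ultimately show ?thesis using U by blast
qed

text \<open>Every splitting multiplies the bound by 17/20 but does not shorten the vectors. They
  therefore have to be short relative to the bound reached at the end, not to the initial
  one.\<close>

theorem bessel_paving:
  fixes \<tau> :: "'i \<Rightarrow> 'a ell2"
  assumes "bessel K A \<tau>" and "K > 0" and "\<And>i. i \<in> A \<Longrightarrow> (norm (\<tau> i))\<^sup>2 \<le> K * (17/20) ^ m / 400"
  shows "\<exists>c :: 'i \<Rightarrow> nat. (\<forall>i. c i < 2 ^ m) \<and> (\<forall>l. bessel ((17/20) ^ m * K) {i \<in> A. c i = l} \<tau>)"
  using assms
proof (induction m arbitrary: A K)
  case 0
  show ?case by (rule exI[of _ "\<lambda>_. 0"]) (use 0 in \<open>auto elim: bessel_subset\<close>)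
next
  case (Suc m)
  have "(norm (\<tau> i))\<^sup>2 \<le> K / 400" if "i \<in> A" for i
  proof -
    have "K * (17/20) ^ Suc m \<le> K * 1" using Suc.prems(2) by (intro mult_left_mono power_le_one) auto
    then show ?thesis using Suc.prems(3)[OF that] by simp
  qed
  from bessel_split[OF Suc.prems(1,2) this] obtain U where U: "U \<subseteq> A" "bessel (17/20 * K) U \<tau>" "bessel (17/20 * K) (A - U) \<tau>" by blast
  have K': "17/20 * K > 0" using Suc.prems by simp
  have sm: "(norm (\<tau> i))\<^sup>2 \<le> (17/20 * K) * (17/20) ^ m / 400" if "i \<in> A" for i
    using Suc.prems(3)[OF that] by (simp add: mult_ac)
  obtain c1 :: "'i \<Rightarrow> nat" where c1: "\<forall>i. c1 i < 2 ^ m" "\<forall>l. bessel ((17/20) ^ m * (17/20 * K)) {i \<in> U. c1 i = l} \<tau>"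
    using Suc.IH[OF U(2) K'] sm U(1) by blast
  obtain c2 :: "'i \<Rightarrow> nat" where c2: "\<forall>i. c2 i < 2 ^ m" "\<forall>l. bessel ((17/20) ^ m * (17/20 * K)) {i \<in> A - U. c2 i = l} \<tau>"
    using Suc.IH[OF U(3) K'] sm by blast
  define c where "c i = (if i \<in> U then c1 i else 2 ^ m + c2 i)" for i
  have eq: "(17/20) ^ m * (17/20 * K) = (17/20) ^ Suc m * K" by simp
  show ?case
  proof (intro exI[of _ c] conjI allI)
    show "c i < 2 ^ Suc m" for i using c1(1) c2(1) by (auto simp: c_def intro: less_trans[of _ "2 ^ m"])
    fix l
    show "bessel ((17/20) ^ Suc m * K) {i \<in> A. c i = l} \<tau>"
    proof (cases "l < 2 ^ m")
      case True
      then have "{i \<in> A. c i = l} \<subseteq> {i \<in> U. c1 i = l}" by (auto simp: c_def)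
      with c1(2) show ?thesis unfolding eq[symmetric] by (blast intro: bessel_subset)
    next
      case False
      then have "{i \<in> A. c i = l} \<subseteq> {i \<in> A - U. c2 i = l - 2 ^ m}" using c1(1) by (auto simp: c_def)
      with c2(2) show ?thesis unfolding eq[symmetric] by (blast intro: bessel_subset)
    qed
  qed
qed

section \<open>Colourings and matchings\<close>

text \<open>The weighted degree of the graph induced on \<open>A\<close>, tested on finite sets so
  that it passes through compactness and makes sense for infinite \<open>A\<close>.\<close>

definition weight_bound :: "('i \<Rightarrow> 'i \<Rightarrow> real) \<Rightarrow> real \<Rightarrow> 'i set \<Rightarrow> bool" where
  "weight_bound w D A \<longleftrightarrow> (\<forall>x\<in>A. \<forall>F. finite F \<longrightarrow> F \<subseteq> A \<longrightarrow> sum (w x) F \<le> D)"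

lemma weight_bound_subset: "weight_bound w D A \<Longrightarrow> B \<subseteq> A \<Longrightarrow> weight_bound w D B"
  unfolding weight_bound_def by blast

text \<open>In a cut of maximal weight no vertex gains by changing sides.\<close>

lemma weight_split_finite:
  fixes w :: "'i \<Rightarrow> 'i \<Rightarrow> real"
  assumes A: "finite A" and b: "weight_bound w D A" and nn: "\<And>x y. w x y \<ge> 0"
    and sym: "\<And>x y. w x y = w y x" and diag: "\<And>x. w x x = 0"
  shows "\<exists>U\<subseteq>A. weight_bound w (D / 2) U \<and> weight_bound w (D / 2) (A - U)"
proof -
  define cut where "cut U = (\<Sum>x\<in>U. \<Sum>y\<in>A - U. w x y)" for U
  have fin: "finite (cut ` Pow A)" using A by simp
  have "Max (cut ` Pow A) \<in> cut ` Pow A" by (rule Max_in[OF fin]) auto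
  then obtain U where U: "U \<in> Pow A" "Max (cut ` Pow A) = cut U" by auto
  have maxU: "cut V \<le> cut U" if "V \<subseteq> A" for V
    using Max_ge[OF fin, of "cut V"] that U(2) by simp
  have cut_compl: "cut (A - V) = cut V" if "V \<subseteq> A" for V
  proof -
    have "A - (A - V) = V" using that by auto
    then have "cut (A - V) = (\<Sum>x\<in>A - V. \<Sum>y\<in>V. w x y)" by (simp add: cut_def)
    also have "\<dots> = (\<Sum>y\<in>V. \<Sum>x\<in>A - V. w x y)" by (rule sum.swap)
    also have "\<dots> = cut V" unfolding cut_def by (intro sum.cong refl sym)
    finally show ?thesis .
  qed
  have key: "weight_bound w (D / 2) V" if V: "V \<subseteq> A" "\<And>V'. V' \<subseteq> A \<Longrightarrow> cut V' \<le> cut V" for V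
    unfolding weight_bound_def
  proof (intro ballI allI impI)
    fix x F assume x: "x \<in> V" and F: "finite F" "F \<subseteq> V"
    have finV: "finite V" "finite (A - V)" using A V finite_subset by auto
    have AV: "A - (V - {x}) = insert x (A - V)" using x V by auto
    have "cut (V - {x}) = (\<Sum>a\<in>V - {x}. w a x) + (\<Sum>a\<in>V - {x}. \<Sum>y\<in>A - V. w a y)"
      unfolding cut_def AV using finV x by (simp add: sum.distrib)
    moreover have "cut V = (\<Sum>y\<in>A - V. w x y) + (\<Sum>a\<in>V - {x}. \<Sum>y\<in>A - V. w a y)"
      unfolding cut_def using finV x by (simp add: sum.remove)
    moreover have "cut (V - {x}) \<le> cut V" by (rule V(2)) (use V in auto)
    moreover have "(\<Sum>a\<in>V - {x}. w a x) = sum (w x) V"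
      using finV x diag by (simp add: sum.remove[of V x "w x"] sym[of _ x])
    ultimately have "sum (w x) V \<le> sum (w x) (A - V)" by simp
    moreover have "sum (w x) V + sum (w x) (A - V) = sum (w x) A"
      using sum.subset_diff[OF V(1) A, of "w x"] by simp
    moreover have "sum (w x) A \<le> D" using b A x V unfolding weight_bound_def by blast
    moreover have "sum (w x) F \<le> sum (w x) V" using F finV nn by (intro sum_mono2) auto
    ultimately show "sum (w x) F \<le> D / 2" by linarith
  qed
  have UA: "U \<subseteq> A" using U by simp
  have "weight_bound w (D / 2) U" by (rule key[OF UA maxU])
  moreover have "weight_bound w (D / 2) (A - U)"
    by (rule key) (use cut_compl[OF UA] maxU in auto)
  ultimately show ?thesis using UA by blast
qed

lemma weight_bound_finitary:
  "weight_bound w D A \<longleftrightarrow> (\<forall>F. finite F \<longrightarrow> F \<subseteq> A \<longrightarrow> weight_bound w D F)"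
proof
  assume R: "\<forall>F. finite F \<longrightarrow> F \<subseteq> A \<longrightarrow> weight_bound w D F"
  show "weight_bound w D A"
    unfolding weight_bound_def
  proof (intro ballI allI impI)
    fix x F assume "x \<in> A" "finite F" "F \<subseteq> A"
    then have "weight_bound w D (insert x F)" using R by auto
    then show "sum (w x) F \<le> D" using \<open>finite F\<close> unfolding weight_bound_def by blast
  qed
qed (blast intro: weight_bound_subset)

lemma weight_split:
  fixes w :: "'i \<Rightarrow> 'i \<Rightarrow> real"
  assumes b: "weight_bound w D A" and nn: "\<And>x y. w x y \<ge> 0"
    and sym: "\<And>x y. w x y = w y x" and diag: "\<And>x. w x x = 0"
  shows "\<exists>U\<subseteq>A. weight_bound w (D / 2) U \<and> weight_bound w (D / 2) (A - U)"
proof -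
  let ?good = "\<lambda>F B. weight_bound w (D / 2) (F \<inter> B) \<and> weight_bound w (D / 2) (F - B)"
  have "\<exists>U\<subseteq>A. \<forall>F. finite F \<longrightarrow> F \<subseteq> A \<longrightarrow> ?good F U"
  proof (rule subset_compactness)
    show "?good F B" if "?good G B" "F \<subseteq> G" for F G B
      using that by (meson weight_bound_subset Diff_mono Int_mono order_refl)
    show "?good F B'" if "?good F B" "B \<inter> F = B' \<inter> F" for F B B'
    proof -
      have "F \<inter> B = F \<inter> B'" "F - B = F - B'" using that(2) by auto
      then show ?thesis using that(1) by simp
    qed
    show "\<exists>B. ?good F B" if F: "finite F" "F \<subseteq> A" for F
    proof -
      obtain U where "U \<subseteq> F" "weight_bound w (D / 2) U" "weight_bound w (D / 2) (F - U)"
        using weight_split_finite[OF F(1) weight_bound_subset[OF b F(2)] nn sym diag] by blast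
      then show ?thesis by (intro exI[of _ U]) (simp add: Int_absorb1)
    qed
  qed
  then obtain U where U: "U \<subseteq> A" "\<And>F. finite F \<Longrightarrow> F \<subseteq> A \<Longrightarrow> ?good F U" by blast
  have "weight_bound w (D / 2) F" if "finite F" "F \<subseteq> U" for F
  proof -
    have "weight_bound w (D / 2) (F \<inter> U)" "F \<inter> U = F" using U that by auto
    then show ?thesis by simp
  qed
  moreover have "weight_bound w (D / 2) F" if "finite F" "F \<subseteq> A - U" for F
  proof -
    have "weight_bound w (D / 2) (F - U)" "F - U = F" using U that by auto
    then show ?thesis by simp
  qed
  ultimately have "weight_bound w (D / 2) U" "weight_bound w (D / 2) (A - U)"
    using weight_bound_finitary[of w "D / 2"] by blast+
  with U(1) show ?thesis by blast
qed

lemma weight_colouring: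
  fixes w :: "'i \<Rightarrow> 'i \<Rightarrow> real"
  assumes "weight_bound w D A" and nn: "\<And>x y. w x y \<ge> 0"
    and sym: "\<And>x y. w x y = w y x" and diag: "\<And>x. w x x = 0"
  shows "\<exists>c :: 'i \<Rightarrow> nat. (\<forall>i. c i < 2 ^ m) \<and> (\<forall>l. weight_bound w (D / 2 ^ m) {i \<in> A. c i = l})"
  using assms(1)
proof (induction m arbitrary: A D)
  case 0
  show ?case by (rule exI[of _ "\<lambda>_. 0"]) (use 0 in \<open>auto elim: weight_bound_subset\<close>)
next
  case (Suc m)
  obtain U where U: "U \<subseteq> A" "weight_bound w (D / 2) U" "weight_bound w (D / 2) (A - U)"
    using weight_split[OF Suc.prems nn sym diag] by blast
  obtain c1 :: "'i \<Rightarrow> nat" where c1: "\<forall>i. c1 i < 2 ^ m" "\<forall>l. weight_bound w (D / 2 / 2 ^ m) {i \<in> U. c1 i = l}"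
    using Suc.IH[OF U(2)] by blast
  obtain c2 :: "'i \<Rightarrow> nat" where c2: "\<forall>i. c2 i < 2 ^ m" "\<forall>l. weight_bound w (D / 2 / 2 ^ m) {i \<in> A - U. c2 i = l}"
    using Suc.IH[OF U(3)] by blast
  define c where "c i = (if i \<in> U then c1 i else 2 ^ m + c2 i)" for i
  have eq: "D / 2 / 2 ^ m = D / 2 ^ Suc m" by simp
  show ?case
  proof (intro exI[of _ c] conjI allI)
    show "c i < 2 ^ Suc m" for i using c1(1) c2(1) by (auto simp: c_def intro: less_trans[of _ "2 ^ m"])
    fix l
    show "weight_bound w (D / 2 ^ Suc m) {i \<in> A. c i = l}"
    proof (cases "l < 2 ^ m")
      case True
      then have "{i \<in> A. c i = l} \<subseteq> {i \<in> U. c1 i = l}" by (auto simp: c_def)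
      with c1(2) show ?thesis unfolding eq[symmetric] by (blast intro: weight_bound_subset)
    next
      case False
      then have "{i \<in> A. c i = l} \<subseteq> {i \<in> A - U. c2 i = l - 2 ^ m}" using c1(1) by (auto simp: c_def)
      with c2(2) show ?thesis unfolding eq[symmetric] by (blast intro: weight_bound_subset)
    qed
  qed
qed

section \<open>Hall's marriage theorem\<close>

text \<open>Rado's argument: in a minimal family satisfying Hall's condition all members are singletons.\<close>

lemma hall_finite:
  fixes N :: "'i \<Rightarrow> 'j set"
  assumes A: "finite A" and N: "\<And>x. x \<in> A \<Longrightarrow> finite (N x)"
    and hall: "\<And>F. F \<subseteq> A \<Longrightarrow> card F \<le> card (\<Union>x\<in>F. N x)"
  shows "\<exists>f. inj_on f A \<and> (\<forall>x\<in>A. f x \<in> N x)"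
proof -
  define P where "P B \<longleftrightarrow> (\<forall>x\<in>A. B x \<subseteq> N x) \<and> (\<forall>F\<subseteq>A. card F \<le> card (\<Union>x\<in>F. B x))" for B
  have "P N" using hall by (simp add: P_def)
  then obtain B where B: "P B" and minB: "\<And>B'. P B' \<Longrightarrow> (\<Sum>x\<in>A. card (B x)) \<le> (\<Sum>x\<in>A. card (B' x))"
    using ex_has_least_nat[of P N "\<lambda>B. \<Sum>x\<in>A. card (B x)"] by blast
  have BN: "B x \<subseteq> N x" if "x \<in> A" for x using B that by (simp add: P_def)
  have finB: "finite (B x)" if "x \<in> A" for x using BN[OF that] N[OF that] by (rule finite_subset)
  have BF: "card F \<le> card (\<Union>x\<in>F. B x)" if "F \<subseteq> A" for F using B that by (simp add: P_def)
  have deficient: "\<exists>I\<subseteq>A - {x}. card ((\<Union>i\<in>I. B i) \<union> (B x - {y})) \<le> card I" if x: "x \<in> A" "y \<in> B x" for x y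
  proof -
    define B' where "B' a = (if a = x then B x - {y} else B a)" for a
    have "(\<Sum>a\<in>A. card (B' a)) < (\<Sum>a\<in>A. card (B a))"
    proof (rule sum_strict_mono_ex1)
      show "\<forall>a\<in>A. card (B' a) \<le> card (B a)" using finB by (auto simp: B'_def intro: card_mono)
      have "card (B' x) < card (B x)" using card_Diff1_less[OF finB[OF x(1)] x(2)] by (simp add: B'_def)
      then show "\<exists>a\<in>A. card (B' a) < card (B a)" using x(1) by blast
    qed (rule A)
    then have "\<not> P B'" using minB[of B'] by (meson not_le)
    moreover have "\<forall>a\<in>A. B' a \<subseteq> N a" using BN x by (auto simp: B'_def)
    ultimately obtain F where F: "F \<subseteq> A" "card (\<Union>a\<in>F. B' a) < card F" by (auto simp: P_def not_le)
    have xF: "x \<in> F"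
    proof (rule ccontr)
      assume "x \<notin> F"
      then have "(\<Union>a\<in>F. B' a) = (\<Union>a\<in>F. B a)" by (auto simp: B'_def)
      then show False using F BF[OF F(1)] by simp
    qed
    have "(\<Union>a\<in>F. B' a) = (\<Union>i\<in>F - {x}. B i) \<union> (B x - {y})"
    proof -
      have "(\<Union>a\<in>F. B' a) = (\<Union>a\<in>F - {x}. B' a) \<union> B' x" using xF by blast
      also have "(\<Union>a\<in>F - {x}. B' a) = (\<Union>i\<in>F - {x}. B i)" by (intro SUP_cong) (auto simp: B'_def)
      finally show ?thesis by (simp add: B'_def)
    qed
    moreover have "card F = Suc (card (F - {x}))"
      by (rule card.remove[OF finite_subset[OF F(1) A] xF])
    ultimately have "card ((\<Union>i\<in>F - {x}. B i) \<union> (B x - {y})) \<le> card (F - {x})"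
      using F(2) by (simp only: less_Suc_eq_le)
    moreover have "F - {x} \<subseteq> A - {x}" using F(1) by blast
    ultimately show ?thesis by blast
  qed
  have single: "\<exists>y. B x = {y}" if x: "x \<in> A" for x
  proof (rule ccontr)
    assume no: "\<nexists>y. B x = {y}"
    have "card {x} \<le> card (\<Union>a\<in>{x}. B a)" using x by (intro BF) auto
    then have "B x \<noteq> {}" by auto
    then obtain y1 y2 where y: "y1 \<in> B x" "y2 \<in> B x" "y1 \<noteq> y2" using no by blast
    \<comment> \<open>By minimality, deleting either of two elements of \<open>B x\<close> creates a
      deficient set. Counting the union and the intersection of the two deficient images contradicts
      Hall's condition for \<open>insert x (I \<union> J)\<close> and
      \<open>I \<inter> J\<close>.\<close>
    obtain I where I: "I \<subseteq> A - {x}" "card ((\<Union>i\<in>I. B i) \<union> (B x - {y1})) \<le> card I" using deficient[OF x y(1)] by blast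
    obtain J where J: "J \<subseteq> A - {x}" "card ((\<Union>i\<in>J. B i) \<union> (B x - {y2})) \<le> card J" using deficient[OF x y(2)] by blast
    let ?P = "(\<Union>i\<in>I. B i) \<union> (B x - {y1})" and ?Q = "(\<Union>i\<in>J. B i) \<union> (B x - {y2})"
    have finI: "finite I" "finite J" using finite_subset[OF I(1)] finite_subset[OF J(1)] A by simp_all
    have finP: "finite ?P" "finite ?Q" using finI I J finB x by auto
    have "?P \<union> ?Q = (\<Union>a\<in>insert x (I \<union> J). B a)" using y by auto
    moreover have "card (insert x (I \<union> J)) = Suc (card (I \<union> J))" using finI I J by (subst card_insert_disjoint) auto
    moreover have "insert x (I \<union> J) \<subseteq> A" using I J x by auto
    ultimately have "Suc (card (I \<union> J)) \<le> card (?P \<union> ?Q)" using BF[of "insert x (I \<union> J)"] by (simp only:)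
    moreover have "card (I \<inter> J) \<le> card (?P \<inter> ?Q)"
    proof -
      have "card (I \<inter> J) \<le> card (\<Union>a\<in>I \<inter> J. B a)" using I by (intro BF) auto
      also have "\<dots> \<le> card (?P \<inter> ?Q)" using finP by (intro card_mono) auto
      finally show ?thesis .
    qed
    moreover have "card ?P + card ?Q = card (?P \<union> ?Q) + card (?P \<inter> ?Q)" by (rule card_Un_Int[OF finP])
    moreover have "card I + card J = card (I \<union> J) + card (I \<inter> J)" by (rule card_Un_Int[OF finI])
    ultimately show False using I(2) J(2) by linarith
  qed
  define f where "f x = (THE y. B x = {y})" for x
  have f: "B x = {f x}" if "x \<in> A" for x
    using single[OF that] by (auto simp: f_def)
  have "inj_on f A"
  proof (rule inj_onI)
    fix x y assume xy: "x \<in> A" "y \<in> A" "f x = f y"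
    then have "(\<Union>a\<in>{x, y}. B a) = {f x}" using f by auto
    then have "card {x, y} \<le> 1" using BF[of "{x, y}"] xy by simp
    then show "x = y" by (cases "x = y") auto
  qed
  moreover have "f x \<in> N x" if "x \<in> A" for x using f[OF that] BN[OF that] by auto
  ultimately show ?thesis by blast
qed

theorem hall:
  fixes N :: "'i \<Rightarrow> 'j set"
  assumes N: "\<And>x. x \<in> A \<Longrightarrow> finite (N x)"
    and hall: "\<And>F. finite F \<Longrightarrow> F \<subseteq> A \<Longrightarrow> card F \<le> card (\<Union>x\<in>F. N x)"
  shows "\<exists>f. inj_on f A \<and> (\<forall>x\<in>A. f x \<in> N x)"
proof -
  \<comment> \<open>A matching is encoded as a set of pairs, of which only the window
    \<open>F\<close> is visible. Totality at x is demanded only if the window contains all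
    candidates of x; this makes the condition inherited by smaller windows, and since
    \<open>N x\<close> is finite some finite window does enforce it.\<close>
  define good where "good F B \<longleftrightarrow> single_valued (F \<inter> B) \<and> single_valued ((F \<inter> B)\<inverse>)
      \<and> (\<forall>x\<in>A. {x} \<times> N x \<subseteq> F \<longrightarrow> (\<exists>y\<in>N x. (x, y) \<in> F \<inter> B))" for F B
  have "\<exists>B\<subseteq>Sigma A N. \<forall>F. finite F \<longrightarrow> F \<subseteq> Sigma A N \<longrightarrow> good F B"
  proof (rule subset_compactness)
    show "good F B" if "good G B" "F \<subseteq> G" for F G B
      unfolding good_def
    proof (intro conjI ballI impI)
      show "single_valued (F \<inter> B)"
        by (rule single_valued_subset[of _ "G \<inter> B"]) (use that in \<open>auto simp: good_def\<close>)
      show "single_valued ((F \<inter> B)\<inverse>)"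
        by (rule single_valued_subset[of _ "(G \<inter> B)\<inverse>"]) (use that in \<open>auto simp: good_def\<close>)
      fix x assume x: "x \<in> A" "{x} \<times> N x \<subseteq> F"
      then have "{x} \<times> N x \<subseteq> G" using that(2) by (rule_tac order_trans)
      then have "\<exists>y\<in>N x. (x, y) \<in> G \<inter> B" using that(1) x(1) by (simp add: good_def)
      then show "\<exists>y\<in>N x. (x, y) \<in> F \<inter> B"
      proof
        fix y assume "y \<in> N x" "(x, y) \<in> G \<inter> B"
        moreover from this have "(x, y) \<in> F" using x(2) by (auto intro: subsetD)
        ultimately show ?thesis by (intro bexI[of _ y]) simp_all
      qed
    qed
    show "good F B'" if "good F B" and eq: "B \<inter> F = B' \<inter> F" for F B B'
    proof -
      have "F \<inter> B = F \<inter> B'" using eq by (simp only: Int_commute)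
      then show ?thesis using that(1) unfolding good_def by simp
    qed
    show "\<exists>B. good F B" if F: "finite F" "F \<subseteq> Sigma A N" for F
    proof -
      define C where "C = {x \<in> A. {x} \<times> N x \<subseteq> F}"
      have ne: "N x \<noteq> {}" if "x \<in> A" for x using hall[of "{x}"] that by auto
      have "C \<subseteq> fst ` F"
      proof
        fix x assume x: "x \<in> C"
        then obtain y where "y \<in> N x" using ne unfolding C_def by blast
        then have "(x, y) \<in> F" using x unfolding C_def by blast
        then show "x \<in> fst ` F" by (rule rev_image_eqI) simp
      qed
      then have fC: "finite C" using F(1) finite_subset by blast
      have CA: "C \<subseteq> A" by (auto simp: C_def)
      have "\<exists>f. inj_on f C \<and> (\<forall>x\<in>C. f x \<in> N x)"
      proof (rule hall_finite[OF fC])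
        show "finite (N x)" if "x \<in> C" for x using N that CA by blast
        show "card G \<le> card (\<Union>x\<in>G. N x)" if "G \<subseteq> C" for G
          by (rule hall[OF finite_subset[OF that fC]]) (use that CA in blast)
      qed
      then obtain f where f: "inj_on f C" "\<And>x. x \<in> C \<Longrightarrow> f x \<in> N x" by blast
      define B where "B = (\<lambda>x. (x, f x)) ` C"
      have "B \<subseteq> F" using f(2) by (auto simp: B_def C_def)
      then have FB: "F \<inter> B = B" by blast
      have "good F B"
        unfolding good_def FB
      proof (intro conjI ballI impI)
        show "single_valued B" by (auto simp: B_def single_valued_def)
        show "single_valued (B\<inverse>)" using f(1) by (auto simp: B_def single_valued_def inj_on_def)
        fix x assume "x \<in> A" "{x} \<times> N x \<subseteq> F"
        then have "x \<in> C" by (simp add: C_def)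
        then show "\<exists>y\<in>N x. (x, y) \<in> B" using f(2) by (auto simp: B_def)
      qed
      then show ?thesis by blast
    qed
  qed
  then obtain B where B: "B \<subseteq> Sigma A N" "\<And>F. finite F \<Longrightarrow> F \<subseteq> Sigma A N \<Longrightarrow> good F B" by blast
  have tot: "\<exists>y. y \<in> N x \<and> (x, y) \<in> B" if x: "x \<in> A" for x
  proof -
    have "good ({x} \<times> N x) B" using x N by (intro B(2)) auto
    then have "\<forall>z\<in>A. {z} \<times> N z \<subseteq> {x} \<times> N x \<longrightarrow> (\<exists>y\<in>N z. (z, y) \<in> ({x} \<times> N x) \<inter> B)"
      unfolding good_def by (elim conjE)
    from this[rule_format, OF x order_refl] have "\<exists>y\<in>N x. (x, y) \<in> ({x} \<times> N x) \<inter> B" .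
    then show ?thesis by auto
  qed
  have inj: "x = y" if "(x, z) \<in> B" "(y, z) \<in> B" for x y z
  proof -
    have "good {(x, z), (y, z)} B" using that B(1) by (intro B(2)) auto
    then have "single_valued (({(x, z), (y, z)} \<inter> B)\<inverse>)" by (simp add: good_def)
    then show ?thesis by (rule single_valuedD[of _ z]) (use that in auto)
  qed
  obtain f where f: "\<And>x. x \<in> A \<Longrightarrow> f x \<in> N x \<and> (x, f x) \<in> B"
    using bchoice[of A "\<lambda>x y. y \<in> N x \<and> (x, y) \<in> B"] tot by blast
  have "inj_on f A"
  proof (rule inj_onI)
    fix x y assume xy: "x \<in> A" "y \<in> A" "f x = f y"
    show "x = y" by (rule inj[of x "f x"]) (use f[OF xy(1)] f[OF xy(2)] xy(3) in auto)
  qed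
  then show ?thesis using f by blast
qed

text \<open>The bijection is \<open>f\<close> on the least fixed point \<open>S\<close> and the
  inverse of \<open>g\<close> elsewhere. Each of its pairs thus comes from one of the two
  injections, so a relation satisfied by both is satisfied by it.\<close>

lemma schroeder_bernstein_relation:
  assumes f: "inj_on f A" "\<And>x. x \<in> A \<Longrightarrow> f x \<in> B" "\<And>x. x \<in> A \<Longrightarrow> R x (f x)"
    and g: "inj_on g B" "\<And>y. y \<in> B \<Longrightarrow> g y \<in> A" "\<And>y. y \<in> B \<Longrightarrow> R (g y) y"
  shows "\<exists>b. bij_betw b A B \<and> (\<forall>x\<in>A. R x (b x))"
proof -
  define S where "S = lfp (\<lambda>S. A - g ` (B - f ` S))"
  have "mono (\<lambda>S. A - g ` (B - f ` S))" by (rule monoI) blast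
  then have S: "S = A - g ` (B - f ` S)" unfolding S_def by (rule lfp_unfold)
  have SA: "S \<subseteq> A" using S by blast
  have gS: "g ` (B - f ` S) = A - S" using S g(2) by blast
  define h where "h x = (if x \<in> S then f x else inv_into B g x)" for x
  have 1: "bij_betw h S (f ` S)"
    using inj_on_subset[OF f(1) SA] by (auto simp: bij_betw_def h_def inj_on_def)
  have 2: "bij_betw h (A - S) (B - f ` S)"
  proof -
    have "bij_betw g (B - f ` S) (A - S)"
      using inj_on_subset[OF g(1), of "B - f ` S"] gS by (auto simp: bij_betw_def)
    then have "bij_betw (inv_into (B - f ` S) g) (A - S) (B - f ` S)" by (rule bij_betw_inv_into)
    moreover have "inv_into (B - f ` S) g x = h x" if "x \<in> A - S" for x
    proof -
      have "x \<in> g ` (B - f ` S)" using that by (simp only: gS)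
      then obtain y where y: "y \<in> B - f ` S" "x = g y" by (rule imageE)
      then show ?thesis using that inv_into_f_f[OF inj_on_subset[OF g(1)], of "B - f ` S" y] inv_into_f_f[OF g(1), of y]
        by (auto simp: h_def)
    qed
    ultimately show ?thesis using bij_betw_cong by blast
  qed
  have "bij_betw h (S \<union> (A - S)) (f ` S \<union> (B - f ` S))"
    by (rule bij_betw_combine[OF 1 2]) blast
  moreover have "S \<union> (A - S) = A" "f ` S \<union> (B - f ` S) = B" using SA f(2) by auto
  ultimately have "bij_betw h A B" by simp
  moreover have "R x (h x)" if "x \<in> A" for x
  proof (cases "x \<in> S")
    case False
    then have "x \<in> g ` (B - f ` S)" using that by (simp add: gS)
    then obtain y where y: "y \<in> B" "x = g y" by blast
    then show ?thesis using False g inv_into_f_f[OF g(1) y(1)] by (simp add: h_def)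
  qed (use that f in \<open>simp add: h_def\<close>)
  ultimately show ?thesis by blast
qed

section \<open>Operators of controlled support\<close>

lemma coord_simps [simp]:
  "coord 0 x = 0" "coord (f + g) x = coord f x + coord g x" "coord (f - g) x = coord f x - coord g x"
  "coord (- f) x = - coord f x" "coord (c *\<^sub>C f) x = c * coord f x" "coord (delta a) x = (if x = a then 1 else 0)"
  by (simp_all add: zero_ell2.rep_eq plus_ell2.rep_eq minus_ell2.rep_eq uminus_ell2.rep_eq scaleC.rep_eq delta.rep_eq)

lemma norm_delta [simp]: "norm (delta x) = 1"
proof -
  have "complex_of_real ((norm (delta x))\<^sup>2) = complex_of_real 1"
    using cinner_self[of "delta x"] by (simp add: cinner_delta_right)
  then have "(norm (delta x))\<^sup>2 = 1\<^sup>2" by (simp only: of_real_eq_iff one_power2)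
  then show ?thesis by (simp only: power2_eq_iff_nonneg norm_ge_zero zero_le_one)
qed

lemma cmod_coord_le: "cmod (coord f x) \<le> norm f"
  using cmod_cinner_le[of f "delta x"] by (simp add: cinner_delta_right)

text \<open>Composition with \<open>v\<close> on \<open>D\<close>, that is, the matrix with entries
  1 at \<open>(x, v x)\<close>. With this orientation its support is the graph of \<open>v\<close>,
  in accordance with \<open>supp\<close>.\<close>

definition partial_translation :: "'a set \<Rightarrow> ('a \<Rightarrow> 'a) \<Rightarrow> ('a ell2 \<Rightarrow>\<^sub>L 'a ell2)" where
  "partial_translation D v = Blinfun (\<lambda>f. Abs_ell2 (\<lambda>x. if x \<in> D then coord f (v x) else 0))"

lemma partial_translation_summable:
  fixes f :: "'a ell2"
  assumes "inj_on v D"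
  shows "(\<lambda>x. (cmod (if x \<in> D then coord f (v x) else 0))\<^sup>2) summable_on UNIV"
    and "(\<Sum>\<^sub>\<infinity>x. (cmod (if x \<in> D then coord f (v x) else 0))\<^sup>2) \<le> (norm f)\<^sup>2"
proof -
  let ?n = "\<lambda>x. (cmod (coord f x))\<^sup>2"
  have s: "?n summable_on v ` D" by (rule summable_on_subset_banach[OF coord_summable]) simp
  then have "(?n \<circ> v) summable_on D" using summable_on_reindex[OF assms, of ?n] by simp
  then show "(\<lambda>x. (cmod (if x \<in> D then coord f (v x) else 0))\<^sup>2) summable_on UNIV"
    by (subst summable_on_cong_neutral[where T = D and g = "?n \<circ> v"]) auto
  have "(\<Sum>\<^sub>\<infinity>x. (cmod (if x \<in> D then coord f (v x) else 0))\<^sup>2) = infsum (?n \<circ> v) D"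
    by (rule infsum_cong_neutral) auto
  also have "\<dots> = infsum ?n (v ` D)" by (rule infsum_reindex[OF assms, symmetric])
  also have "\<dots> \<le> infsum ?n UNIV"
    by (rule infsum_mono_neutral[OF s coord_summable]) auto
  also have "\<dots> = (norm f)\<^sup>2" by (simp add: norm_square_ell2)
  finally show "(\<Sum>\<^sub>\<infinity>x. (cmod (if x \<in> D then coord f (v x) else 0))\<^sup>2) \<le> (norm f)\<^sup>2" .
qed

lemma coord_partial_translation:
  assumes "inj_on v D"
  shows "coord (blinfun_apply (partial_translation D v) f) x = (if x \<in> D then coord f (v x) else 0)"
proof -
  let ?T = "\<lambda>f. Abs_ell2 (\<lambda>x. if x \<in> D then coord f (v x) else 0)"
  have c: "coord (?T f) x = (if x \<in> D then coord f (v x) else 0)" for f x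
    using partial_translation_summable(1)[OF assms, of f] by (simp add: Abs_ell2_inverse)
  have "bounded_linear ?T"
  proof (rule bounded_linear_intro[where K = 1])
    show "?T (f + g) = ?T f + ?T g" for f g by (rule ell2_eqI) (simp add: c)
    show "?T (r *\<^sub>R f) = r *\<^sub>R ?T f" for r f by (rule ell2_eqI) (simp add: c scaleR_ell2_def)
    have le: "(norm (?T f))\<^sup>2 \<le> (norm f)\<^sup>2" for f
      using partial_translation_summable(2)[OF assms, of f] by (simp add: norm_square_ell2 c)
    show "norm (?T f) \<le> norm f * 1" for f using power2_le_imp_le[OF le norm_ge_zero] by simp
  qed
  then show ?thesis unfolding partial_translation_def by (simp add: bounded_linear_Blinfun_apply c)
qed

definition proj :: "'a set \<Rightarrow> ('a ell2 \<Rightarrow>\<^sub>L 'a ell2)" where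
  "proj A = partial_translation A id"

lemma coord_proj [simp]: "coord (blinfun_apply (proj A) f) x = (if x \<in> A then coord f x else 0)"
  by (simp add: proj_def coord_partial_translation)

lemma proj_compose: "proj A o\<^sub>L proj B = proj (A \<inter> B)"
  by (rule blinfun_eqI, rule ell2_eqI) simp

lemma proj_delta: "blinfun_apply (proj A) (delta x) = (if x \<in> A then delta x else 0)"
  by (rule ell2_eqI) simp

lemma bounded_opsD:
  assumes "T \<in> bounded_ops X"
  shows "clinear_op T" "x \<notin> X \<Longrightarrow> coord (blinfun_apply T f) x = 0"
    "(\<And>x. x \<in> X \<Longrightarrow> coord f x = 0) \<Longrightarrow> blinfun_apply T f = 0"
  using assms by (auto simp: bounded_ops_def)

lemma clinear_opD: "clinear_op T \<Longrightarrow> blinfun_apply T (c *\<^sub>C f) = c *\<^sub>C blinfun_apply T f"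
  by (simp add: clinear_op_def)

lemma proj_bounded_ops_left: "T \<in> bounded_ops X \<Longrightarrow> proj X o\<^sub>L T = T"
  by (rule blinfun_eqI, rule ell2_eqI) (auto simp: bounded_opsD)

lemma proj_bounded_ops_right:
  assumes "T \<in> bounded_ops X"
  shows "T o\<^sub>L proj X = T"
proof (rule blinfun_eqI)
  fix f
  have "blinfun_apply T (f - blinfun_apply (proj X) f) = 0" by (rule bounded_opsD(3)[OF assms]) simp
  then show "blinfun_apply (T o\<^sub>L proj X) f = blinfun_apply T f" by (simp add: blinfun.diff_right)
qed

lemma cinner_eqI: "(\<And>g. cinner g f = cinner g h) \<Longrightarrow> f = h"
proof (rule ell2_eqI)
  fix x assume "\<And>g. cinner g f = cinner g h"
  from this[of "delta x"] show "coord f x = coord h x" by (simp add: cinner_delta_left)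
qed

lemma adj_cinner: "clinear_op T \<Longrightarrow> cinner (blinfun_apply T f) g = cinner f (blinfun_apply (adj T) g)"
  using adj_correct[of T] by (simp add: is_adjoint_def)

lemma adj_cinner': "clinear_op T \<Longrightarrow> cinner (blinfun_apply (adj T) f) g = cinner f (blinfun_apply T g)"
  using adj_cinner[of T g f] by (metis cnj_cinner)

lemma adj_eqI:
  assumes "\<And>f g. cinner (blinfun_apply T f) g = cinner f (blinfun_apply S g)"
  shows "adj T = S"
proof -
  have "is_adjoint S T" using assms by (simp add: is_adjoint_def)
  then show ?thesis unfolding adj_def by (rule the_equality) (rule adjoint_unique[OF _ \<open>is_adjoint S T\<close>])
qed

lemma clinear_adj: "clinear_op T \<Longrightarrow> clinear_op (adj T)"
  unfolding clinear_op_def[of "adj T"]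
  by (intro allI cinner_eqI) (simp add: adj_cinner[symmetric] cinner_scaleC_right)

lemma cinner_diff_left: "cinner (f - g) h = cinner f h - cinner g h"
  using cinner_add_left[of "f - g" g h] by simp

lemma cinner_diff_right: "cinner h (f - g) = cinner h f - cinner h g"
  using cinner_add_right[of h "f - g" g] by simp

lemma adj_diff: "clinear_op S \<Longrightarrow> clinear_op T \<Longrightarrow> adj (S - T) = adj S - adj T"
  by (rule adj_eqI) (simp add: blinfun.diff_left cinner_diff_left cinner_diff_right adj_cinner)

lemma scaleC_diff: "c *\<^sub>C (f - g) = c *\<^sub>C f - c *\<^sub>C g"
  by (rule ell2_eqI) (simp add: algebra_simps)

lemma scaleC_left_commute: "c *\<^sub>C d *\<^sub>C f = d *\<^sub>C c *\<^sub>C f"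
  by (rule ell2_eqI) simp

lemma clinear_ops:
  "clinear_op S \<Longrightarrow> clinear_op T \<Longrightarrow> clinear_op (S + T)"
  "clinear_op S \<Longrightarrow> clinear_op T \<Longrightarrow> clinear_op (S - T)"
  "clinear_op S \<Longrightarrow> clinear_op T \<Longrightarrow> clinear_op (S o\<^sub>L T)"
  "clinear_op T \<Longrightarrow> clinear_op (scaleC_op c T)"
  by (simp_all add: clinear_op_def blinfun.add_left blinfun.diff_left scaleC_op_apply scaleC_add scaleC_diff)
    (simp add: scaleC_left_commute)

lemma norm_adj_le:
  assumes "clinear_op T"
  shows "norm (adj T) \<le> norm T"
proof (rule norm_blinfun_bound)
  fix g
  let ?h = "blinfun_apply (adj T) g"
  have "norm ?h * norm ?h = cmod (cinner ?h ?h)" by (simp add: cinner_self power2_eq_square norm_mult)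
  also have "\<dots> = cmod (cinner (blinfun_apply T ?h) g)" by (simp add: adj_cinner[OF assms])
  also have "\<dots> \<le> norm (blinfun_apply T ?h) * norm g" by (rule cmod_cinner_le)
  also have "\<dots> \<le> (norm T * norm ?h) * norm g" by (intro mult_right_mono norm_blinfun) simp
  finally have "norm ?h * norm ?h \<le> norm ?h * (norm T * norm g)" by (simp add: mult_ac)
  then show "norm ?h \<le> norm T * norm g"
    by (cases "norm ?h = 0") (simp_all add: mult_le_cancel_left)
qed simp

lemma adj_proj: "adj (proj A) = proj A"
proof (rule adj_eqI)
  fix f g :: "'a ell2"
  show "cinner (blinfun_apply (proj A) f) g = cinner f (blinfun_apply (proj A) g)"
    unfolding cinner_def by (rule infsum_cong) simp
qed

lemma supp_iff: "(x, x') \<in> supp T \<longleftrightarrow> coord (blinfun_apply T (delta x')) x \<noteq> 0"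
  by (simp add: supp_def cinner_delta_right)

lemma coord_adj_delta:
  "clinear_op S \<Longrightarrow> coord (blinfun_apply (adj S) (delta x)) x' = cnj (coord (blinfun_apply S (delta x')) x)"
  using adj_cinner'[of S "delta x" "delta x'"] by (simp only: cinner_delta_left cinner_delta_right)

lemma supp_adj: "clinear_op T \<Longrightarrow> supp (adj T) = (supp T)\<inverse>"
  by (auto simp: supp_iff coord_adj_delta)

text \<open>An entry of the product is the inner product of a column of \<open>T\<close> with a
  column of \<open>adj S\<close>. If it is nonzero, so is one of its summands, which names the
  intermediate point.\<close>

lemma supp_compose:
  assumes "clinear_op S"
  shows "supp (S o\<^sub>L T) \<subseteq> supp S O supp T"
proof (clarify)
  fix x x'' assume "(x, x'') \<in> supp (S o\<^sub>L T)"
  then have "cinner (blinfun_apply S (blinfun_apply T (delta x''))) (delta x) \<noteq> 0"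
    by (simp add: supp_def)
  then have ne: "cinner (blinfun_apply T (delta x'')) (blinfun_apply (adj S) (delta x)) \<noteq> 0"
    by (simp add: adj_cinner[OF assms])
  have "\<exists>x'. coord (blinfun_apply T (delta x'')) x' * cnj (coord (blinfun_apply (adj S) (delta x)) x') \<noteq> 0"
  proof (rule ccontr)
    assume "\<nexists>x'. coord (blinfun_apply T (delta x'')) x' * cnj (coord (blinfun_apply (adj S) (delta x)) x') \<noteq> 0"
    then have "cinner (blinfun_apply T (delta x'')) (blinfun_apply (adj S) (delta x)) = 0"
      unfolding cinner_def by (intro infsum_0) blast
    with ne show False by contradiction
  qed
  then obtain x' where "coord (blinfun_apply T (delta x'')) x' * cnj (coord (blinfun_apply (adj S) (delta x)) x') \<noteq> 0" ..
  then have "(x', x'') \<in> supp T" "(x, x') \<in> supp S"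
    by (auto simp: supp_iff coord_adj_delta[OF assms])
  then show "(x, x'') \<in> supp S O supp T" by blast
qed

lemma supp_add: "supp (S + T) \<subseteq> supp S \<union> supp T"
  by (auto simp: supp_iff blinfun.add_left)

lemma bounded_ops_compose: "S \<in> bounded_ops X \<Longrightarrow> T \<in> bounded_ops X \<Longrightarrow> S o\<^sub>L T \<in> bounded_ops X"
  by (auto simp: bounded_ops_def clinear_op_def blinfun.zero_right)

lemma bounded_ops_add: "S \<in> bounded_ops X \<Longrightarrow> T \<in> bounded_ops X \<Longrightarrow> S + T \<in> bounded_ops X"
  by (auto simp: bounded_ops_def blinfun.add_left intro: clinear_ops)

lemma bounded_ops_adj:
  assumes T: "T \<in> bounded_ops X"
  shows "adj T \<in> bounded_ops X"
proof -
  note c = bounded_opsD(1)[OF T]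
  have "coord (blinfun_apply (adj T) f) x = 0" if "x \<notin> X" for f x
  proof -
    have "blinfun_apply T (delta x) = 0" using that by (intro bounded_opsD(3)[OF T]) auto
    then have "cinner (blinfun_apply (adj T) f) (delta x) = 0"
      using adj_cinner'[OF c, of f "delta x"] by (simp add: cinner_def)
    then show ?thesis by (simp add: cinner_delta_right)
  qed
  moreover have "blinfun_apply (adj T) f = 0" if "\<forall>x\<in>X. coord f x = 0" for f
  proof (rule cinner_eqI)
    fix g
    have z: "coord (blinfun_apply T g) x * cnj (coord f x) = 0" for x
      using bounded_opsD(2)[OF T, of x g] that by (cases "x \<in> X") auto
    have "cinner (blinfun_apply T g) f = 0" unfolding cinner_def by (rule infsum_0) (rule z)
    then show "cinner g (blinfun_apply (adj T) f) = cinner g 0"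
      unfolding adj_cinner[OF c] by (simp add: cinner_def)
  qed
  ultimately show ?thesis using clinear_adj[OF c] by (simp add: bounded_ops_def)
qed

lemma closed_bounded_ops: "closed (bounded_ops X)"
proof -
  have c1: "continuous_on UNIV (\<lambda>T::'a ell2 \<Rightarrow>\<^sub>L 'a ell2. blinfun_apply T f)" for f
    by (intro continuous_intros)
  have c2: "continuous_on UNIV (\<lambda>T::'a ell2 \<Rightarrow>\<^sub>L 'a ell2. c *\<^sub>C blinfun_apply T f)" for c f
    by (rule bounded_linear.continuous_on[OF bounded_linear_scaleC c1])
  have c3: "continuous_on UNIV (\<lambda>T::'a ell2 \<Rightarrow>\<^sub>L 'a ell2. coord (blinfun_apply T f) x)" for f x
    unfolding cinner_delta_right[symmetric]
    by (rule bounded_linear.continuous_on[OF bounded_linear_cinner_left c1])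
  have "bounded_ops X = (\<Inter>c. \<Inter>f. {T. blinfun_apply T (c *\<^sub>C f) = c *\<^sub>C blinfun_apply T f})
      \<inter> (\<Inter>f. \<Inter>x\<in>- X. {T. coord (blinfun_apply T f) x = 0})
      \<inter> (\<Inter>f\<in>{f. \<forall>x\<in>X. coord f x = 0}. {T. blinfun_apply T f = 0})"
    by (auto simp: bounded_ops_def clinear_op_def)
  also have "closed \<dots>"
    by (intro closed_Int closed_INT ballI closed_Collect_eq c1 c2 c3 continuous_on_const)
  finally show ?thesis .
qed

lemma proj_in_bounded_ops: "A \<subseteq> X \<Longrightarrow> scaleC_op c (proj A) \<in> bounded_ops X"
  by (auto simp: bounded_ops_def clinear_op_def scaleC_op_apply intro!: ell2_eqI)

lemma scaleC_op_one: "scaleC_op 1 T = T"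
  by (rule blinfun_eqI, rule ell2_eqI) (simp add: scaleC_op_apply)

locale ulf_space = coarse_space X \<E> for X :: "'a set" and \<E> :: "('a \<times> 'a) set set" +
  assumes ulf: "uniformly_locally_finite X \<E>"
begin

abbreviation "\<A> \<equiv> uniform_Roe_algebra X \<E>"

lemma base_in_algebra: "b \<in> bounded_ops X \<Longrightarrow> supp b \<in> \<E> \<Longrightarrow> b \<in> \<A>"
  unfolding uniform_Roe_algebra_def by (rule subsetD[OF closure_subset]) simp

lemma algebra_approx:
  assumes "T \<in> \<A>" "e > 0"
  obtains b where "b \<in> bounded_ops X" "supp b \<in> \<E>" "norm (T - b) < e"
proof -
  have "\<exists>b\<in>{T \<in> bounded_ops X. supp T \<in> \<E>}. dist b T < e"
    using assms by (simp only: uniform_Roe_algebra_def closure_approachable)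
  then obtain b where "b \<in> {T \<in> bounded_ops X. supp T \<in> \<E>}" "dist b T < e" ..
  then show ?thesis by (intro that[of b]) (simp_all add: dist_norm norm_minus_commute)
qed

lemma algebra_bounded: "T \<in> \<A> \<Longrightarrow> T \<in> bounded_ops X"
  unfolding uniform_Roe_algebra_def
  by (erule subsetD[OF closure_minimal[OF _ closed_bounded_ops], rotated]) (rule Collect_subset)

lemma algebra_seq:
  assumes "T \<in> \<A>"
  obtains s where "\<And>n. s n \<in> bounded_ops X" "\<And>n. supp (s n) \<in> \<E>" "s \<longlonglongrightarrow> T"
proof -
  have "\<exists>s. (\<forall>n. s n \<in> {T \<in> bounded_ops X. supp T \<in> \<E>}) \<and> s \<longlonglongrightarrow> T"
    using assms by (simp only: uniform_Roe_algebra_def closure_sequential)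
  then obtain s where "(\<forall>n. s n \<in> {T \<in> bounded_ops X. supp T \<in> \<E>}) \<and> s \<longlonglongrightarrow> T" ..
  then show ?thesis by (intro that[of s]) simp_all
qed

lemma algebra_limit:
  assumes "\<And>n. s n \<in> bounded_ops X" "\<And>n. supp (s n) \<in> \<E>" "s \<longlonglongrightarrow> T"
  shows "T \<in> \<A>"
  unfolding uniform_Roe_algebra_def closure_sequential using assms by (intro exI[of _ s]) simp

lemma algebra_compose:
  assumes "S \<in> \<A>" "T \<in> \<A>"
  shows "S o\<^sub>L T \<in> \<A>"
proof -
  obtain s where s: "\<And>n. s n \<in> bounded_ops X" "\<And>n. supp (s n) \<in> \<E>" "s \<longlonglongrightarrow> S" by (rule algebra_seq[OF assms(1)]) blast
  obtain t where t: "\<And>n. t n \<in> bounded_ops X" "\<And>n. supp (t n) \<in> \<E>" "t \<longlonglongrightarrow> T" by (rule algebra_seq[OF assms(2)]) blast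
  show ?thesis
  proof (rule algebra_limit[where s = "\<lambda>n. s n o\<^sub>L t n"])
    show "s n o\<^sub>L t n \<in> bounded_ops X" for n by (rule bounded_ops_compose[OF s(1) t(1)])
    show "supp (s n o\<^sub>L t n) \<in> \<E>" for n
      by (rule subset_closed[OF comp_closed[OF s(2) t(2)] supp_compose[OF bounded_opsD(1)[OF s(1)]]])
    show "(\<lambda>n. s n o\<^sub>L t n) \<longlonglongrightarrow> (S o\<^sub>L T)"
      by (rule bounded_bilinear.tendsto[OF bounded_bilinear_blinfun_compose s(3) t(3)])
  qed
qed

lemma algebra_add:
  assumes "S \<in> \<A>" "T \<in> \<A>"
  shows "S + T \<in> \<A>"
proof -
  obtain s where s: "\<And>n. s n \<in> bounded_ops X" "\<And>n. supp (s n) \<in> \<E>" "s \<longlonglongrightarrow> S" by (rule algebra_seq[OF assms(1)]) blast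
  obtain t where t: "\<And>n. t n \<in> bounded_ops X" "\<And>n. supp (t n) \<in> \<E>" "t \<longlonglongrightarrow> T" by (rule algebra_seq[OF assms(2)]) blast
  show ?thesis
  proof (rule algebra_limit[where s = "\<lambda>n. s n + t n"])
    show "s n + t n \<in> bounded_ops X" for n by (rule bounded_ops_add[OF s(1) t(1)])
    show "supp (s n + t n) \<in> \<E>" for n
      by (rule subset_closed[OF union_closed[OF s(2) t(2)] supp_add])
    show "(\<lambda>n. s n + t n) \<longlonglongrightarrow> S + T" by (intro tendsto_add s t)
  qed
qed

lemma algebra_adj:
  assumes "T \<in> \<A>"
  shows "adj T \<in> \<A>"
proof -
  obtain t where t: "\<And>n. t n \<in> bounded_ops X" "\<And>n. supp (t n) \<in> \<E>" "t \<longlonglongrightarrow> T" by (rule algebra_seq[OF assms]) blast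
  have cT: "clinear_op T" using algebra_bounded[OF assms] by (rule bounded_opsD(1))
  have ct: "clinear_op (t n)" for n using t(1) by (rule bounded_opsD(1))
  show ?thesis
  proof (rule algebra_limit[where s = "\<lambda>n. adj (t n)"])
    show "adj (t n) \<in> bounded_ops X" for n by (rule bounded_ops_adj[OF t(1)])
    show "supp (adj (t n)) \<in> \<E>" for n
      unfolding supp_adj[OF ct] by (rule converse_closed[OF t(2)])
    have "norm (adj (t n) - adj T) \<le> norm (t n - T)" for n
      unfolding adj_diff[OF ct cT, symmetric] by (rule norm_adj_le) (intro clinear_ops ct cT)
    then have ev: "\<forall>\<^sub>F n in sequentially. norm (adj (t n) - adj T) \<le> norm (t n - T)"
      by (intro always_eventually allI)
    have "(\<lambda>n. norm (t n - T)) \<longlonglongrightarrow> 0" using t(3) by (simp add: LIM_zero tendsto_norm_zero)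
    then have "(\<lambda>n. adj (t n) - adj T) \<longlonglongrightarrow> 0" by (rule Lim_null_comparison[OF ev])
    then show "(\<lambda>n. adj (t n)) \<longlonglongrightarrow> adj T" by (rule LIM_zero_cancel)
  qed
qed

lemma partial_translation_in_algebra:
  assumes v: "inj_on v D" "D \<subseteq> X" "v ` D \<subseteq> X" and E: "(\<lambda>x. (x, v x)) ` D \<in> \<E>"
  shows "partial_translation D v \<in> \<A>"
proof (rule base_in_algebra)
  show "partial_translation D v \<in> bounded_ops X"
    unfolding bounded_ops_def
  proof (intro CollectI conjI allI impI)
    show "clinear_op (partial_translation D v)"
      unfolding clinear_op_def by (intro allI ell2_eqI) (simp add: coord_partial_translation[OF v(1)])
    show "coord (blinfun_apply (partial_translation D v) f) x = 0" if "x \<notin> X" for f x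
      using v(2) that by (auto simp: coord_partial_translation[OF v(1)])
    show "blinfun_apply (partial_translation D v) f = 0" if "\<forall>x\<in>X. coord f x = 0" for f
      by (rule ell2_eqI) (use that v(3) in \<open>auto simp: coord_partial_translation[OF v(1)]\<close>)
  qed
  have "supp (partial_translation D v) \<subseteq> (\<lambda>x. (x, v x)) ` D"
    by (auto simp: supp_iff coord_partial_translation[OF v(1)] split: if_splits)
  then show "supp (partial_translation D v) \<in> \<E>" by (rule subset_closed[OF E])
qed

lemma scaled_proj_in_algebra:
  assumes "A \<subseteq> X"
  shows "scaleC_op c (proj A) \<in> \<A>"
proof (rule base_in_algebra[OF proj_in_bounded_ops[OF assms]])
  have "supp (scaleC_op c (proj A)) \<subseteq> Id_on X"
    using assms by (auto simp: supp_iff scaleC_op_apply split: if_splits)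
  then show "supp (scaleC_op c (proj A)) \<in> \<E>" by (rule subset_closed[OF diagonal])
qed

lemma proj_in_algebra: "A \<subseteq> X \<Longrightarrow> proj A \<in> \<A>"
  using scaled_proj_in_algebra[of A 1] by (simp add: scaleC_op_one)

lemma algebra_scaleC:
  assumes "T \<in> \<A>"
  shows "scaleC_op c T \<in> \<A>"
proof -
  have "scaleC_op c (proj X) o\<^sub>L T = scaleC_op c (proj X o\<^sub>L T)"
    by (rule blinfun_eqI) (simp add: scaleC_op_apply)
  then show ?thesis
    using algebra_compose[OF scaled_proj_in_algebra[OF order_refl] assms, of c]
    by (simp add: proj_bounded_ops_left[OF algebra_bounded[OF assms]])
qed

lemma degree_bound:
  assumes "E \<in> \<E>"
  obtains N where "\<And>x. x \<in> X \<Longrightarrow> finite (E `` {x})" "\<And>x. x \<in> X \<Longrightarrow> card (E `` {x}) \<le> N"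
  using ulf assms unfolding uniformly_locally_finite_def by blast

end

lemma star_isomorphism_inverse:
  assumes X: "ulf_space X \<E>" and \<Phi>: "star_isomorphism \<Phi> (uniform_Roe_algebra X \<E>) B"
  shows "star_isomorphism (inv_into (uniform_Roe_algebra X \<E>) \<Phi>) B (uniform_Roe_algebra X \<E>)"
proof -
  interpret ulf_space X \<E> by (rule X)
  let ?\<Psi> = "inv_into \<A> \<Phi>"
  have bij: "bij_betw \<Phi> \<A> B" using \<Phi> by (simp add: star_isomorphism_def)
  have inv: "\<Phi> (?\<Psi> S) = S" "?\<Psi> S \<in> \<A>" if "S \<in> B" for S
    using that bij by (auto simp: bij_betw_def f_inv_into_f inv_into_into)
  have eq: "?\<Psi> S = T" if "T \<in> \<A>" "\<Phi> T = S" for S T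
    using that bij by (auto simp: bij_betw_def)
  show ?thesis
    unfolding star_isomorphism_def
  proof (intro conjI ballI allI)
    show "bij_betw ?\<Psi> B \<A>" by (rule bij_betw_inv_into[OF bij])
    show "?\<Psi> (S + T) = ?\<Psi> S + ?\<Psi> T" if "S \<in> B" "T \<in> B" for S T
      using \<Phi> inv[OF that(1)] inv[OF that(2)] by (intro eq algebra_add) (auto simp: star_isomorphism_def)
    show "?\<Psi> (scaleC_op c T) = scaleC_op c (?\<Psi> T)" if "T \<in> B" for c T
      using \<Phi> inv[OF that] by (intro eq algebra_scaleC) (auto simp: star_isomorphism_def)
    show "?\<Psi> (S o\<^sub>L T) = ?\<Psi> S o\<^sub>L ?\<Psi> T" if "S \<in> B" "T \<in> B" for S T
      using \<Phi> inv[OF that(1)] inv[OF that(2)] by (intro eq algebra_compose) (auto simp: star_isomorphism_def)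
    show "?\<Psi> (adj T) = adj (?\<Psi> T)" if "T \<in> B" for T
      using \<Phi> inv[OF that] by (intro eq algebra_adj) (auto simp: star_isomorphism_def)
  qed
qed

section \<open>Images of rank one projections\<close>

lemma proj_singleton: "blinfun_apply (proj {x}) f = coord f x *\<^sub>C delta x"
  by (rule ell2_eqI) simp

lemma proj_sandwich:
  assumes "clinear_op T"
  shows "proj {x} o\<^sub>L T o\<^sub>L proj {x} = scaleC_op (coord (blinfun_apply T (delta x)) x) (proj {x})"
  by (rule blinfun_eqI, rule ell2_eqI)
    (simp add: proj_singleton scaleC_op_apply clinear_opD[OF assms])

lemma scaleC_left_cancel: "f \<noteq> 0 \<Longrightarrow> c *\<^sub>C f = d *\<^sub>C f \<Longrightarrow> c = d"
proof -
  assume "f \<noteq> 0" and eq: "c *\<^sub>C f = d *\<^sub>C f"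
  then obtain x where "coord f x \<noteq> 0" by (metis ell2_eqI coord_simps(1))
  moreover have "coord (c *\<^sub>C f) x = coord (d *\<^sub>C f) x" using eq by (rule arg_cong)
  ultimately show "c = d" by simp
qed

definition is_rank_one :: "('a ell2 \<Rightarrow>\<^sub>L 'a ell2) \<Rightarrow> 'a ell2 \<Rightarrow> bool" where
  "is_rank_one q \<xi> \<longleftrightarrow> norm \<xi> = 1 \<and> (\<forall>f. blinfun_apply q f = cinner f \<xi> *\<^sub>C \<xi>)"

text \<open>Take y with \<zeta> = \<open>q (delta y)\<close> nonzero. Evaluating
  \<open>q o\<^sub>L proj {y} o\<^sub>L q\<close> at f gives both \<open>k *\<^sub>C q f\<close> and
  \<open>cinner f \<zeta> *\<^sub>C \<zeta>\<close>, and k turns out to be the squared norm of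
  \<zeta>. Since one nonzero column suffices, minimality is stated for basis projections.\<close>

lemma minimal_projection_rank_one:
  assumes q: "q \<in> bounded_ops Y" and idem: "q o\<^sub>L q = q" and sa: "adj q = q" and nz: "q \<noteq> 0"
    and minimal: "\<And>y. y \<in> Y \<Longrightarrow> \<exists>c. q o\<^sub>L proj {y} o\<^sub>L q = scaleC_op c q"
  shows "\<exists>\<xi>. is_rank_one q \<xi>"
proof -
  note c = bounded_opsD(1)[OF q]
  have sym: "cinner (blinfun_apply q f) g = cinner f (blinfun_apply q g)" for f g
    using adj_cinner[OF c, of f g] by (simp add: sa)
  have "\<exists>y\<in>Y. blinfun_apply q (delta y) \<noteq> 0"
  proof (rule ccontr)
    assume "\<not> (\<exists>y\<in>Y. blinfun_apply q (delta y) \<noteq> 0)"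
    then have z: "blinfun_apply q (delta y) = 0" if "y \<in> Y" for y using that by blast
    have "coord (blinfun_apply q f) y = 0" for f y
    proof (cases "y \<in> Y")
      case True
      have "coord (blinfun_apply q f) y = cinner f (blinfun_apply q (delta y))"
        by (simp only: cinner_delta_right[symmetric] sym)
      then show ?thesis by (simp add: z[OF True] cinner_def)
    qed (rule bounded_opsD(2)[OF q])
    then have "q = 0" by (intro blinfun_eqI ell2_eqI) simp
    with nz show False by contradiction
  qed
  then obtain y where y: "y \<in> Y" "blinfun_apply q (delta y) \<noteq> 0" by blast
  define \<zeta> where "\<zeta> = blinfun_apply q (delta y)"
  obtain k where k: "q o\<^sub>L proj {y} o\<^sub>L q = scaleC_op k q" using minimal[OF y(1)] by blast
  have qq: "blinfun_apply q (blinfun_apply q f) = blinfun_apply q f" for f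
    using idem by (metis blinfun_apply_blinfun_compose)
  have main: "k *\<^sub>C blinfun_apply q f = cinner f \<zeta> *\<^sub>C \<zeta>" for f
  proof -
    have "k *\<^sub>C blinfun_apply q f = blinfun_apply (q o\<^sub>L proj {y} o\<^sub>L q) f"
      by (simp add: k scaleC_op_apply)
    also have "\<dots> = coord (blinfun_apply q f) y *\<^sub>C \<zeta>"
      by (simp add: proj_singleton clinear_opD[OF c] \<zeta>_def)
    also have "coord (blinfun_apply q f) y = cinner f \<zeta>"
      unfolding \<zeta>_def by (simp only: cinner_delta_right[symmetric] sym)
    finally show ?thesis .
  qed
  have "k *\<^sub>C \<zeta> = cinner (delta y) \<zeta> *\<^sub>C \<zeta>"
    using main[of "delta y"] by (simp add: \<zeta>_def)
  then have "k = cinner (delta y) \<zeta>" using y(2) by (intro scaleC_left_cancel[of \<zeta>]) (simp_all add: \<zeta>_def)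
  also have "cinner (delta y) \<zeta> = cinner \<zeta> \<zeta>"
    unfolding \<zeta>_def using sym[of "delta y" "blinfun_apply q (delta y)"] by (simp add: qq)
  finally have k: "k = complex_of_real ((norm \<zeta>)\<^sup>2)" by (simp only: cinner_self)
  have n0: "norm \<zeta> \<noteq> 0" using y(2) by (simp add: \<zeta>_def)
  define \<xi> where "\<xi> = complex_of_real (1 / norm \<zeta>) *\<^sub>C \<zeta>"
  have "norm \<xi> = 1" using n0 by (simp add: \<xi>_def norm_scaleC norm_divide)
  moreover have "blinfun_apply q f = cinner f \<xi> *\<^sub>C \<xi>" for f
  proof (rule ell2_eqI)
    fix x
    have "coord (k *\<^sub>C blinfun_apply q f) x = coord (cinner f \<zeta> *\<^sub>C \<zeta>) x" by (simp only: main)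
    then have "coord (blinfun_apply q f) x = cinner f \<zeta> * coord \<zeta> x / complex_of_real ((norm \<zeta>)\<^sup>2)"
      using n0 k by (simp add: field_simps)
    then show "coord (blinfun_apply q f) x = coord (cinner f \<xi> *\<^sub>C \<xi>) x"
      by (simp add: \<xi>_def cinner_scaleC_right power2_eq_square)
  qed
  ultimately show ?thesis unfolding is_rank_one_def by blast
qed

text \<open>The vector is determined only up to a unimodular factor; for this reason
  \<open>cmod_xi_eta\<close> compares moduli.\<close>

definition range_vector :: "('a ell2 \<Rightarrow>\<^sub>L 'a ell2) \<Rightarrow> 'a ell2" where
  "range_vector q = (SOME \<xi>. is_rank_one q \<xi>)"

locale roe_iso = X: ulf_space X \<E> + Y: ulf_space Y \<F>
  for X :: "'a set" and \<E> and Y :: "'b set" and \<F> +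
  fixes \<Phi> :: "('a ell2 \<Rightarrow>\<^sub>L 'a ell2) \<Rightarrow> ('b ell2 \<Rightarrow>\<^sub>L 'b ell2)"
  assumes iso: "star_isomorphism \<Phi> (uniform_Roe_algebra X \<E>) (uniform_Roe_algebra Y \<F>)"
begin

abbreviation "\<Psi> \<equiv> inv_into (uniform_Roe_algebra X \<E>) \<Phi>"

lemma inverse: "roe_iso Y \<F> X \<E> \<Psi>"
proof -
  have "star_isomorphism \<Psi> (uniform_Roe_algebra Y \<F>) (uniform_Roe_algebra X \<E>)"
    by (rule star_isomorphism_inverse[OF X.ulf_space_axioms iso])
  then show ?thesis by (intro roe_iso.intro roe_iso_axioms.intro X.ulf_space_axioms Y.ulf_space_axioms)
qed

lemma Phi_add: "S \<in> X.\<A> \<Longrightarrow> T \<in> X.\<A> \<Longrightarrow> \<Phi> (S + T) = \<Phi> S + \<Phi> T"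
  and Phi_scaleC: "T \<in> X.\<A> \<Longrightarrow> \<Phi> (scaleC_op c T) = scaleC_op c (\<Phi> T)"
  and Phi_compose: "S \<in> X.\<A> \<Longrightarrow> T \<in> X.\<A> \<Longrightarrow> \<Phi> (S o\<^sub>L T) = \<Phi> S o\<^sub>L \<Phi> T"
  and Phi_adj: "T \<in> X.\<A> \<Longrightarrow> \<Phi> (adj T) = adj (\<Phi> T)"
  and Phi_bij: "bij_betw \<Phi> X.\<A> Y.\<A>"
  using iso unfolding star_isomorphism_def by blast+

lemma Phi_in: "T \<in> X.\<A> \<Longrightarrow> \<Phi> T \<in> Y.\<A>"
  using Phi_bij by (auto simp: bij_betw_def)

lemma Phi_clinear: "T \<in> X.\<A> \<Longrightarrow> clinear_op (\<Phi> T)"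
  by (rule bounded_opsD(1)[OF Y.algebra_bounded[OF Phi_in]])

lemma Psi_Phi: "T \<in> X.\<A> \<Longrightarrow> \<Psi> (\<Phi> T) = T"
  using Phi_bij by (auto simp: bij_betw_def)

lemma Phi_Psi: "S \<in> Y.\<A> \<Longrightarrow> \<Phi> (\<Psi> S) = S"
  using Phi_bij by (auto simp: bij_betw_def f_inv_into_f)

lemma Psi_in: "S \<in> Y.\<A> \<Longrightarrow> \<Psi> S \<in> X.\<A>"
  using Phi_bij by (auto simp: bij_betw_def inv_into_into)

lemma Phi_zero: "\<Phi> 0 = 0"
proof -
  have z: "scaleC_op 0 T = 0" for T :: "'c ell2 \<Rightarrow>\<^sub>L 'c ell2"
    by (rule blinfun_eqI, rule ell2_eqI) (simp add: scaleC_op_apply)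
  have "\<Phi> (scaleC_op 0 (proj {})) = scaleC_op 0 (\<Phi> (proj {}))"
    by (rule Phi_scaleC[OF X.proj_in_algebra]) simp
  then show ?thesis by (simp add: z)
qed

lemma Phi_eq_zero: "T \<in> X.\<A> \<Longrightarrow> \<Phi> T = 0 \<Longrightarrow> T = 0"
proof -
  assume T: "T \<in> X.\<A>" "\<Phi> T = 0"
  have "proj {} = (0 :: 'a ell2 \<Rightarrow>\<^sub>L 'a ell2)" by (rule blinfun_eqI, rule ell2_eqI) simp
  then have "0 \<in> X.\<A>" using X.proj_in_algebra[of "{}"] by simp
  then show "T = 0" using T Phi_zero Phi_bij unfolding bij_betw_def inj_on_def by metis
qed

definition xi :: "'a \<Rightarrow> 'b ell2" where "xi x = range_vector (\<Phi> (proj {x}))"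

text \<open>Minimality is an algebraic property: surjectivity writes \<open>proj {y}\<close> as the
  image of some \<open>a\<close>, and by \<open>proj_sandwich\<close> the corner of
  \<open>proj {x}\<close> consists of scalar multiples of it.\<close>

lemma xi_rank_one:
  assumes x: "x \<in> X"
  shows "is_rank_one (\<Phi> (proj {x})) (xi x)"
proof -
  have e: "proj {x} \<in> X.\<A>" using x by (intro X.proj_in_algebra) simp
  have "\<exists>\<xi>. is_rank_one (\<Phi> (proj {x})) \<xi>"
  proof (rule minimal_projection_rank_one)
    show "\<Phi> (proj {x}) \<in> bounded_ops Y" by (rule Y.algebra_bounded[OF Phi_in[OF e]])
    show "\<Phi> (proj {x}) o\<^sub>L \<Phi> (proj {x}) = \<Phi> (proj {x})"
      by (simp add: Phi_compose[OF e e, symmetric] proj_compose)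
    show "adj (\<Phi> (proj {x})) = \<Phi> (proj {x})" by (simp add: Phi_adj[OF e, symmetric] adj_proj)
    show "\<Phi> (proj {x}) \<noteq> 0"
    proof
      assume "\<Phi> (proj {x}) = 0"
      then have "proj {x} = 0" by (rule Phi_eq_zero[OF e])
      then have "coord (blinfun_apply (proj {x}) (delta x)) x = 0" by simp
      then show False by simp
    qed
    fix y assume y: "y \<in> Y"
    define a where "a = \<Psi> (proj {y})"
    have ey: "proj {y} \<in> Y.\<A>" using y by (intro Y.proj_in_algebra) simp
    have a: "a \<in> X.\<A>" "\<Phi> a = proj {y}" unfolding a_def by (rule Psi_in[OF ey], rule Phi_Psi[OF ey])
    have "\<Phi> (proj {x}) o\<^sub>L proj {y} o\<^sub>L \<Phi> (proj {x}) = \<Phi> (proj {x} o\<^sub>L a o\<^sub>L proj {x})"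
      by (simp only: Phi_compose e a X.algebra_compose)
    also have "\<dots> = scaleC_op (coord (blinfun_apply a (delta x)) x) (\<Phi> (proj {x}))"
      by (simp only: proj_sandwich[OF bounded_opsD(1)[OF X.algebra_bounded[OF a(1)]]] Phi_scaleC[OF e])
    finally show "\<exists>c. \<Phi> (proj {x}) o\<^sub>L proj {y} o\<^sub>L \<Phi> (proj {x}) = scaleC_op c (\<Phi> (proj {x}))" by blast
  qed
  then show ?thesis unfolding xi_def range_vector_def by (rule someI_ex)
qed

lemma norm_xi: "x \<in> X \<Longrightarrow> norm (xi x) = 1"
  using xi_rank_one by (simp add: is_rank_one_def)

lemma Phi_proj_singleton: "x \<in> X \<Longrightarrow> blinfun_apply (\<Phi> (proj {x})) f = cinner f (xi x) *\<^sub>C xi x"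
  using xi_rank_one by (simp add: is_rank_one_def)

lemma xi_self: "x \<in> X \<Longrightarrow> blinfun_apply (\<Phi> (proj {x})) (xi x) = xi x"
  by (rule ell2_eqI) (simp add: Phi_proj_singleton cinner_self norm_xi)

lemma Phi_proj_xi:
  assumes "A \<subseteq> X" "x \<in> X"
  shows "blinfun_apply (\<Phi> (proj A)) (xi x) = (if x \<in> A then xi x else 0)"
proof -
  have e: "proj {x} \<in> X.\<A>" "proj A \<in> X.\<A>" using assms by (auto intro: X.proj_in_algebra)
  have "blinfun_apply (\<Phi> (proj A)) (xi x) = blinfun_apply (\<Phi> (proj A) o\<^sub>L \<Phi> (proj {x})) (xi x)"
    by (simp add: xi_self[OF assms(2)])
  also have "\<Phi> (proj A) o\<^sub>L \<Phi> (proj {x}) = \<Phi> (proj (A \<inter> {x}))"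
    by (simp only: Phi_compose[OF e(2,1), symmetric] proj_compose)
  also have "blinfun_apply (\<Phi> (proj (A \<inter> {x}))) (xi x) = (if x \<in> A then xi x else 0)"
  proof (cases "x \<in> A")
    case True
    then have "A \<inter> {x} = {x}" by simp
    then show ?thesis using True xi_self[OF assms(2)] by simp
  next
    case False
    then have "proj (A \<inter> {x}) = 0" by (intro blinfun_eqI ell2_eqI) simp
    then show ?thesis using False by (simp add: Phi_zero)
  qed
  finally show ?thesis .
qed

lemma xi_orthogonal:
  assumes "x \<in> X" "x' \<in> X" "x \<noteq> x'"
  shows "cinner (xi x) (xi x') = 0"
proof -
  have "cinner (xi x) (xi x') *\<^sub>C xi x' = 0 *\<^sub>C xi x'"
    using Phi_proj_xi[of "{x'}" x] Phi_proj_singleton[OF assms(2), of "xi x"] assms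
    by (simp add: ell2_eqI)
  moreover have "xi x' \<noteq> 0" using norm_xi[OF assms(2)] by auto
  ultimately show ?thesis by (rule scaleC_left_cancel[rotated])
qed

lemma xi_outside: "x \<in> X \<Longrightarrow> y \<notin> Y \<Longrightarrow> coord (xi x) y = 0"
  using bounded_opsD(2)[OF Y.algebra_bounded[OF Phi_in[OF X.proj_in_algebra]], of "{x}" y "xi x"] xi_self[of x] by simp

definition eta :: "'b \<Rightarrow> 'a ell2" where "eta y = range_vector (\<Psi> (proj {y}))"

lemma eta_eq: "roe_iso.xi \<Psi> = eta"
  by (rule ext) (simp add: eta_def roe_iso.xi_def[OF inverse])

lemma norm_eta: "y \<in> Y \<Longrightarrow> norm (eta y) = 1"
  and eta_outside: "y \<in> Y \<Longrightarrow> x \<notin> X \<Longrightarrow> coord (eta y) x = 0"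
  and Psi_proj_singleton: "y \<in> Y \<Longrightarrow> blinfun_apply (\<Psi> (proj {y})) f = cinner f (eta y) *\<^sub>C eta y"
  and eta_self: "y \<in> Y \<Longrightarrow> blinfun_apply (\<Psi> (proj {y})) (eta y) = eta y"
  using roe_iso.norm_xi[OF inverse] roe_iso.xi_outside[OF inverse] roe_iso.Phi_proj_singleton[OF inverse]
    roe_iso.xi_self[OF inverse] by (simp_all only: eta_eq)

text \<open>Compression to the corner of \<open>proj {y}\<close> gives a scalar. In the target it is
  the diagonal coefficient of \<open>\<Phi> a\<close>; transported by the inverse it is the vector
  state of \<open>eta y\<close> at \<open>a\<close>.\<close>

lemma diagonal_coefficient:
  assumes a: "a \<in> X.\<A>" and y: "y \<in> Y"
  shows "coord (blinfun_apply (\<Phi> a) (delta y)) y = cinner (blinfun_apply a (eta y)) (eta y)"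
proof -
  interpret inv: roe_iso Y \<F> X \<E> \<Psi> by (rule inverse)
  have ey: "proj {y} \<in> Y.\<A>" using y by (intro Y.proj_in_algebra) simp
  let ?t = "coord (blinfun_apply (\<Phi> a) (delta y)) y"
  have "\<Psi> (proj {y}) o\<^sub>L a o\<^sub>L \<Psi> (proj {y}) = \<Psi> (proj {y} o\<^sub>L \<Phi> a o\<^sub>L proj {y})"
    by (simp only: inv.Phi_compose ey Phi_in[OF a] Y.algebra_compose Psi_Phi[OF a])
  also have "\<dots> = scaleC_op ?t (\<Psi> (proj {y}))"
    by (simp only: proj_sandwich[OF Phi_clinear[OF a]] inv.Phi_scaleC[OF ey])
  finally have "blinfun_apply (\<Psi> (proj {y}) o\<^sub>L a o\<^sub>L \<Psi> (proj {y})) (eta y) = blinfun_apply (scaleC_op ?t (\<Psi> (proj {y}))) (eta y)"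
    by simp
  then have "cinner (blinfun_apply a (eta y)) (eta y) *\<^sub>C eta y = ?t *\<^sub>C eta y"
    by (simp add: eta_self[OF y] scaleC_op_apply Psi_proj_singleton[OF y, of "blinfun_apply a (eta y)"])
  moreover have "eta y \<noteq> 0" using norm_eta[OF y] by auto
  ultimately show ?thesis by (intro scaleC_left_cancel[of "eta y", symmetric])
qed

text \<open>By \<open>norm_Phi_proj_delta\<close> this is the squared norm of column y of
  \<open>\<Phi> (proj A)\<close>. Expressed through \<open>eta y\<close> it is an infinite sum over
  \<open>A\<close>, whereas additivity of \<Phi> by itself reaches only finite unions.\<close>

definition mass :: "'a set \<Rightarrow> 'b \<Rightarrow> real" where
  "mass A y = (norm (blinfun_apply (proj A) (eta y)))\<^sup>2"

lemma norm_Phi_proj_delta: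
  assumes A: "A \<subseteq> X" and y: "y \<in> Y"
  shows "(norm (blinfun_apply (\<Phi> (proj A)) (delta y)))\<^sup>2 = mass A y"
proof -
  have e: "proj A \<in> X.\<A>" by (rule X.proj_in_algebra[OF A])
  let ?p = "\<Phi> (proj A)"
  have idem: "?p o\<^sub>L ?p = ?p" by (simp only: Phi_compose[OF e e, symmetric] proj_compose Int_absorb)
  have sa: "adj ?p = ?p" by (simp only: Phi_adj[OF e, symmetric] adj_proj)
  have "complex_of_real ((norm (blinfun_apply ?p (delta y)))\<^sup>2) = cinner (blinfun_apply ?p (delta y)) (blinfun_apply ?p (delta y))"
    by (simp only: cinner_self)
  also have "\<dots> = cinner (blinfun_apply ?p (blinfun_apply ?p (delta y))) (delta y)"
    using adj_cinner[OF Phi_clinear[OF e], of "blinfun_apply ?p (delta y)" "delta y"] by (simp only: sa)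
  also have "blinfun_apply ?p (blinfun_apply ?p (delta y)) = blinfun_apply ?p (delta y)"
    using idem by (metis blinfun_apply_blinfun_compose)
  also have "cinner (blinfun_apply ?p (delta y)) (delta y) = cinner (blinfun_apply (proj A) (eta y)) (eta y)"
    by (simp only: cinner_delta_right diagonal_coefficient[OF e y])
  also have "\<dots> = cinner (blinfun_apply (proj A) (eta y)) (blinfun_apply (proj A) (eta y))"
    unfolding cinner_def by (rule infsum_cong) simp
  also have "\<dots> = complex_of_real (mass A y)" by (simp only: cinner_self mass_def)
  finally show ?thesis by (simp only: of_real_eq_iff)
qed

text \<open>Both squares are the mass of \<open>{x}\<close> at y. This symmetry lets the estimates
  for \<Phi> and for its inverse refer to one and the same matrix of moduli.\<close>

lemma cmod_xi_eta:
  assumes "x \<in> X" "y \<in> Y"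
  shows "cmod (coord (eta y) x) = cmod (coord (xi x) y)"
proof -
  have "(cmod (coord (xi x) y))\<^sup>2 = (norm (blinfun_apply (\<Phi> (proj {x})) (delta y)))\<^sup>2"
    using assms by (simp add: Phi_proj_singleton norm_scaleC norm_xi cinner_delta_left)
  also have "\<dots> = mass {x} y" using assms by (intro norm_Phi_proj_delta) auto
  also have "\<dots> = (cmod (coord (eta y) x))\<^sup>2" by (simp add: mass_def proj_singleton norm_scaleC)
  finally show ?thesis by (simp add: power2_eq_iff_nonneg)
qed

end

section \<open>The uniform lower bound\<close>

text \<open>Random signs are indexed by subsets, so expectations become sums over
  \<open>Pow A\<close> divided by their number.\<close>

definition flip :: "'i set \<Rightarrow> 'i \<Rightarrow> complex" where
  "flip B x = (if x \<in> B then 1 else -1)"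

text \<open>With s the sum of the squared moduli and u the real part of \<open>a * cnj b\<close>,
  the left side equals 2 s^2 + 8 u^2, and u is at most the product of the moduli.\<close>

lemma fourth_power_flip:
  "cmod (a + b) ^ 4 + cmod (a - b) ^ 4 \<le> 2 * (cmod a ^ 4 + 6 * (cmod a)\<^sup>2 * (cmod b)\<^sup>2 + cmod b ^ 4)"
proof -
  define u where "u = Re a * Re b + Im a * Im b"
  define s where "s = (cmod a)\<^sup>2 + (cmod b)\<^sup>2"
  have p: "(cmod (a + b))\<^sup>2 = s + 2 * u" "(cmod (a - b))\<^sup>2 = s - 2 * u"
    unfolding s_def u_def cmod_power2 by (simp_all add: power2_eq_square algebra_simps)
  have "\<bar>u\<bar> \<le> cmod a * cmod b"
  proof -
    have "u = Re (a * cnj b)" by (simp add: u_def)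
    then show ?thesis using abs_Re_le_cmod[of "a * cnj b"] by (simp add: norm_mult)
  qed
  then have "u\<^sup>2 \<le> (cmod a * cmod b)\<^sup>2" by (rule abs_le_square_iff[THEN iffD1, OF order_trans]) simp
  then have u: "u\<^sup>2 \<le> (cmod a)\<^sup>2 * (cmod b)\<^sup>2" by (simp add: power_mult_distrib)
  have f: "c ^ 4 = (c\<^sup>2)\<^sup>2" for c :: real by simp
  have "cmod (a + b) ^ 4 + cmod (a - b) ^ 4 = (s + 2 * u)\<^sup>2 + (s - 2 * u)\<^sup>2" unfolding f p ..
  also have "\<dots> = 2 * s\<^sup>2 + 8 * u\<^sup>2" by (simp add: power2_eq_square algebra_simps)
  also have "\<dots> \<le> 2 * s\<^sup>2 + 8 * ((cmod a)\<^sup>2 * (cmod b)\<^sup>2)" using u by simp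
  also have "\<dots> = 2 * (cmod a ^ 4 + 6 * (cmod a)\<^sup>2 * (cmod b)\<^sup>2 + cmod b ^ 4)"
    unfolding f s_def by (simp add: power2_eq_square algebra_simps)
  finally show ?thesis .
qed

lemma sum_flip_insert:
  fixes h :: "complex \<Rightarrow> real" and c :: "'i \<Rightarrow> complex"
  assumes "finite A" "k \<notin> A"
  shows "(\<Sum>B\<in>Pow (insert k A). h (\<Sum>x\<in>insert k A. flip B x * c x))
      = (\<Sum>B\<in>Pow A. h ((\<Sum>x\<in>A. flip B x * c x) + c k) + h ((\<Sum>x\<in>A. flip B x * c x) - c k))"
proof -
  have inj: "inj_on (insert k) (Pow A)" using assms(2) by (auto simp: inj_on_def)
  have 1: "(\<Sum>x\<in>insert k A. flip B x * c x) = (\<Sum>x\<in>A. flip B x * c x) - c k" if "B \<in> Pow A" for B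
    using assms that by (auto simp: flip_def)
  have 2: "(\<Sum>x\<in>insert k A. flip (insert k B) x * c x) = (\<Sum>x\<in>A. flip B x * c x) + c k" if "B \<in> Pow A" for B
  proof -
    have "(\<Sum>x\<in>A. flip (insert k B) x * c x) = (\<Sum>x\<in>A. flip B x * c x)"
      using assms(2) by (intro sum.cong) (auto simp: flip_def)
    then show ?thesis using assms by (simp add: flip_def)
  qed
  have "(\<Sum>B\<in>Pow (insert k A). h (\<Sum>x\<in>insert k A. flip B x * c x))
      = (\<Sum>B\<in>Pow A. h (\<Sum>x\<in>insert k A. flip B x * c x))
        + (\<Sum>B\<in>insert k ` Pow A. h (\<Sum>x\<in>insert k A. flip B x * c x))"
    unfolding Pow_insert using assms by (intro sum.union_disjoint) auto
  also have "(\<Sum>B\<in>insert k ` Pow A. h (\<Sum>x\<in>insert k A. flip B x * c x))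
      = (\<Sum>B\<in>Pow A. h (\<Sum>x\<in>insert k A. flip (insert k B) x * c x))"
    by (simp only: sum.reindex[OF inj] o_def)
  finally show ?thesis by (simp only: 1 2 sum.distrib cong: sum.cong)
qed

lemma sum_flip_second_moment:
  fixes c :: "'i \<Rightarrow> complex"
  assumes "finite A"
  shows "(\<Sum>B\<in>Pow A. (cmod (\<Sum>x\<in>A. flip B x * c x))\<^sup>2) = 2 ^ card A * (\<Sum>x\<in>A. (cmod (c x))\<^sup>2)"
  using assms
proof (induction A rule: finite_induct)
  case (insert k A)
  have par: "(cmod (a + b))\<^sup>2 + (cmod (a - b))\<^sup>2 = 2 * (cmod a)\<^sup>2 + 2 * (cmod b)\<^sup>2" for a b :: complex
    unfolding cmod_power2 by (simp add: power2_eq_square algebra_simps)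
  have "(\<Sum>B\<in>Pow (insert k A). (cmod (\<Sum>x\<in>insert k A. flip B x * c x))\<^sup>2)
      = (\<Sum>B\<in>Pow A. 2 * (cmod (\<Sum>x\<in>A. flip B x * c x))\<^sup>2 + 2 * (cmod (c k))\<^sup>2)"
    unfolding sum_flip_insert[OF insert.hyps, of "\<lambda>z. (cmod z)\<^sup>2" c] par ..
  also have "\<dots> = 2 * (2 ^ card A * (\<Sum>x\<in>A. (cmod (c x))\<^sup>2)) + 2 ^ card A * (2 * (cmod (c k))\<^sup>2)"
    using insert.hyps by (simp add: sum.distrib sum_distrib_left[symmetric] insert.IH card_Pow)
  finally show ?case using insert.hyps by (simp add: algebra_simps)
qed simp

text \<open>Khintchine's inequality for exponent 4. The constant 3 closes the induction because the
  new term 6 b s is precisely the cross term of 3 (b + s)^2.\<close>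

lemma sum_flip_fourth_moment:
  fixes c :: "'i \<Rightarrow> complex"
  assumes "finite A"
  shows "(\<Sum>B\<in>Pow A. cmod (\<Sum>x\<in>A. flip B x * c x) ^ 4) \<le> 2 ^ card A * (3 * (\<Sum>x\<in>A. (cmod (c x))\<^sup>2)\<^sup>2)"
  using assms
proof (induction A rule: finite_induct)
  case (insert k A)
  let ?S = "\<lambda>B. \<Sum>x\<in>A. flip B x * c x"
  define s where "s = (\<Sum>x\<in>A. (cmod (c x))\<^sup>2)"
  define b where "b = (cmod (c k))\<^sup>2"
  have b4: "cmod (c k) ^ 4 = b\<^sup>2" by (simp add: b_def)
  have "(\<Sum>B\<in>Pow (insert k A). cmod (\<Sum>x\<in>insert k A. flip B x * c x) ^ 4)
      = (\<Sum>B\<in>Pow A. cmod (?S B + c k) ^ 4 + cmod (?S B - c k) ^ 4)"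
    by (rule sum_flip_insert[OF insert.hyps, of "\<lambda>z. cmod z ^ 4" c])
  also have "\<dots> \<le> (\<Sum>B\<in>Pow A. 2 * (cmod (?S B) ^ 4 + 6 * (cmod (?S B))\<^sup>2 * (cmod (c k))\<^sup>2 + cmod (c k) ^ 4))"
    by (intro sum_mono fourth_power_flip)
  also have "\<dots> = 2 * ((\<Sum>B\<in>Pow A. cmod (?S B) ^ 4) + 6 * b * (\<Sum>B\<in>Pow A. (cmod (?S B))\<^sup>2) + 2 ^ card A * b\<^sup>2)"
    using insert.hyps by (simp add: sum.distrib sum_distrib_left[symmetric] sum_distrib_right[symmetric] card_Pow b4 b_def[symmetric])
  also have "(\<Sum>B\<in>Pow A. (cmod (?S B))\<^sup>2) = 2 ^ card A * s"
    unfolding s_def by (rule sum_flip_second_moment[OF insert.hyps(1)])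
  also have "2 * ((\<Sum>B\<in>Pow A. cmod (?S B) ^ 4) + 6 * b * (2 ^ card A * s) + 2 ^ card A * b\<^sup>2)
      \<le> 2 * (2 ^ card A * (3 * s\<^sup>2) + 6 * b * (2 ^ card A * s) + 2 ^ card A * b\<^sup>2)"
    using insert.IH by (simp add: s_def)
  also have "\<dots> \<le> 2 * (2 ^ card A * (3 * s\<^sup>2) + 6 * b * (2 ^ card A * s) + 2 ^ card A * (3 * b\<^sup>2))"
    by simp
  also have "\<dots> = 2 ^ card (insert k A) * (3 * (b + s)\<^sup>2)"
    using insert.hyps by (simp add: power2_eq_square algebra_simps)
  also have "b + s = (\<Sum>x\<in>insert k A. (cmod (c x))\<^sup>2)" using insert.hyps by (simp add: b_def s_def)
  finally show ?case .
qed simp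

text \<open>If every sign pattern had a bad coordinate, choosing one for each pattern gives a finite
  set \<open>V\<close> on which the fourth moments sum to more than allowed; the index type itself
  may be infinite. Second moments would not do in the application, as their sum over all coordinates
  is not small.\<close>

lemma exists_flat_signs:
  fixes c :: "'i \<Rightarrow> 'j \<Rightarrow> complex"
  assumes A: "finite A"
    and K: "\<And>V. finite V \<Longrightarrow> 3 * (\<Sum>y\<in>V. (\<Sum>x\<in>A. (cmod (c x y))\<^sup>2)\<^sup>2) \<le> K"
  shows "\<exists>B\<subseteq>A. \<forall>y. cmod (\<Sum>x\<in>A. flip B x * c x y) ^ 4 \<le> K"
proof (rule ccontr)
  assume "\<not> ?thesis"
  then have "\<forall>B\<in>Pow A. \<exists>y. cmod (\<Sum>x\<in>A. flip B x * c x y) ^ 4 > K" by (auto simp: not_le)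
  then obtain f where f: "\<And>B. B \<in> Pow A \<Longrightarrow> cmod (\<Sum>x\<in>A. flip B x * c x (f B)) ^ 4 > K"
    using bchoice[of "Pow A" "\<lambda>B y. cmod (\<Sum>x\<in>A. flip B x * c x y) ^ 4 > K"] by blast
  define V where "V = f ` Pow A"
  have V: "finite V" using A by (simp add: V_def)
  have "2 ^ card A * K = (\<Sum>B\<in>Pow A. K)" using A by (simp add: card_Pow)
  also have "\<dots> < (\<Sum>B\<in>Pow A. cmod (\<Sum>x\<in>A. flip B x * c x (f B)) ^ 4)"
    using A f by (intro sum_strict_mono) auto
  also have "\<dots> \<le> (\<Sum>B\<in>Pow A. \<Sum>y\<in>V. cmod (\<Sum>x\<in>A. flip B x * c x y) ^ 4)"
  proof (rule sum_mono)
    fix B assume "B \<in> Pow A"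
    then have "f B \<in> V" by (simp add: V_def)
    then show "cmod (\<Sum>x\<in>A. flip B x * c x (f B)) ^ 4 \<le> (\<Sum>y\<in>V. cmod (\<Sum>x\<in>A. flip B x * c x y) ^ 4)"
      using V by (intro member_le_sum[where f = "\<lambda>y. cmod (\<Sum>x\<in>A. flip B x * c x y) ^ 4"]) auto
  qed
  also have "\<dots> = (\<Sum>y\<in>V. \<Sum>B\<in>Pow A. cmod (\<Sum>x\<in>A. flip B x * c x y) ^ 4)" by (rule sum.swap)
  also have "\<dots> \<le> (\<Sum>y\<in>V. 2 ^ card A * (3 * (\<Sum>x\<in>A. (cmod (c x y))\<^sup>2)\<^sup>2))"
    by (intro sum_mono sum_flip_fourth_moment A)
  also have "\<dots> = 2 ^ card A * (3 * (\<Sum>y\<in>V. (\<Sum>x\<in>A. (cmod (c x y))\<^sup>2)\<^sup>2))"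
    by (simp add: sum_distrib_left)
  also have "\<dots> \<le> 2 ^ card A * K" by (intro mult_left_mono K V) simp
  finally show False by simp
qed

lemma sum_coord_square_le: "finite F \<Longrightarrow> (\<Sum>x\<in>F. (cmod (coord f x))\<^sup>2) \<le> (norm f)\<^sup>2"
  unfolding norm_square_ell2 by (rule finite_sum_le_infsum[OF coord_summable]) auto

lemma norm_proj_le: "norm (blinfun_apply (proj A) f) \<le> norm f"
proof (rule power2_le_imp_le)
  show "(norm (blinfun_apply (proj A) f))\<^sup>2 \<le> (norm f)\<^sup>2"
    unfolding norm_square_ell2 by (intro infsum_mono coord_summable) auto
qed simp

lemma norm_proj_finite: "finite F \<Longrightarrow> (norm (blinfun_apply (proj F) f))\<^sup>2 = (\<Sum>x\<in>F. (cmod (coord f x))\<^sup>2)"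
proof -
  assume F: "finite F"
  have "(norm (blinfun_apply (proj F) f))\<^sup>2 = infsum (\<lambda>x. (cmod (coord f x))\<^sup>2) F"
    unfolding norm_square_ell2 by (rule infsum_cong_neutral) auto
  then show ?thesis using F by simp
qed

context roe_iso
begin

lemma mass_infsum: "mass A y = infsum (\<lambda>x. (cmod (coord (eta y) x))\<^sup>2) A"
  unfolding mass_def norm_square_ell2 by (rule infsum_cong_neutral) auto

lemma mass_finite:
  assumes "finite F" "F \<subseteq> X" "y \<in> Y"
  shows "mass F y = (\<Sum>x\<in>F. (cmod (coord (xi x) y))\<^sup>2)"
  unfolding mass_def norm_proj_finite[OF assms(1)] using assms by (intro sum.cong) (auto simp: cmod_xi_eta)

lemma eta_summable: "(\<lambda>x. (cmod (coord (eta y) x))\<^sup>2) summable_on A"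
  by (rule summable_on_subset_banach[OF coord_summable]) simp

lemma mass_nonneg: "mass A y \<ge> 0"
  by (simp add: mass_def)

lemma mass_mono: "A \<subseteq> B \<Longrightarrow> mass A y \<le> mass B y"
  unfolding mass_infsum by (intro infsum_mono_neutral eta_summable) auto

lemma mass_union: "A \<inter> B = {} \<Longrightarrow> mass (A \<union> B) y = mass A y + mass B y"
  unfolding mass_infsum by (intro infsum_Un_disjoint eta_summable)

lemma mass_total:
  assumes "y \<in> Y"
  shows "mass X y = 1"
proof -
  have "blinfun_apply (proj X) (eta y) = eta y" by (rule ell2_eqI) (use eta_outside[OF assms] in auto)
  then show ?thesis using norm_eta[OF assms] by (simp add: mass_def)
qed

lemma mass_le_one: "y \<in> Y \<Longrightarrow> A \<subseteq> X \<Longrightarrow> mass A y \<le> 1"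
  using mass_mono[of A X y] mass_total by simp

lemma mass_le:
  assumes "y \<in> Y" "A \<subseteq> X" and F: "\<And>F. finite F \<Longrightarrow> F \<subseteq> A \<Longrightarrow> (\<Sum>x\<in>F. (cmod (coord (xi x) y))\<^sup>2) \<le> c"
  shows "mass A y \<le> c"
  unfolding mass_infsum
proof (rule infsum_le_finite_sums[OF eta_summable])
  fix F assume F': "finite F" "F \<subseteq> A"
  have "(\<Sum>x\<in>F. (cmod (coord (eta y) x))\<^sup>2) = (\<Sum>x\<in>F. (cmod (coord (xi x) y))\<^sup>2)"
    using F' assms by (intro sum.cong) (auto simp: cmod_xi_eta)
  with F[OF F'] show "(\<Sum>x\<in>F. (cmod (coord (eta y) x))\<^sup>2) \<le> c" by simp
qed

lemma Phi_proj_union: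
  assumes "A \<subseteq> X" "B \<subseteq> X" "A \<inter> B = {}"
  shows "blinfun_apply (\<Phi> (proj (A \<union> B))) f = blinfun_apply (\<Phi> (proj A)) f + blinfun_apply (\<Phi> (proj B)) f"
proof -
  have "proj (A \<union> B) = proj A + proj B"
    using assms(3) by (intro blinfun_eqI ell2_eqI) (auto simp: blinfun.add_left)
  then show ?thesis using assms by (simp add: Phi_add X.proj_in_algebra blinfun.add_left)
qed

lemma Phi_proj_empty: "blinfun_apply (\<Phi> (proj {})) f = 0"
proof -
  have "proj {} = (0 :: 'a ell2 \<Rightarrow>\<^sub>L 'a ell2)" by (rule blinfun_eqI, rule ell2_eqI) simp
  then show ?thesis by (simp add: Phi_zero)
qed

lemma Phi_proj_finite:
  assumes "finite F" "F \<subseteq> X"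
  shows "blinfun_apply (\<Phi> (proj F)) f = (\<Sum>x\<in>F. cinner f (xi x) *\<^sub>C xi x)"
  using assms
proof (induction F rule: finite_induct)
  case (insert x F)
  then show ?case
    using Phi_proj_union[of "{x}" F f] by (simp add: Phi_proj_singleton)
qed (simp add: Phi_proj_empty)

text \<open>\<open>proj X\<close> and \<open>proj Y\<close> are the units of the two algebras, and a
  surjective homomorphism preserves the unit.\<close>

lemma Phi_proj_total: "\<Phi> (proj X) = proj Y"
proof -
  have e: "proj X \<in> X.\<A>" "proj Y \<in> Y.\<A>" by (rule X.proj_in_algebra, simp, rule Y.proj_in_algebra, simp)
  have "\<Phi> (proj X) = \<Phi> (proj X) o\<^sub>L proj Y"
    by (rule proj_bounded_ops_right[OF Y.algebra_bounded[OF Phi_in[OF e(1)]], symmetric])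
  also have "\<dots> = \<Phi> (proj X) o\<^sub>L \<Phi> (\<Psi> (proj Y))" by (simp only: Phi_Psi[OF e(2)])
  also have "\<dots> = \<Phi> (proj X o\<^sub>L \<Psi> (proj Y))" by (simp only: Phi_compose[OF e(1) Psi_in[OF e(2)]])
  also have "\<dots> = proj Y" by (simp only: proj_bounded_ops_left[OF X.algebra_bounded[OF Psi_in[OF e(2)]]] Phi_Psi[OF e(2)])
  finally show ?thesis .
qed

lemma Phi_proj_delta_defect:
  assumes C: "C \<subseteq> X" "x \<in> C" and y: "y \<in> Y"
  shows "(norm (blinfun_apply (\<Phi> (proj C)) (delta y) - cnj (coord (xi x) y) *\<^sub>C xi x))\<^sup>2 = mass (C - {x}) y"
proof -
  have "C = {x} \<union> (C - {x})" using C by auto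
  then have "blinfun_apply (\<Phi> (proj C)) (delta y) = cnj (coord (xi x) y) *\<^sub>C xi x + blinfun_apply (\<Phi> (proj (C - {x}))) (delta y)"
    using Phi_proj_union[of "{x}" "C - {x}" "delta y"] C by (auto simp: Phi_proj_singleton cinner_delta_left)
  then show ?thesis using C by (simp add: norm_Phi_proj_delta[OF _ y] subset_iff)
qed

lemma Phi_proj_flip:
  assumes A: "finite A" "A \<subseteq> X" and B: "B \<subseteq> A"
  shows "coord (blinfun_apply (\<Phi> (proj B)) (delta y) - blinfun_apply (\<Phi> (proj (A - B))) (delta y)) y'
    = (\<Sum>x\<in>A. flip B x * (cnj (coord (xi x) y) * coord (xi x) y'))"
proof -
  have fin: "finite B" "finite (A - B)" using A B finite_subset by auto
  have "(\<Sum>x\<in>A. flip B x * (cnj (coord (xi x) y) * coord (xi x) y'))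
      = (\<Sum>x\<in>B. flip B x * (cnj (coord (xi x) y) * coord (xi x) y'))
        + (\<Sum>x\<in>A - B. flip B x * (cnj (coord (xi x) y) * coord (xi x) y'))"
    using sum.subset_diff[OF B A(1)] by (simp add: add.commute)
  also have "(\<Sum>x\<in>B. flip B x * (cnj (coord (xi x) y) * coord (xi x) y')) = coord (blinfun_apply (\<Phi> (proj B)) (delta y)) y'"
    using A B fin by (subst Phi_proj_finite) (auto simp: coord_sum flip_def cinner_delta_left intro!: sum.cong)
  also have "(\<Sum>x\<in>A - B. flip B x * (cnj (coord (xi x) y) * coord (xi x) y'))
      = - coord (blinfun_apply (\<Phi> (proj (A - B))) (delta y)) y'"
    using A B fin by (subst Phi_proj_finite) (auto simp: coord_sum flip_def cinner_delta_left sum_negf[symmetric] intro!: sum.cong)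
  finally show ?thesis by simp
qed

text \<open>Coordinate y' of the signed column is a sum over x in A of signs times the coefficients
  \<open>cnj (coord (xi x) y) * coord (xi x) y'\<close>. Their squared moduli add up to at most d^2
  for each y' (\<open>col\<close>) and to at most 1 over all y' (\<open>tot\<close>), so the squares
  of the partial sums add up to at most d^2, as the fourth moment needs. The set \<open>A\<close>
  arises by discarding a tail and the forbidden set \<open>U\<close>, which has little mass by
  flatness.\<close>

lemma flat_stage:
  assumes flat: "\<And>d. d > 0 \<Longrightarrow> \<exists>y\<in>Y. \<forall>x\<in>X. cmod (coord (xi x) y) < d"
    and U: "finite U" "U \<subseteq> X" and e: "e > 0"
  shows "\<exists>y A B. y \<in> Y \<and> finite A \<and> A \<subseteq> X - U \<and> B \<subseteq> A \<and> mass (X - A) y \<le> 1/100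
    \<and> (\<forall>y'. cmod (coord (blinfun_apply (\<Phi> (proj B)) (delta y) - blinfun_apply (\<Phi> (proj (A - B))) (delta y)) y') \<le> e)"
proof -
  \<comment> \<open>The first bound yields 3 d^2 \<le> e^4 for the fourth powers, the second keeps
    the mass of \<open>U\<close> below 1/200.\<close>
  define d where "d = min (e\<^sup>2 / 2) (1 / (20 * (1 + real (card U))))"
  have d0: "d > 0" using e by (simp add: d_def)
  have d1: "d \<le> e\<^sup>2 / 2" "d \<le> 1 / (20 * (1 + real (card U)))" by (simp_all add: d_def)
  obtain y where y: "y \<in> Y" "\<And>x. x \<in> X \<Longrightarrow> cmod (coord (xi x) y) < d" using flat[OF d0] by blast
  have sq: "(cmod (coord (xi x) y))\<^sup>2 \<le> d\<^sup>2" if "x \<in> X" for x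
    using y(2)[OF that] by (intro power_mono) auto
  have massU: "mass U y \<le> 1/200"
  proof -
    have "mass U y = (\<Sum>x\<in>U. (cmod (coord (xi x) y))\<^sup>2)" by (rule mass_finite[OF U y(1)])
    also have "\<dots> \<le> real (card U) * d\<^sup>2" using sum_bounded_above[of U "\<lambda>x. (cmod (coord (xi x) y))\<^sup>2" "d\<^sup>2"] sq U by auto
    also have "\<dots> \<le> (1 + real (card U))\<^sup>2 * d\<^sup>2"
      by (intro mult_right_mono) (auto simp: power2_eq_square algebra_simps)
    also have "\<dots> = ((1 + real (card U)) * d)\<^sup>2" by (simp add: power_mult_distrib)
    also have "\<dots> \<le> (1/20)\<^sup>2"
    proof (rule power_mono)
      have "(1 + real (card U)) * d \<le> (1 + real (card U)) * (1 / (20 * (1 + real (card U))))"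
        using d1 by (intro mult_left_mono) auto
      also have "\<dots> = 1/20" by simp
      finally show "(1 + real (card U)) * d \<le> 1/20" .
    qed (use d0 in simp)
    finally show ?thesis by (simp add: power2_eq_square)
  qed
  have "\<exists>F. finite F \<and> F \<subseteq> X \<and> mass (X - F) y \<le> 1/200"
  proof -
    let ?f = "\<lambda>x. (cmod (coord (eta y) x))\<^sup>2"
    have "(?f has_sum mass X y) X" unfolding mass_infsum by (rule has_sum_infsum[OF eta_summable])
    then have "\<forall>\<^sub>F F in finite_subsets_at_top X. dist (sum ?f F) (mass X y) < 1/200"
      unfolding has_sum_def by (rule tendstoD) simp
    then obtain F where F: "finite F" "F \<subseteq> X" "dist (sum ?f F) (mass X y) < 1/200"
      unfolding eventually_finite_subsets_at_top by blast
    have "mass F y = sum ?f F" unfolding mass_infsum using F by simp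
    moreover have "mass X y = mass F y + mass (X - F) y"
      using mass_union[of F "X - F" y] F by (simp add: Un_absorb1)
    ultimately have "mass (X - F) y \<le> 1/200" using F(3) by (simp add: dist_real_def)
    with F show ?thesis by blast
  qed
  then obtain F where F: "finite F" "F \<subseteq> X" "mass (X - F) y \<le> 1/200" by blast
  define A where "A = F - U"
  have A: "finite A" "A \<subseteq> X - U" using F by (auto simp: A_def)
  have "mass (X - A) y \<le> mass (U \<union> (X - F - U)) y" by (rule mass_mono) (auto simp: A_def)
  also have "\<dots> = mass U y + mass (X - F - U) y" by (rule mass_union) auto
  also have "\<dots> \<le> 1/200 + mass (X - F) y" using massU by (intro add_mono mass_mono) auto
  finally have mA: "mass (X - A) y \<le> 1/100" using F(3) by simp
  have col: "(\<Sum>x\<in>A. (cmod (cnj (coord (xi x) y) * coord (xi x) y'))\<^sup>2) \<le> d\<^sup>2" for y'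
  proof (cases "y' \<in> Y")
    case True
    have "(\<Sum>x\<in>A. (cmod (cnj (coord (xi x) y) * coord (xi x) y'))\<^sup>2) \<le> (\<Sum>x\<in>A. d\<^sup>2 * (cmod (coord (xi x) y'))\<^sup>2)"
    proof (rule sum_mono)
      fix x assume "x \<in> A"
      then have "x \<in> X" using A by blast
      then show "(cmod (cnj (coord (xi x) y) * coord (xi x) y'))\<^sup>2 \<le> d\<^sup>2 * (cmod (coord (xi x) y'))\<^sup>2"
        unfolding norm_mult power_mult_distrib complex_mod_cnj by (intro mult_right_mono sq) simp_all
    qed
    also have "\<dots> = d\<^sup>2 * mass A y'"
      using A True by (subst mass_finite) (auto simp: sum_distrib_left)
    also have "\<dots> \<le> d\<^sup>2 * 1" using A True by (intro mult_left_mono mass_le_one) auto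
    finally show ?thesis by simp
  next
    case False
    then have "coord (xi x) y' = 0" if "x \<in> A" for x using that A xi_outside by blast
    then show ?thesis by simp
  qed
  have tot: "(\<Sum>y'\<in>V. \<Sum>x\<in>A. (cmod (cnj (coord (xi x) y) * coord (xi x) y'))\<^sup>2) \<le> 1" if V: "finite V" for V
  proof -
    have "(\<Sum>y'\<in>V. \<Sum>x\<in>A. (cmod (cnj (coord (xi x) y) * coord (xi x) y'))\<^sup>2)
        = (\<Sum>x\<in>A. \<Sum>y'\<in>V. (cmod (cnj (coord (xi x) y) * coord (xi x) y'))\<^sup>2)" by (rule sum.swap)
    also have "\<dots> = (\<Sum>x\<in>A. (cmod (coord (xi x) y))\<^sup>2 * (\<Sum>y'\<in>V. (cmod (coord (xi x) y'))\<^sup>2))"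
      by (simp add: norm_mult power_mult_distrib sum_distrib_left)
    also have "\<dots> \<le> (\<Sum>x\<in>A. (cmod (coord (xi x) y))\<^sup>2 * 1)"
    proof (intro sum_mono mult_left_mono)
      fix x assume "x \<in> A"
      then have "norm (xi x) = 1" using A norm_xi by blast
      then show "(\<Sum>y'\<in>V. (cmod (coord (xi x) y'))\<^sup>2) \<le> 1" using sum_coord_square_le[OF V, of "xi x"] by simp
    qed simp
    also have "\<dots> = mass A y" using A y(1) by (subst mass_finite) auto
    also have "\<dots> \<le> 1" using A y(1) by (intro mass_le_one) auto
    finally show ?thesis .
  qed
  have "\<exists>B\<subseteq>A. \<forall>y'. cmod (\<Sum>x\<in>A. flip B x * (cnj (coord (xi x) y) * coord (xi x) y')) ^ 4 \<le> 3 * d\<^sup>2"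
  proof (rule exists_flat_signs[OF A(1)])
    fix V :: "'b set" assume V: "finite V"
    let ?s = "\<lambda>y'. \<Sum>x\<in>A. (cmod (cnj (coord (xi x) y) * coord (xi x) y'))\<^sup>2"
    have "(\<Sum>y'\<in>V. (?s y')\<^sup>2) \<le> (\<Sum>y'\<in>V. d\<^sup>2 * ?s y')"
      unfolding power2_eq_square[of "?s _"] by (intro sum_mono mult_right_mono col sum_nonneg) simp
    also have "\<dots> = d\<^sup>2 * (\<Sum>y'\<in>V. ?s y')" by (simp add: sum_distrib_left)
    also have "\<dots> \<le> d\<^sup>2 * 1" by (intro mult_left_mono tot V) simp
    finally show "3 * (\<Sum>y'\<in>V. (?s y')\<^sup>2) \<le> 3 * d\<^sup>2" by simp
  qed
  then obtain B where B: "B \<subseteq> A" "\<And>y'. cmod (\<Sum>x\<in>A. flip B x * (cnj (coord (xi x) y) * coord (xi x) y')) ^ 4 \<le> 3 * d\<^sup>2"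
    by blast
  have "cmod (coord (blinfun_apply (\<Phi> (proj B)) (delta y) - blinfun_apply (\<Phi> (proj (A - B))) (delta y)) y') \<le> e" for y'
  proof (rule power_le_imp_le_base[where n = 3])
    have "cmod (coord (blinfun_apply (\<Phi> (proj B)) (delta y) - blinfun_apply (\<Phi> (proj (A - B))) (delta y)) y') ^ 4 \<le> 3 * d\<^sup>2"
      using B A by (subst Phi_proj_flip) auto
    also have "\<dots> \<le> 4 * d\<^sup>2" by simp
    also have "\<dots> \<le> 4 * (e\<^sup>2 / 2)\<^sup>2" using d0 d1 by (intro mult_left_mono power_mono) auto
    also have "\<dots> = e ^ 4" by (simp add: power2_eq_square power4_eq_xxxx)
    finally show "cmod (coord (blinfun_apply (\<Phi> (proj B)) (delta y) - blinfun_apply (\<Phi> (proj (A - B))) (delta y)) y') ^ Suc 3 \<le> e ^ Suc 3"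
      by simp
  qed (use e in simp)
  then show ?thesis using y(1) A B(1) mA by blast
qed

text \<open>If all columns at \<open>y\<^sub>n\<close> of the projections \<open>\<Phi> (proj {x})\<close> were flat, a suitable union of finite
  sets would produce an element of the algebra with flat columns, which no finite propagation operator approximates.\<close>

theorem rigidity_constant:
  "\<exists>d>0. \<forall>y\<in>Y. \<exists>x\<in>X. d \<le> cmod (coord (xi x) y)"
proof (rule ccontr)
  assume "\<not> ?thesis"
  then have flat: "\<And>d. d > 0 \<Longrightarrow> \<exists>y\<in>Y. \<forall>x\<in>X. cmod (coord (xi x) y) < d" by (meson not_le)
  let ?w = "\<lambda>y A B. blinfun_apply (\<Phi> (proj B)) (delta y) - blinfun_apply (\<Phi> (proj (A - B))) (delta y)"
  define P where "P U n t \<longleftrightarrow> (case t of (y, A, B) \<Rightarrow> y \<in> Y \<and> finite A \<and> A \<subseteq> X - U \<and> B \<subseteq> A \<and> mass (X - A) y \<le> 1/100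
    \<and> (\<forall>y'. cmod (coord (?w y A B) y') \<le> 1 / (1 + real n)))" for U n t
  define t where "t U n = (SOME t. P U n t)" for U n
  have t: "P U n (t U n)" if "finite U" "U \<subseteq> X" for U n
  proof -
    have "\<exists>y A B. P U n (y, A, B)" unfolding P_def using flat_stage[OF flat that, of "1 / (1 + real n)"] by auto
    then have "\<exists>s. P U n s" by blast
    then show ?thesis unfolding t_def by (rule someI_ex)
  qed
  define U where "U = rec_nat {} (\<lambda>n V. V \<union> fst (snd (t V n)))"
  have U0: "U 0 = {}" and US: "U (Suc n) = U n \<union> fst (snd (t (U n) n))" for n
    by (simp_all only: U_def nat.rec)
  have finU: "finite (U n) \<and> U n \<subseteq> X" for n
  proof (induction n)
    case (Suc n)
    then have "P (U n) n (t (U n) n)" by (intro t) auto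
    then show ?case using Suc by (auto simp: US P_def split: prod.splits)
  qed (simp add: U0)
  define y where "y n = fst (t (U n) n)" for n
  define A where "A n = fst (snd (t (U n) n))" for n
  define B where "B n = snd (snd (t (U n) n))" for n
  have PU: "P (U n) n (y n, A n, B n)" for n
    using t[of "U n" n] finU[of n] by (simp add: y_def A_def B_def)
  have props: "y n \<in> Y" "finite (A n)" "A n \<subseteq> X - U n" "B n \<subseteq> A n" "mass (X - A n) (y n) \<le> 1/100"
    "\<And>y'. cmod (coord (?w (y n) (A n) (B n)) y') \<le> 1 / (1 + real n)" for n
    using PU[of n] by (simp_all add: P_def)
  have AX: "A n \<subseteq> X" "B n \<subseteq> X" for n using props(3,4)[of n] by auto
  have AU: "A m \<subseteq> U n" if "m < n" for m n
    using that by (induction n) (auto simp: US A_def less_Suc_eq)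
  have disj: "A m \<inter> A n = {}" if "m \<noteq> n" for m n
    using that AU[of m n] AU[of n m] props(3)[of n] props(3)[of m] by (cases "m < n") auto
  define D where "D = (\<Union>n. B n)"
  have DX: "D \<subseteq> X" using AX by (auto simp: D_def)
  have Dn: "D \<inter> A n = B n" for n
  proof -
    have "x \<in> B n" if "x \<in> B m" "x \<in> A n" for x m
      using that disj[of m n] props(4)[of m] by (cases "m = n") auto
    then show ?thesis using props(4)[of n] by (auto simp: D_def)
  qed
  \<comment> \<open>The approximant is fixed before the stage n, so a single \<open>N\<close> bounds
    the number of nonzero entries in all of its columns.\<close>
  obtain b where b: "b \<in> bounded_ops Y" "supp b \<in> \<F>" "norm (\<Phi> (proj D) - b) < 1/10"
    by (rule Y.algebra_approx[OF Phi_in[OF X.proj_in_algebra[OF DX]], of "1/10"]) auto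
  obtain N where N: "\<And>y. y \<in> Y \<Longrightarrow> finite ((supp b)\<inverse> `` {y})" "\<And>y. y \<in> Y \<Longrightarrow> card ((supp b)\<inverse> `` {y}) \<le> N"
    by (rule Y.degree_bound[OF Y.converse_closed[OF b(2)]]) blast
  have tri: "norm (f + h - k) \<le> norm f + norm h + norm k" for f h k :: "'b ell2"
    by (rule order_trans[OF norm_triangle_ineq4 add_right_mono[OF norm_triangle_ineq]])
  have bound: "(3/10)\<^sup>2 \<le> real (N + 1) * (1 / (1 + real n))\<^sup>2" for n
  proof -
    let ?d = "delta (y n)"
    let ?p = "\<lambda>A. blinfun_apply (\<Phi> (proj A)) ?d"
    have small: "norm (?p C) \<le> 1/10" if "C \<subseteq> X - A n" for C
    proof (rule power2_le_imp_le)
      have "(norm (?p C))\<^sup>2 = mass C (y n)" using that props(1) by (intro norm_Phi_proj_delta) auto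
      also have "\<dots> \<le> mass (X - A n) (y n)" by (rule mass_mono[OF that])
      finally show "(norm (?p C))\<^sup>2 \<le> (1/10)\<^sup>2" using props(5)[of n] by (simp add: power2_eq_square)
    qed simp
    have "D = B n \<union> (D - A n)" using Dn[of n] by blast
    then have "?p D = ?p (B n \<union> (D - A n))" by simp
    also have "\<dots> = ?p (B n) + ?p (D - A n)"
      using DX AX props(4)[of n] by (intro Phi_proj_union) auto
    finally have pD: "?p D = ?p (B n) + ?p (D - A n)" .
    have "X = (B n \<union> (A n - B n)) \<union> (X - A n)" using AX[of n] props(4)[of n] by blast
    then have "?p X = ?p ((B n \<union> (A n - B n)) \<union> (X - A n))" by simp
    also have "\<dots> = ?p (B n \<union> (A n - B n)) + ?p (X - A n)"
      using AX[of n] props(4)[of n] by (intro Phi_proj_union) auto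
    also have "?p (B n \<union> (A n - B n)) = ?p (B n) + ?p (A n - B n)"
      using AX[of n] by (intro Phi_proj_union) auto
    finally have pX: "?p X = ?p (B n) + ?p (A n - B n) + ?p (X - A n)" .
    have dX: "?p X = ?d" using props(1) by (simp add: Phi_proj_total proj_delta)
    \<comment> \<open>Column \<open>y n\<close> of the symmetry
      \<open>2 \<Phi> (proj D) - 1\<close>. It is a unit vector, close to the flat vector
      \<open>w\<close> below, and also close to the corresponding column of \<open>2 b - 1\<close>,
      which lives on at most N + 1 points; there a flat vector has small norm.\<close>
    define T where "T = ?p D + ?p D - ?d"
    have "inner (?p D) ?d = (norm (?p D))\<^sup>2"
    proof -
      have e: "proj D \<in> X.\<A>" by (rule X.proj_in_algebra[OF DX])
      have "cinner (?p D) (?p D) = cinner (blinfun_apply (\<Phi> (proj D)) (?p D)) ?d"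
        using adj_cinner[OF Phi_clinear[OF e], of "?p D" ?d] by (simp only: Phi_adj[OF e, symmetric] adj_proj)
      also have "blinfun_apply (\<Phi> (proj D)) (?p D) = ?p D"
        using Phi_compose[OF e e] by (simp only: proj_compose Int_absorb blinfun_apply_blinfun_compose[symmetric])
      finally have "Re (cinner (?p D) ?d) = Re (cinner (?p D) (?p D))" by simp
      then show ?thesis by (simp add: Re_cinner power2_norm_eq_inner)
    qed
    moreover have "(norm T)\<^sup>2 = 4 * (norm (?p D))\<^sup>2 - 4 * inner (?p D) ?d + (norm ?d)\<^sup>2"
      unfolding T_def power2_norm_eq_inner
      by (simp add: inner_add_left inner_add_right inner_diff_left inner_diff_right inner_commute[of ?d "?p D"])
    ultimately have "(norm T)\<^sup>2 = 1\<^sup>2" by simp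
    then have T1: "norm T = 1" by (simp only: power2_eq_iff_nonneg norm_ge_zero zero_le_one)
    define w where "w = ?w (y n) (A n) (B n)"
    have "T - w = ?p (D - A n) + ?p (D - A n) - ?p (X - A n)"
      unfolding T_def w_def by (subst (3) dX[symmetric]) (simp add: pD pX)
    also have "norm \<dots> \<le> norm (?p (D - A n)) + norm (?p (D - A n)) + norm (?p (X - A n))"
      by (rule tri)
    also have "\<dots> \<le> 1/10 + 1/10 + 1/10" using DX by (intro add_mono small) auto
    finally have Tw: "norm (T - w) \<le> 3/10" by simp
    define g where "g = blinfun_apply b ?d + blinfun_apply b ?d - ?d"
    have "T - g = blinfun_apply (\<Phi> (proj D) - b) ?d + blinfun_apply (\<Phi> (proj D) - b) ?d"
      unfolding T_def g_def by (simp add: blinfun.diff_left)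
    also have "norm \<dots> \<le> 1/10 + 1/10"
    proof (rule norm_triangle_le)
      have "norm (blinfun_apply (\<Phi> (proj D) - b) ?d) \<le> norm (\<Phi> (proj D) - b) * norm ?d" by (rule norm_blinfun)
      then show "norm (blinfun_apply (\<Phi> (proj D) - b) ?d) + norm (blinfun_apply (\<Phi> (proj D) - b) ?d) \<le> 1/10 + 1/10"
        using b(3) by simp
    qed
    finally have Tg: "norm (T - g) \<le> 2/10" by simp
    define S where "S = insert (y n) ((supp b)\<inverse> `` {y n})"
    have S: "finite S" "card S \<le> N + 1"
      using N(1)[OF props(1)[of n]] N(2)[OF props(1)[of n]] by (simp_all add: S_def card_insert_if)
    have "blinfun_apply (proj S) g = g"
    proof (rule ell2_eqI)
      fix y' show "coord (blinfun_apply (proj S) g) y' = coord g y'"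
        by (auto simp: g_def S_def supp_iff)
    qed
    then have "g = blinfun_apply (proj S) w + blinfun_apply (proj S) (T - w) - blinfun_apply (proj S) (T - g)"
      by (simp add: blinfun.diff_right)
    then have "norm g \<le> norm (blinfun_apply (proj S) w) + norm (blinfun_apply (proj S) (T - w)) + norm (blinfun_apply (proj S) (T - g))"
      using tri[of "blinfun_apply (proj S) w" "blinfun_apply (proj S) (T - w)" "blinfun_apply (proj S) (T - g)"] by simp
    also have "\<dots> \<le> norm (blinfun_apply (proj S) w) + 3/10 + 2/10"
      using Tw Tg norm_proj_le[of S "T - w"] norm_proj_le[of S "T - g"] by linarith
    finally have "norm g \<le> norm (blinfun_apply (proj S) w) + 5/10" by simp
    moreover have "norm T \<le> norm g + norm (T - g)" using norm_triangle_ineq[of g "T - g"] by simp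
    ultimately have "3/10 \<le> norm (blinfun_apply (proj S) w)" using T1 Tg by linarith
    then have "(3/10)\<^sup>2 \<le> (norm (blinfun_apply (proj S) w))\<^sup>2" by (rule power_mono) simp
    also have "\<dots> = (\<Sum>x\<in>S. (cmod (coord w x))\<^sup>2)" by (rule norm_proj_finite[OF S(1)])
    also have "\<dots> \<le> real (card S) * (1 / (1 + real n))\<^sup>2"
      using props(6)[of n] by (intro sum_bounded_above power_mono) (simp_all add: w_def)
    also have "\<dots> \<le> real (N + 1) * (1 / (1 + real n))\<^sup>2" using S by (intro mult_right_mono) auto
    finally show ?thesis .
  qed
  \<comment> \<open>The stage n = 100 (N + 1) makes the right side of \<open>bound\<close> smaller
    than the constant 9/100.\<close>
  define k where "k = real (N + 1)"
  have k: "k \<ge> 1" by (simp add: k_def)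
  have "9/100 \<le> k * (1 / (1 + 100 * k))\<^sup>2"
    using bound[of "100 * (N + 1)"] by (simp add: power2_eq_square k_def algebra_simps)
  also have "\<dots> \<le> k * (1 / (100 * k))\<^sup>2"
    using k by (intro mult_left_mono power_mono divide_left_mono) auto
  also have "\<dots> = 1 / (10000 * k)" using k by (simp add: power2_eq_square)
  also have "\<dots> \<le> 1 / 10000" using k by (simp add: field_simps)
  finally show False by simp
qed

end

section \<open>Transport of entourages\<close>

lemma (in coarse_space) empty_entourage: "{} \<in> \<E>"
  by (rule subset_closed[OF diagonal]) simp

lemma (in coarse_space) finite_union_closed:
  "finite I \<Longrightarrow> (\<And>i. i \<in> I \<Longrightarrow> E i \<in> \<E>) \<Longrightarrow> (\<Union>i\<in>I. E i) \<in> \<E>"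
proof (induction I rule: finite_induct)
  case empty
  show ?case using empty_entourage by simp
next
  case (insert i I)
  then have "E i \<union> (\<Union>i\<in>I. E i) \<in> \<E>" by (intro union_closed) auto
  then show ?case by simp
qed

lemma finite_card_le_of_sum:
  fixes h :: "'i \<Rightarrow> real"
  assumes d: "d > 0" and h: "\<And>i. i \<in> S \<Longrightarrow> h i \<ge> d" and le: "\<And>F. finite F \<Longrightarrow> F \<subseteq> S \<Longrightarrow> sum h F \<le> 1"
  shows "finite S \<and> real (card S) \<le> 1 / d"
proof -
  have F: "real (card F) \<le> 1 / d" if "finite F" "F \<subseteq> S" for F
  proof -
    have "real (card F) * d = (\<Sum>i\<in>F. d)" by simp
    also have "\<dots> \<le> sum h F" using that h by (intro sum_mono) auto
    also have "\<dots> \<le> 1" by (rule le[OF that])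
    finally show ?thesis using d by (simp add: field_simps)
  qed
  have "finite S \<and> card S \<le> nat \<lfloor>1 / d\<rfloor>"
    by (rule finite_if_finite_subsets_card_bdd) (use F in \<open>simp add: le_nat_floor\<close>)
  then show ?thesis using F by blast
qed

definition matrix_unit :: "'a \<Rightarrow> 'a \<Rightarrow> ('a ell2 \<Rightarrow>\<^sub>L 'a ell2)" where
  "matrix_unit x x' = partial_translation {x} (\<lambda>_. x')"

lemma matrix_unit_apply: "blinfun_apply (matrix_unit x x') f = coord f x' *\<^sub>C delta x"
  by (rule ell2_eqI) (simp add: matrix_unit_def coord_partial_translation)

lemma adj_matrix_unit: "adj (matrix_unit x x') = matrix_unit x' x"
  by (rule adj_eqI)
    (simp add: matrix_unit_apply cinner_scaleC_left cinner_scaleC_right cinner_delta_left cinner_delta_right)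

lemma matrix_unit_compose: "matrix_unit x' x o\<^sub>L matrix_unit x x' = proj {x'}"
  by (rule blinfun_eqI, rule ell2_eqI) (simp add: matrix_unit_apply)

context roe_iso
begin

abbreviation m :: "'a \<Rightarrow> 'b \<Rightarrow> real" where "m x y \<equiv> cmod (coord (xi x) y)"

lemma column_sum_le: "finite F \<Longrightarrow> F \<subseteq> X \<Longrightarrow> y \<in> Y \<Longrightarrow> (\<Sum>x\<in>F. (m x y)\<^sup>2) \<le> 1"
  using mass_finite mass_le_one by metis

lemma row_sum_le: "finite V \<Longrightarrow> x \<in> X \<Longrightarrow> (\<Sum>y\<in>V. (m x y)\<^sup>2) \<le> 1"
  using sum_coord_square_le[of V "xi x"] norm_xi[of x] by simp

lemma large_row: "d > 0 \<Longrightarrow> x \<in> X \<Longrightarrow> finite {y. m x y \<ge> d} \<and> real (card {y. m x y \<ge> d}) \<le> 1 / d\<^sup>2"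
  by (rule finite_card_le_of_sum[where h = "\<lambda>y. (m x y)\<^sup>2"]) (auto intro: power_mono row_sum_le)

lemma large_column: "d > 0 \<Longrightarrow> y \<in> Y \<Longrightarrow> finite {x \<in> X. m x y \<ge> d} \<and> real (card {x \<in> X. m x y \<ge> d}) \<le> 1 / d\<^sup>2"
  by (rule finite_card_le_of_sum[where h = "\<lambda>x. (m x y)\<^sup>2"]) (auto intro: power_mono column_sum_le)

text \<open>Join x to x' with weight equal to the total squared modulus of \<open>xi x'\<close> on
  the at most 1/d^2 points of Y where \<open>xi x\<close> is large. As rows and columns of squared
  moduli sum to at most 1, the weights out of and into a point are each at most 1/d^2. Repeated
  halving of the symmetrised degree 2/d^2 brings it below \<open>e\<close>.\<close>

lemma separating_colouring:
  assumes d: "d > 0" and e: "e > 0"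
  shows "\<exists>(c :: 'a \<Rightarrow> nat) n. (\<forall>x. c x < n) \<and>
    (\<forall>x\<in>X. \<forall>y\<in>Y. d \<le> m x y \<longrightarrow> mass ({x' \<in> X. c x' = c x} - {x}) y \<le> e)"
proof -
  define K where "K = 1 / d\<^sup>2"
  have K: "K > 0" using d by (simp add: K_def)
  define L where "L x = {y \<in> Y. m x y \<ge> d}" for x
  define w0 where "w0 x x' = (if x = x' \<or> x \<notin> X \<or> x' \<notin> X then 0 else \<Sum>y\<in>L x. (m x' y)\<^sup>2)" for x x'
  define w where "w x x' = w0 x x' + w0 x' x" for x x'
  have w0nn: "w0 x x' \<ge> 0" for x x' by (simp add: w0_def sum_nonneg)
  have L: "finite (L x)" "real (card (L x)) \<le> K" if "x \<in> X" for x
  proof -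
    have "L x \<subseteq> {y. m x y \<ge> d}" by (auto simp: L_def)
    then show "finite (L x)" "real (card (L x)) \<le> K"
      using large_row[OF d that] by (auto simp: K_def intro: finite_subset order_trans[OF of_nat_mono[OF card_mono]])
  qed
  have row: "(\<Sum>x'\<in>F. w0 x x') \<le> K" if x: "x \<in> X" and F: "finite F" "F \<subseteq> X" for x F
  proof -
    have "(\<Sum>x'\<in>F. w0 x x') \<le> (\<Sum>x'\<in>F. \<Sum>y\<in>L x. (m x' y)\<^sup>2)"
      by (rule sum_mono) (simp add: w0_def sum_nonneg)
    also have "\<dots> = (\<Sum>y\<in>L x. \<Sum>x'\<in>F. (m x' y)\<^sup>2)" by (rule sum.swap)
    also have "\<dots> \<le> real (card (L x)) * 1"
      by (rule sum_bounded_above) (use F in \<open>auto simp: L_def intro: column_sum_le\<close>)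
    finally show ?thesis using L(2)[OF x] by simp
  qed
  have col: "(\<Sum>x'\<in>F. w0 x' x) \<le> K" if x: "x \<in> X" and F: "finite F" "F \<subseteq> X" for x F
  proof -
    define V where "V = (\<Union>x'\<in>F. L x')"
    have V: "finite V" "V \<subseteq> Y" using F L by (auto simp: V_def L_def)
    have "(\<Sum>x'\<in>F. w0 x' x) \<le> (\<Sum>x'\<in>F. \<Sum>y\<in>L x'. (m x y)\<^sup>2)"
      by (rule sum_mono) (simp add: w0_def sum_nonneg)
    also have "\<dots> = (\<Sum>x'\<in>F. \<Sum>y\<in>V. if y \<in> L x' then (m x y)\<^sup>2 else 0)"
    proof (rule sum.cong[OF refl])
      fix x' assume "x' \<in> F"
      then have "V \<inter> L x' = L x'" by (auto simp: V_def)
      then show "(\<Sum>y\<in>L x'. (m x y)\<^sup>2) = (\<Sum>y\<in>V. if y \<in> L x' then (m x y)\<^sup>2 else 0)"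
        using V(1) by (simp add: sum.inter_restrict[symmetric])
    qed
    also have "\<dots> = (\<Sum>y\<in>V. \<Sum>x'\<in>F. if y \<in> L x' then (m x y)\<^sup>2 else 0)" by (rule sum.swap)
    also have "\<dots> \<le> (\<Sum>y\<in>V. K * (m x y)\<^sup>2)"
    proof (rule sum_mono)
      fix y assume y: "y \<in> V"
      have "(\<Sum>x'\<in>F. if y \<in> L x' then (m x y)\<^sup>2 else 0) = real (card {x' \<in> F. y \<in> L x'}) * (m x y)\<^sup>2"
        using F(1) by (simp add: sum.inter_filter[symmetric])
      also have "\<dots> \<le> K * (m x y)\<^sup>2"
      proof (rule mult_right_mono)
        have yY: "y \<in> Y" using y V by blast
        have "card {x' \<in> F. y \<in> L x'} \<le> card {x \<in> X. m x y \<ge> d}"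
          using large_column[OF d yY] F by (intro card_mono) (auto simp: L_def)
        then show "real (card {x' \<in> F. y \<in> L x'}) \<le> K" using large_column[OF d yY] by (simp add: K_def)
      qed simp
      finally show "(\<Sum>x'\<in>F. if y \<in> L x' then (m x y)\<^sup>2 else 0) \<le> K * (m x y)\<^sup>2" .
    qed
    also have "\<dots> = K * (\<Sum>y\<in>V. (m x y)\<^sup>2)" by (simp add: sum_distrib_left)
    also have "\<dots> \<le> K * 1" using row_sum_le[OF V(1) x] K by (intro mult_left_mono) auto
    finally show ?thesis by simp
  qed
  have wb: "weight_bound w (2 * K) X"
    unfolding weight_bound_def
  proof (intro ballI allI impI)
    fix x F assume "x \<in> X" "finite F" "F \<subseteq> X"
    then show "sum (w x) F \<le> 2 * K" using row[of x F] col[of x F] by (simp add: w_def sum.distrib)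
  qed
  obtain k where k: "2 * K / e < 2 ^ k" using real_arch_pow[of 2 "2 * K / e"] by auto
  have ke: "2 * K / 2 ^ k \<le> e" using k e by (simp add: field_simps)
  obtain c :: "'a \<Rightarrow> nat" where c: "\<forall>i. c i < 2 ^ k" "\<forall>l. weight_bound w (2 * K / 2 ^ k) {i \<in> X. c i = l}"
    using weight_colouring[OF wb, of k] w0nn by (auto simp: w_def w0_def add.commute)
  have "mass ({x' \<in> X. c x' = c x} - {x}) y \<le> e" if xy: "x \<in> X" "y \<in> Y" "d \<le> m x y" for x y
  proof (rule mass_le[OF xy(2)])
    show "{x' \<in> X. c x' = c x} - {x} \<subseteq> X" by auto
    fix F assume F: "finite F" "F \<subseteq> {x' \<in> X. c x' = c x} - {x}"
    have "(\<Sum>x'\<in>F. (m x' y)\<^sup>2) \<le> sum (w x) F"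
    proof (rule sum_mono)
      fix x' assume x': "x' \<in> F"
      have "y \<in> L x" using xy by (simp add: L_def)
      then have "(m x' y)\<^sup>2 \<le> (\<Sum>y\<in>L x. (m x' y)\<^sup>2)"
        using L(1)[OF xy(1)] by (intro member_le_sum[where f = "\<lambda>y. (m x' y)\<^sup>2"]) auto
      also have "\<dots> = w0 x x'" using F x' xy(1) by (auto simp: w0_def)
      finally show "(m x' y)\<^sup>2 \<le> w x x'" using w0nn[of x' x] by (simp add: w_def)
    qed
    also have "\<dots> \<le> 2 * K / 2 ^ k"
    proof -
      have "weight_bound w (2 * K / 2 ^ k) {i \<in> X. c i = c x}" using c(2) by blast
      moreover have "x \<in> {i \<in> X. c i = c x}" "F \<subseteq> {i \<in> X. c i = c x}" using xy F by auto
      ultimately show ?thesis using F(1) unfolding weight_bound_def by blast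
    qed
    finally show "(\<Sum>x'\<in>F. (m x' y)\<^sup>2) \<le> e" using ke by simp
  qed
  then show ?thesis using c(1) by blast
qed

lemma Phi_matrix_unit:
  assumes u: "matrix_unit x x' \<in> X.\<A>" and x: "x \<in> X" "x' \<in> X"
  shows "norm (blinfun_apply (\<Phi> (matrix_unit x x')) (xi x')) = 1"
proof -
  let ?u = "matrix_unit x x'"
  have u': "adj ?u \<in> X.\<A>" by (rule X.algebra_adj[OF u])
  have "cinner (blinfun_apply (\<Phi> ?u) (xi x')) (blinfun_apply (\<Phi> ?u) (xi x'))
      = cinner (xi x') (blinfun_apply (adj (\<Phi> ?u)) (blinfun_apply (\<Phi> ?u) (xi x')))"
    by (rule adj_cinner[OF Phi_clinear[OF u]])
  also have "blinfun_apply (adj (\<Phi> ?u)) (blinfun_apply (\<Phi> ?u) (xi x')) = blinfun_apply (\<Phi> (adj ?u o\<^sub>L ?u)) (xi x')"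
    by (simp only: Phi_compose[OF u' u] Phi_adj[OF u] blinfun_apply_blinfun_compose)
  also have "\<dots> = xi x'" using x by (simp only: adj_matrix_unit matrix_unit_compose xi_self)
  finally have "complex_of_real ((norm (blinfun_apply (\<Phi> ?u) (xi x')))\<^sup>2) = complex_of_real 1"
    using norm_xi[OF x(2)] by (simp add: cinner_self)
  then have "(norm (blinfun_apply (\<Phi> ?u) (xi x')))\<^sup>2 = 1\<^sup>2" by (simp only: of_real_eq_iff one_power2)
  then show ?thesis by (simp only: power2_eq_iff_nonneg norm_ge_zero zero_le_one)
qed

lemma cinner_perturbation:
  assumes f: "norm (f - f0) \<le> s" and g: "norm (g - g0) \<le> s" and n: "norm f \<le> 1" "norm g0 \<le> 1" and K: "norm T \<le> K"
  shows "cmod (cinner (blinfun_apply T f) g - cinner (blinfun_apply T f0) g0) \<le> 2 * K * s"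
proof -
  have K0: "K \<ge> 0" using K norm_ge_zero[of T] by linarith
  have s0: "s \<ge> 0" using f norm_ge_zero[of "f - f0"] by linarith
  have T: "norm (blinfun_apply T h) \<le> K * norm h" for h
    using norm_blinfun[of T h] K by (meson mult_right_mono norm_ge_zero order_trans)
  have "cinner (blinfun_apply T f) g - cinner (blinfun_apply T f0) g0
      = cinner (blinfun_apply T f) (g - g0) + cinner (blinfun_apply T (f - f0)) g0"
    by (simp add: cinner_diff_left cinner_diff_right blinfun.diff_right)
  also have "cmod \<dots> \<le> cmod (cinner (blinfun_apply T f) (g - g0)) + cmod (cinner (blinfun_apply T (f - f0)) g0)"
    by (rule norm_triangle_ineq)
  also have "cmod (cinner (blinfun_apply T f) (g - g0)) \<le> norm (blinfun_apply T f) * norm (g - g0)" by (rule cmod_cinner_le)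
  also have "\<dots> \<le> (K * 1) * s"
    using T[of f] n g K0 s0 by (intro mult_mono order_trans[OF T[of f]] mult_left_mono) auto
  also have "cmod (cinner (blinfun_apply T (f - f0)) g0) \<le> norm (blinfun_apply T (f - f0)) * norm g0" by (rule cmod_cinner_le)
  also have "\<dots> \<le> (K * s) * 1"
    using T[of "f - f0"] n f K0 s0 by (intro mult_mono order_trans[OF T[of "f - f0"]] mult_left_mono) auto
  finally show ?thesis by simp
qed

lemma norm_Phi_proj_le:
  assumes A: "A \<subseteq> X"
  shows "norm (blinfun_apply (\<Phi> (proj A)) f) \<le> norm f"
proof (cases "blinfun_apply (\<Phi> (proj A)) f = 0")
  case False
  have e: "proj A \<in> X.\<A>" by (rule X.proj_in_algebra[OF A])
  let ?g = "blinfun_apply (\<Phi> (proj A)) f"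
  have "cinner ?g ?g = cinner (blinfun_apply (\<Phi> (proj A)) ?g) f"
    using adj_cinner[OF Phi_clinear[OF e], of ?g f] by (simp only: Phi_adj[OF e, symmetric] adj_proj)
  also have "blinfun_apply (\<Phi> (proj A)) ?g = ?g"
    using Phi_compose[OF e e] by (simp only: proj_compose Int_absorb blinfun_apply_blinfun_compose[symmetric])
  finally have "complex_of_real ((norm ?g)\<^sup>2) = cinner ?g f" by (simp only: cinner_self)
  then have "(norm ?g)\<^sup>2 \<le> norm ?g * norm f"
    using cmod_cinner_le[of ?g f] by (metis norm_of_real abs_of_nonneg zero_le_power2)
  then show ?thesis using False by (simp add: power2_eq_square)
qed simp

text \<open>An entry of \<open>\<Phi> a\<close> mixes contributions of many points. Compressing by
  the classes of x and \<open>v x\<close> in a separating colouring isolates one: column y of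
  \<open>\<Phi> (proj C)\<close> is nearly a multiple of \<open>xi x\<close>, so the compressed
  entry is close to a product of two coordinates of modulus at least d with a number of modulus 1.
  There are only finitely many compressions, each approximated by an operator supported in an
  entourage.\<close>

lemma controlled_partial_translation:
  assumes v: "inj_on v D" "D \<subseteq> X" "v ` D \<subseteq> X" and E: "(\<lambda>x. (x, v x)) ` D \<in> \<E>" and d: "d > 0"
  shows "{(y, y'). y \<in> Y \<and> y' \<in> Y \<and> (\<exists>x\<in>D. d \<le> m x y \<and> d \<le> m (v x) y')} \<in> \<F>"
proof -
  define a where "a = partial_translation D v"
  have a: "a \<in> X.\<A>" unfolding a_def by (rule X.partial_translation_in_algebra[OF v E])
  define K where "K = norm (\<Phi> a) + 1"
  have K: "K > 0" "norm (\<Phi> a) \<le> K" by (simp_all add: K_def add_nonneg_pos)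
  \<comment> \<open>Then \<open>2 * K * s\<close>, the loss in \<open>cinner_perturbation\<close>,
    is half of d^2. Of the remaining d^2 / 2 the approximation may take d^2 / 4, and the entry stays
    nonzero.\<close>
  define s where "s = d\<^sup>2 / (4 * K)"
  have s: "s > 0" using d K by (simp add: s_def)
  obtain c :: "'a \<Rightarrow> nat" and n where c: "\<And>x. c x < n"
    "\<And>x y. x \<in> X \<Longrightarrow> y \<in> Y \<Longrightarrow> d \<le> m x y \<Longrightarrow> mass ({x' \<in> X. c x' = c x} - {x}) y \<le> s\<^sup>2"
    using separating_colouring[OF d, of "s\<^sup>2"] s by auto
  define C where "C l = {x \<in> X. c x = l}" for l
  have CX: "C l \<subseteq> X" for l by (auto simp: C_def)
  have pC: "proj (C l) \<in> X.\<A>" for l by (rule X.proj_in_algebra[OF CX])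
  define T where "T l l' = \<Phi> (proj (C l)) o\<^sub>L \<Phi> a o\<^sub>L \<Phi> (proj (C l'))" for l l'
  have T: "T l l' \<in> Y.\<A>" for l l'
    unfolding T_def by (intro Y.algebra_compose Phi_in pC a)
  have "\<exists>b. b \<in> bounded_ops Y \<and> supp b \<in> \<F> \<and> norm (T l l' - b) < d\<^sup>2 / 4" for l l'
    using Y.algebra_approx[OF T, of "d\<^sup>2 / 4" l l'] d by (metis zero_less_power zero_less_divide_iff zero_less_numeral)
  then obtain b where b: "\<And>l l'. b l l' \<in> bounded_ops Y" "\<And>l l'. supp (b l l') \<in> \<F>" "\<And>l l'. norm (T l l' - b l l') < d\<^sup>2 / 4"
    by metis
  have "(\<Union>p\<in>{..<n} \<times> {..<n}. supp (b (fst p) (snd p))) \<in> \<F>"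
    by (rule Y.finite_union_closed) (auto intro: b)
  then show ?thesis
  proof (rule Y.subset_closed, clarify)
    fix y y' x assume y: "y \<in> Y" "y' \<in> Y" and x: "x \<in> D" "d \<le> m x y" "d \<le> m (v x) y'"
    define x' where "x' = v x"
    have xX: "x \<in> X" "x' \<in> X" using x v by (auto simp: x'_def)
    have dx': "d \<le> m x' y'" using x by (simp add: x'_def)
    define g where "g = blinfun_apply (\<Phi> (proj (C (c x)))) (delta y)"
    define f where "f = blinfun_apply (\<Phi> (proj (C (c x')))) (delta y')"
    define g0 where "g0 = cnj (coord (xi x) y) *\<^sub>C xi x"
    define f0 where "f0 = cnj (coord (xi x') y') *\<^sub>C xi x'"
    have near: "norm (blinfun_apply (\<Phi> (proj (C (c z)))) (delta t) - cnj (coord (xi z) t) *\<^sub>C xi z) \<le> s"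
      if "z \<in> X" "t \<in> Y" "d \<le> m z t" for z t
    proof (rule power2_le_imp_le)
      have zC: "z \<in> C (c z)" using that by (simp add: C_def)
      have "(norm (blinfun_apply (\<Phi> (proj (C (c z)))) (delta t) - cnj (coord (xi z) t) *\<^sub>C xi z))\<^sup>2 = mass (C (c z) - {z}) t"
        by (rule Phi_proj_delta_defect[OF CX zC that(2)])
      also have "\<dots> \<le> s\<^sup>2" using c(2)[OF that] by (simp only: C_def)
      finally show "(norm (blinfun_apply (\<Phi> (proj (C (c z)))) (delta t) - cnj (coord (xi z) t) *\<^sub>C xi z))\<^sup>2 \<le> s\<^sup>2" .
    qed (use s in simp)
    have n1: "norm f \<le> 1" unfolding f_def using norm_Phi_proj_le[OF CX, of "c x'" "delta y'"] by simp
    have n2: "norm g0 \<le> 1"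
      unfolding g0_def using cmod_coord_le[of "xi x" y] norm_xi[OF xX(1)] by (simp add: norm_scaleC)
    have diff: "cmod (cinner (blinfun_apply (\<Phi> a) f) g - cinner (blinfun_apply (\<Phi> a) f0) g0) \<le> 2 * K * s"
      by (rule cinner_perturbation[OF _ _ n1 n2 K(2)])
        (simp_all add: f_def f0_def g_def g0_def near xX y x dx')
    have unit: "matrix_unit x x' = proj {x} o\<^sub>L a o\<^sub>L proj {x'}"
    proof (intro blinfun_eqI ell2_eqI)
      fix h z
      have "coord (blinfun_apply a (delta x')) x = 1" using x by (simp add: a_def coord_partial_translation[OF v(1)] x'_def)
      then show "coord (blinfun_apply (matrix_unit x x') h) z = coord (blinfun_apply (proj {x} o\<^sub>L a o\<^sub>L proj {x'}) h) z"
        by (simp add: matrix_unit_apply proj_singleton clinear_opD[OF bounded_opsD(1)[OF X.algebra_bounded[OF a]]])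
    qed
    have px: "proj {x} \<in> X.\<A>" "proj {x'} \<in> X.\<A>" using xX by (auto intro: X.proj_in_algebra)
    have uA: "matrix_unit x x' \<in> X.\<A>" unfolding unit by (intro X.algebra_compose px a)
    have "blinfun_apply (\<Phi> (matrix_unit x x')) (xi x') = cinner (blinfun_apply (\<Phi> a) (xi x')) (xi x) *\<^sub>C xi x"
      unfolding unit by (simp add: Phi_compose px a X.algebra_compose xi_self xX Phi_proj_singleton[OF xX(1)])
    then have one: "cmod (cinner (blinfun_apply (\<Phi> a) (xi x')) (xi x)) = 1"
      using Phi_matrix_unit[OF uA xX] norm_xi[OF xX(1)] by (simp add: norm_scaleC)
    have "cmod (cinner (blinfun_apply (\<Phi> a) f0) g0) = m x' y' * m x y"
      unfolding f0_def g0_def clinear_opD[OF Phi_clinear[OF a]] cinner_scaleC_left cinner_scaleC_right norm_mult one by simp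
    also have "\<dots> \<ge> d * d" using x dx' d by (intro mult_mono) auto
    finally have main: "d\<^sup>2 \<le> cmod (cinner (blinfun_apply (\<Phi> a) f0) g0)" by (simp add: power2_eq_square)
    have "2 * K * s = d\<^sup>2 / 2" using K by (simp add: s_def)
    then have big: "d\<^sup>2 / 2 \<le> cmod (cinner (blinfun_apply (\<Phi> a) f) g)"
      using main diff norm_triangle_ineq2[of "cinner (blinfun_apply (\<Phi> a) f0) g0" "cinner (blinfun_apply (\<Phi> a) f0) g0 - cinner (blinfun_apply (\<Phi> a) f) g"]
      by (simp add: norm_minus_commute)
    have "cinner (blinfun_apply (T (c x) (c x')) (delta y')) (delta y) = cinner (blinfun_apply (\<Phi> a) f) g"
      unfolding T_def f_def g_def
      using adj_cinner[OF Phi_clinear[OF pC[of "c x"]], of "blinfun_apply (\<Phi> a) (blinfun_apply (\<Phi> (proj (C (c x')))) (delta y'))" "delta y"]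
      by (simp add: Phi_adj[OF pC, symmetric] adj_proj)
    then have "d\<^sup>2 / 2 \<le> cmod (coord (blinfun_apply (T (c x) (c x')) (delta y')) y)"
      using big by (simp add: cinner_delta_right)
    moreover have lt: "cmod (coord (blinfun_apply (T (c x) (c x') - b (c x) (c x')) (delta y')) y) < d\<^sup>2 / 4"
    proof -
      have "cmod (coord (blinfun_apply (T (c x) (c x') - b (c x) (c x')) (delta y')) y)
          \<le> norm (blinfun_apply (T (c x) (c x') - b (c x) (c x')) (delta y'))" by (rule cmod_coord_le)
      also have "\<dots> \<le> norm (T (c x) (c x') - b (c x) (c x')) * norm (delta y')" by (rule norm_blinfun)
      also have "\<dots> < d\<^sup>2 / 4" using b(3) by simp
      finally show ?thesis .
    qed
    moreover have "d\<^sup>2 / 4 < d\<^sup>2 / 2" using d by simp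
    ultimately have "coord (blinfun_apply (b (c x) (c x')) (delta y')) y \<noteq> 0"
      by (metis blinfun.diff_left coord_simps(3) diff_zero less_trans not_le)
    then have "(y, y') \<in> supp (b (c x) (c x'))" by (simp add: supp_iff)
    then show "(y, y') \<in> (\<Union>p\<in>{..<n} \<times> {..<n}. supp (b (fst p) (snd p)))"
      using c(1) by (intro UN_I[of "(c x, c x')"]) auto
  qed
qed

text \<open>Number the points of \<open>E[x]\<close> and of its converse. The pairs of numbers, x'
  as seen from x and x as seen from x', split \<open>E\<close> into finitely many graphs of
  injective partial maps.\<close>

lemma controlled_relation:
  assumes E: "E \<in> \<E>" and d: "d > 0"
  shows "{(y, y'). y \<in> Y \<and> y' \<in> Y \<and> (\<exists>(x, x')\<in>E. d \<le> m x y \<and> d \<le> m x' y')} \<in> \<F>"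
proof -
  obtain N1 where N1: "\<And>x. x \<in> X \<Longrightarrow> finite (E `` {x})" "\<And>x. x \<in> X \<Longrightarrow> card (E `` {x}) \<le> N1"
    by (rule X.degree_bound[OF E]) blast
  obtain N2 where N2: "\<And>x. x \<in> X \<Longrightarrow> finite (E\<inverse> `` {x})" "\<And>x. x \<in> X \<Longrightarrow> card (E\<inverse> `` {x}) \<le> N2"
    by (rule X.degree_bound[OF X.converse_closed[OF E]]) blast
  have EX: "x \<in> X" "x' \<in> X" if "(x, x') \<in> E" for x x' using X.entourage_subset[OF E] that by auto
  have enum: "\<exists>p :: 'a \<Rightarrow> nat. inj_on p S \<and> (\<forall>z\<in>S. p z < N)" if S: "finite S" "card S \<le> N" for S N
  proof -
    obtain p where "bij_betw p S {0..<card S}" using ex_bij_betw_finite_nat[OF S(1)] by blast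
    then have "inj_on p S" "p ` S = {0..<card S}" by (simp_all add: bij_betw_def)
    moreover from this have "\<forall>z\<in>S. p z < N" using S(2) by (metis imageI atLeastLessThan_iff less_le_trans)
    ultimately show ?thesis by blast
  qed
  have "\<forall>x\<in>X. \<exists>p :: 'a \<Rightarrow> nat. inj_on p (E `` {x}) \<and> (\<forall>z\<in>E `` {x}. p z < N1)"
    using enum N1 by blast
  then obtain p :: "'a \<Rightarrow> 'a \<Rightarrow> nat" where p: "\<And>x. x \<in> X \<Longrightarrow> inj_on (p x) (E `` {x})" "\<And>x z. x \<in> X \<Longrightarrow> (x, z) \<in> E \<Longrightarrow> p x z < N1"
    by (metis (no_types, lifting) ImageI singletonI)
  have "\<forall>x\<in>X. \<exists>p :: 'a \<Rightarrow> nat. inj_on p (E\<inverse> `` {x}) \<and> (\<forall>z\<in>E\<inverse> `` {x}. p z < N2)"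
    using enum N2 by blast
  then obtain q :: "'a \<Rightarrow> 'a \<Rightarrow> nat" where q: "\<And>x. x \<in> X \<Longrightarrow> inj_on (q x) (E\<inverse> `` {x})" "\<And>x z. x \<in> X \<Longrightarrow> (z, x) \<in> E \<Longrightarrow> q x z < N2"
    by (metis (no_types, lifting) ImageI singletonI converseI)
  define E' where "E' i j = {(x, x') \<in> E. p x x' = i \<and> q x' x = j}" for i j
  have functional: "x1 = x2" if "(x, x1) \<in> E' i j" "(x, x2) \<in> E' i j" for x x1 x2 i j
    using that p(1)[OF EX(1), of x x1] by (auto simp: E'_def inj_on_def)
  have inj: "x1 = x2" if "(x1, x) \<in> E' i j" "(x2, x) \<in> E' i j" for x x1 x2 i j
    using that q(1)[OF EX(2), of x1 x] by (auto simp: E'_def inj_on_def)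
  define D where "D i j = Domain (E' i j)" for i j
  define v where "v i j x = (THE x'. (x, x') \<in> E' i j)" for i j x
  have v: "v i j x = x'" if "(x, x') \<in> E' i j" for i j x x'
    unfolding v_def using that functional by blast
  have vE: "(x, v i j x) \<in> E' i j" if "x \<in> D i j" for i j x
  proof -
    obtain x' where "(x, x') \<in> E' i j" using \<open>x \<in> D i j\<close> by (auto simp: D_def)
    then show ?thesis using v by metis
  qed
  have E'E: "E' i j \<subseteq> E" for i j by (auto simp: E'_def)
  have each: "{(y, y'). y \<in> Y \<and> y' \<in> Y \<and> (\<exists>x\<in>D i j. d \<le> m x y \<and> d \<le> m (v i j x) y')} \<in> \<F>" for i j
  proof (rule controlled_partial_translation[OF _ _ _ _ d])
    show "inj_on (v i j) (D i j)"
    proof (rule inj_onI)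
      fix x1 x2 assume "x1 \<in> D i j" "x2 \<in> D i j" "v i j x1 = v i j x2"
      then show "x1 = x2" using vE[of x1 i j] vE[of x2 i j] inj[of x1 "v i j x1" i j x2] by simp
    qed
    show "D i j \<subseteq> X" "v i j ` D i j \<subseteq> X" using vE EX E'E by blast+
    show "(\<lambda>x. (x, v i j x)) ` D i j \<in> \<E>" by (rule X.subset_closed[OF E]) (use vE E'E in blast)
  qed
  have "(\<Union>r\<in>{..<N1} \<times> {..<N2}. {(y, y'). y \<in> Y \<and> y' \<in> Y \<and> (\<exists>x\<in>D (fst r) (snd r). d \<le> m x y \<and> d \<le> m (v (fst r) (snd r) x) y')}) \<in> \<F>"
    by (rule Y.finite_union_closed) (auto intro: each)
  then show ?thesis
  proof (rule Y.subset_closed, clarify)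
    fix y y' x x' assume y: "y \<in> Y" "y' \<in> Y" and x: "(x, x') \<in> E" "d \<le> m x y" "d \<le> m x' y'"
    define i where "i = p x x'"
    define j where "j = q x' x"
    have ij: "i < N1" "j < N2" using p(2) q(2) EX[OF x(1)] x(1) by (auto simp: i_def j_def)
    have e: "(x, x') \<in> E' i j" using x(1) by (simp add: E'_def i_def j_def)
    then have "x \<in> D i j" "v i j x = x'" using v by (auto simp: D_def)
    then show "(y, y') \<in> (\<Union>r\<in>{..<N1} \<times> {..<N2}. {(y, y'). y \<in> Y \<and> y' \<in> Y \<and> (\<exists>x\<in>D (fst r) (snd r). d \<le> m x y \<and> d \<le> m (v (fst r) (snd r) x) y')})"
      using ij y x by (intro UN_I[of "(i, j)"]) auto
  qed
qed

end

section \<open>Injections close to a given map\<close>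

text \<open>Gaussian elimination: equation \<open>b\<close> with pivot \<open>a0\<close> is solved
  for one unknown and substituted into the others.\<close>

lemma underdetermined_system:
  fixes M :: "'j \<Rightarrow> 'i \<Rightarrow> 'k::field"
  assumes "finite B" "finite A" "card B < card A"
  shows "\<exists>w. (\<exists>a\<in>A. w a \<noteq> 0) \<and> (\<forall>b\<in>B. (\<Sum>a\<in>A. M b a * w a) = 0)"
  using assms
proof (induction B arbitrary: A M rule: finite_induct)
  case empty
  then have "A \<noteq> {}" by auto
  then show ?case by (intro exI[of _ "\<lambda>_. 1"]) auto
next
  case (insert b B)
  have lt: "card B < card A" using insert by simp
  show ?case
  proof (cases "\<forall>a\<in>A. M b a = 0")
    case True
    obtain w where "\<exists>a\<in>A. w a \<noteq> 0" "\<forall>b\<in>B. (\<Sum>a\<in>A. M b a * w a) = 0"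
      using insert.IH[OF insert.prems(1) lt, of M] by blast
    then show ?thesis using True by (intro exI[of _ w]) simp
  next
    case False
    then obtain a0 where a0: "a0 \<in> A" "M b a0 \<noteq> 0" by blast
    have A': "finite (A - {a0})" "card B < card (A - {a0})" using insert a0 by auto
    obtain w where w: "\<exists>a\<in>A - {a0}. w a \<noteq> 0"
      "\<forall>b'\<in>B. (\<Sum>a\<in>A - {a0}. (M b' a - M b' a0 * M b a / M b a0) * w a) = 0"
      using insert.IH[OF A', of "\<lambda>b' a. M b' a - M b' a0 * M b a / M b a0"] by blast
    define r where "r = - (\<Sum>a\<in>A - {a0}. M b a * w a) / M b a0"
    have split: "(\<Sum>a\<in>A. M b' a * (w(a0 := r)) a) = M b' a0 * r + (\<Sum>a\<in>A - {a0}. M b' a * w a)" for b'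
      using a0(1) insert.prems(1) by (subst sum.remove[of A a0]) (auto intro!: sum.cong)
    have "(\<Sum>a\<in>A. M b a * (w(a0 := r)) a) = 0" unfolding split using a0(2) by (simp add: r_def)
    moreover have "(\<Sum>a\<in>A. M b' a * (w(a0 := r)) a) = 0" if "b' \<in> B" for b'
    proof -
      have "0 = (\<Sum>a\<in>A - {a0}. M b' a * w a - M b' a0 / M b a0 * (M b a * w a))"
        using w(2) that by (simp add: algebra_simps)
      also have "\<dots> = (\<Sum>a\<in>A - {a0}. M b' a * w a) - M b' a0 / M b a0 * (\<Sum>a\<in>A - {a0}. M b a * w a)"
        by (simp add: sum_subtractf sum_distrib_left)
      finally show ?thesis unfolding split by (simp add: r_def)
    qed
    ultimately have "\<forall>b'\<in>insert b B. (\<Sum>a\<in>A. M b' a * (w(a0 := r)) a) = 0" by blast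
    moreover have "\<exists>a\<in>A. (w(a0 := r)) a \<noteq> 0" using w(1) by auto
    ultimately show ?thesis by (intro exI[of _ "w(a0 := r)"] conjI)
  qed
qed

lemma norm_sum_orthogonal:
  fixes g :: "'i \<Rightarrow> 'a ell2"
  assumes "finite I" and orth: "\<And>i j. i \<in> I \<Longrightarrow> j \<in> I \<Longrightarrow> i \<noteq> j \<Longrightarrow> cinner (g i) (g j) = 0"
  shows "(norm (\<Sum>i\<in>I. g i))\<^sup>2 = (\<Sum>i\<in>I. (norm (g i))\<^sup>2)"
proof (rule norm_sum_Pythagorean[OF assms(1)])
  show "pairwise (\<lambda>i j. real_inner_class.orthogonal (g i) (g j)) I"
    unfolding pairwise_def real_inner_class.orthogonal_def by (simp add: Re_cinner[symmetric] orth)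
qed

lemma coord_blinfun_sum:
  assumes "clinear_op T"
  shows "coord (blinfun_apply T (\<Sum>x\<in>F. w x *\<^sub>C z x)) y = (\<Sum>x\<in>F. w x * coord (blinfun_apply T (z x)) y)"
  by (simp add: blinfun.sum_right coord_sum clinear_opD[OF assms])

section \<open>Dual points, their defects, and Hall's condition\<close>

context roe_iso
begin

lemma norm_sum_xi:
  assumes "finite F" "F \<subseteq> X"
  shows "(norm (\<Sum>x\<in>F. w x *\<^sub>C xi x))\<^sup>2 = (\<Sum>x\<in>F. (cmod (w x))\<^sup>2)"
proof -
  have "(norm (\<Sum>x\<in>F. w x *\<^sub>C xi x))\<^sup>2 = (\<Sum>x\<in>F. (norm (w x *\<^sub>C xi x))\<^sup>2)"
    by (rule norm_sum_orthogonal[OF assms(1)])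
      (use assms(2) in \<open>auto simp: cinner_scaleC_left cinner_scaleC_right xi_orthogonal subset_iff\<close>)
  also have "\<dots> = (\<Sum>x\<in>F. (cmod (w x))\<^sup>2)"
    using assms(2) by (intro sum.cong) (auto simp: norm_scaleC norm_xi subset_iff)
  finally show ?thesis .
qed

lemma Phi_proj_orthogonal:
  assumes "C \<subseteq> X" "D \<subseteq> X" "C \<inter> D = {}"
  shows "cinner (blinfun_apply (\<Phi> (proj C)) f) (blinfun_apply (\<Phi> (proj D)) g) = 0"
proof -
  have e: "proj C \<in> X.\<A>" "proj D \<in> X.\<A>" using assms by (auto intro: X.proj_in_algebra)
  have "cinner (blinfun_apply (\<Phi> (proj C)) f) (blinfun_apply (\<Phi> (proj D)) g)
      = cinner f (blinfun_apply (\<Phi> (proj C) o\<^sub>L \<Phi> (proj D)) g)"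
    unfolding adj_cinner[OF Phi_clinear[OF e(1)]] by (simp only: Phi_adj[OF e(1), symmetric] adj_proj blinfun_apply_blinfun_compose)
  also have "\<Phi> (proj C) o\<^sub>L \<Phi> (proj D) = \<Phi> (proj {})"
    by (simp only: Phi_compose[OF e, symmetric] proj_compose assms(3))
  also have "cinner f (blinfun_apply (\<Phi> (proj {})) g) = 0"
    by (simp only: Phi_proj_empty) (simp add: cinner_def)
  finally show ?thesis .
qed

text \<open>The basis vector at \<open>f x\<close>, scaled so that \<open>\<Phi> (proj {x})\<close>
  maps it exactly to \<open>xi x\<close> when the coordinate is nonzero.\<close>

definition dual_point :: "('a \<Rightarrow> 'b) \<Rightarrow> 'a \<Rightarrow> 'b ell2" where
  "dual_point f x = (1 / cnj (coord (xi x) (f x))) *\<^sub>C delta (f x)"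

text \<open>For x in \<open>C\<close> this is the contribution of the other points of the class,
  namely the image of the dual point under \<open>\<Phi> (proj (C - {x}))\<close>.\<close>

definition defect :: "('a \<Rightarrow> 'b) \<Rightarrow> 'a set \<Rightarrow> 'a \<Rightarrow> 'b ell2" where
  "defect f C x = blinfun_apply (\<Phi> (proj C)) (dual_point f x) - xi x"

lemma norm_sum_dual_point:
  assumes d: "d > 0" and F: "finite F" and inj: "inj_on f F" and f: "\<And>x. x \<in> F \<Longrightarrow> d \<le> m x (f x)"
  shows "norm (\<Sum>x\<in>F. w x *\<^sub>C dual_point f x) \<le> sqrt (\<Sum>x\<in>F. (cmod (w x))\<^sup>2) / d"
proof (rule power2_le_imp_le)
  define a where "a y = w (the_inv_into F f y) / cnj (coord (xi (the_inv_into F f y)) y)" for y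
  have a: "a (f x) = w x / cnj (coord (xi x) (f x))" if "x \<in> F" for x
    by (simp add: a_def the_inv_into_f_f[OF inj that])
  have "(\<Sum>x\<in>F. w x *\<^sub>C dual_point f x) = (\<Sum>x\<in>F. a (f x) *\<^sub>C delta (f x))"
    by (rule sum.cong[OF refl]) (rule ell2_eqI, simp add: dual_point_def a)
  also have "\<dots> = (\<Sum>y\<in>f ` F. a y *\<^sub>C delta y)" by (simp add: sum.reindex[OF inj])
  also have "(norm \<dots>)\<^sup>2 = (\<Sum>y\<in>f ` F. (cmod (a y))\<^sup>2)" using F by (intro norm_square_finite_expansion) simp
  also have "\<dots> = (\<Sum>x\<in>F. (cmod (a (f x)))\<^sup>2)" by (simp add: sum.reindex[OF inj])
  also have "\<dots> \<le> (\<Sum>x\<in>F. (cmod (w x))\<^sup>2 / d\<^sup>2)"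
  proof (rule sum_mono)
    fix x assume x: "x \<in> F"
    have "cmod (a (f x)) \<le> cmod (w x) / d"
      unfolding a[OF x] norm_divide complex_mod_cnj using f[OF x] d by (intro divide_left_mono mult_pos_pos) auto
    then have "(cmod (a (f x)))\<^sup>2 \<le> (cmod (w x) / d)\<^sup>2" by (intro power_mono) auto
    then show "(cmod (a (f x)))\<^sup>2 \<le> (cmod (w x))\<^sup>2 / d\<^sup>2" by (simp only: power_divide)
  qed
  also have "\<dots> = (sqrt (\<Sum>x\<in>F. (cmod (w x))\<^sup>2) / d)\<^sup>2"
    by (simp add: power_divide sum_divide_distrib sum_nonneg)
  finally show "(norm (\<Sum>x\<in>F. w x *\<^sub>C dual_point f x))\<^sup>2 \<le> (sqrt (\<Sum>x\<in>F. (cmod (w x))\<^sup>2) / d)\<^sup>2" .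
qed (use d in \<open>simp add: sum_nonneg\<close>)

lemma sum_defect:
  assumes "C \<subseteq> X"
  shows "(\<Sum>x\<in>F. w x *\<^sub>C defect f C x)
    = blinfun_apply (\<Phi> (proj C)) (\<Sum>x\<in>F. w x *\<^sub>C dual_point f x) - (\<Sum>x\<in>F. w x *\<^sub>C xi x)"
  by (simp add: defect_def scaleC_diff sum_subtractf blinfun.sum_right
      clinear_opD[OF Phi_clinear[OF X.proj_in_algebra[OF assms]]])

text \<open>The dual points contribute 1/d, being multiples of distinct basis vectors under a
  contraction, and the orthonormal \<open>xi x\<close> contribute 1. The bound is far from small,
  but it depends on d alone, so the depth of the paving can be fixed before any colouring.\<close>

lemma bessel_defect:
  assumes d: "d > 0" and C: "C \<subseteq> X" and inj: "inj_on f C" and f: "\<And>x. x \<in> C \<Longrightarrow> d \<le> m x (f x)"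
  shows "bessel ((1 / d + 1)\<^sup>2) C (defect f C)"
proof (rule besselI)
  fix F w assume F: "finite F" "F \<subseteq> C"
  define s where "s = sqrt (\<Sum>x\<in>F. (cmod (w x))\<^sup>2)"
  have s2: "s\<^sup>2 = (\<Sum>x\<in>F. (cmod (w x))\<^sup>2)" by (simp add: s_def sum_nonneg)
  have "norm (\<Sum>x\<in>F. w x *\<^sub>C xi x) = s"
    unfolding s_def norm_sum_xi[OF F(1) subset_trans[OF F(2) C], symmetric] by simp
  moreover have "norm (blinfun_apply (\<Phi> (proj C)) (\<Sum>x\<in>F. w x *\<^sub>C dual_point f x)) \<le> s / d"
    unfolding s_def
    by (rule order_trans[OF norm_Phi_proj_le[OF C] norm_sum_dual_point[OF d F(1) inj_on_subset[OF inj F(2)]]])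
      (use F f in auto)
  ultimately have "norm (\<Sum>x\<in>F. w x *\<^sub>C defect f C x) \<le> s / d + s"
    unfolding sum_defect[OF C]
    using norm_triangle_ineq4[of "blinfun_apply (\<Phi> (proj C)) (\<Sum>x\<in>F. w x *\<^sub>C dual_point f x)" "\<Sum>x\<in>F. w x *\<^sub>C xi x"] by linarith
  also have "\<dots> = (1 / d + 1) * s" by (simp add: field_simps)
  finally have "(norm (\<Sum>x\<in>F. w x *\<^sub>C defect f C x))\<^sup>2 \<le> ((1 / d + 1) * s)\<^sup>2" by (intro power_mono) auto
  then show "(norm (\<Sum>x\<in>F. w x *\<^sub>C defect f C x))\<^sup>2 \<le> (1 / d + 1)\<^sup>2 * (\<Sum>x\<in>F. (cmod (w x))\<^sup>2)"
    by (simp only: power_mult_distrib s2)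
qed

lemma norm_defect:
  assumes d: "d > 0" and C: "C \<subseteq> X" "x \<in> C" and f: "f x \<in> Y" "d \<le> m x (f x)"
  shows "(norm (defect f C x))\<^sup>2 \<le> mass (C - {x}) (f x) / d\<^sup>2"
proof -
  let ?u = "coord (xi x) (f x)"
  have u: "cmod ?u > 0" using d f(2) by linarith
  have c: "clinear_op (\<Phi> (proj C))" by (rule Phi_clinear[OF X.proj_in_algebra[OF C(1)]])
  have "defect f C x = (1 / cnj ?u) *\<^sub>C (blinfun_apply (\<Phi> (proj C)) (delta (f x)) - cnj ?u *\<^sub>C xi x)"
    using u by (intro ell2_eqI) (simp add: defect_def dual_point_def clinear_opD[OF c] field_simps)
  then have "(norm (defect f C x))\<^sup>2 = mass (C - {x}) (f x) / (cmod ?u)\<^sup>2"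
    using Phi_proj_delta_defect[OF C f(1)] by (simp add: norm_scaleC norm_divide power_divide)
  also have "\<dots> \<le> mass (C - {x}) (f x) / d\<^sup>2"
    using d f(2) u by (intro divide_left_mono mass_nonneg power_mono) auto
  finally show ?thesis .
qed

text \<open>For x in \<open>D\<close> the defect relative to \<open>D\<close> is the image of the
  one relative to \<open>C\<close> under the contraction \<open>\<Phi> (proj D)\<close>. Hence a
  bound obtained by paving the defects of a large class passes to the defects of the pieces
  themselves.\<close>

lemma bessel_defect_subset:
  assumes b: "bessel K D (defect f C)" and D: "D \<subseteq> C" and C: "C \<subseteq> X"
  shows "bessel K D (defect f D)"
proof (rule besselI)
  fix F w assume F: "finite F" "F \<subseteq> D"
  have DX: "D \<subseteq> X" using D C by blast
  have e: "proj D \<in> X.\<A>" "proj C \<in> X.\<A>" by (rule X.proj_in_algebra[OF DX], rule X.proj_in_algebra[OF C])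
  have DC: "D \<inter> C = D" using D by blast
  have "defect f D x = blinfun_apply (\<Phi> (proj D)) (defect f C x)" if "x \<in> D" for x
  proof -
    have "blinfun_apply (\<Phi> (proj D)) (blinfun_apply (\<Phi> (proj C)) h) = blinfun_apply (\<Phi> (proj D)) h" for h
      by (simp only: blinfun_apply_blinfun_compose[symmetric] Phi_compose[OF e, symmetric] proj_compose DC)
    moreover have "blinfun_apply (\<Phi> (proj D)) (xi x) = xi x" using Phi_proj_xi[OF DX, of x] that DX by auto
    ultimately show ?thesis by (simp add: defect_def blinfun.diff_right)
  qed
  then have "(\<Sum>x\<in>F. w x *\<^sub>C defect f D x) = (\<Sum>x\<in>F. w x *\<^sub>C blinfun_apply (\<Phi> (proj D)) (defect f C x))"
    using F by (intro sum.cong) auto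
  also have "\<dots> = blinfun_apply (\<Phi> (proj D)) (\<Sum>x\<in>F. w x *\<^sub>C defect f C x)"
    by (simp add: blinfun.sum_right clinear_opD[OF Phi_clinear[OF e(1)]])
  finally have "norm (\<Sum>x\<in>F. w x *\<^sub>C defect f D x) \<le> norm (\<Sum>x\<in>F. w x *\<^sub>C defect f C x)"
    using norm_Phi_proj_le[OF DX] by simp
  then have "(norm (\<Sum>x\<in>F. w x *\<^sub>C defect f D x))\<^sup>2 \<le> (norm (\<Sum>x\<in>F. w x *\<^sub>C defect f C x))\<^sup>2"
    by (intro power_mono) auto
  also have "\<dots> \<le> K * (\<Sum>x\<in>F. (cmod (w x))\<^sup>2)" by (rule besselD[OF b F])
  finally show "(norm (\<Sum>x\<in>F. w x *\<^sub>C defect f D x))\<^sup>2 \<le> K * (\<Sum>x\<in>F. (cmod (w x))\<^sup>2)" .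
qed

text \<open>A separating colouring makes the defects short, and a paving of each class then lowers
  their Bessel bound. The final colour is the pair of both, coded as a number. The bound 1/4 makes
  the defects smaller than the vectors \<open>xi x\<close> by a factor 1/2 in norm.\<close>

lemma paved_colouring:
  assumes d: "d > 0" and f: "\<And>x. x \<in> X \<Longrightarrow> f x \<in> Y" "\<And>x. x \<in> X \<Longrightarrow> d \<le> m x (f x)"
  shows "\<exists>(c :: 'a \<Rightarrow> nat) n. (\<forall>x. c x < n) \<and>
    (\<forall>l. inj_on f {x \<in> X. c x = l} \<and> bessel (1 / 4) {x \<in> X. c x = l} (defect f {x \<in> X. c x = l}))"
proof -
  define K where "K = (1 / d + 1)\<^sup>2"
  have K: "K > 0" proof -
    have "1 / d + 1 > 0" using d by (simp add: add_pos_pos)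
    then show ?thesis unfolding K_def by (rule zero_less_power)
  qed
  obtain k where k: "(17/20 :: real) ^ k < 1 / (4 * K)" using K real_arch_pow_inv[of "1 / (4 * K)" "17/20"] by auto
  have kK: "(17/20) ^ k * K \<le> 1 / 4" using k K by (simp add: field_simps)
  \<comment> \<open>The first bound gives e < d^2 and so injectivity of \<open>f\<close> on a class:
    a second preimage would alone have mass d^2. The second is the shortness of defects that
    \<open>bessel_paving\<close> requires at depth \<open>k\<close>.\<close>
  define e where "e = min (d\<^sup>2 / 2) (d\<^sup>2 * (K * (17/20) ^ k / 400))"
  have e: "e > 0" "e < d\<^sup>2" using d K by (auto simp: e_def min_def)
  have e2: "e / d\<^sup>2 \<le> K * (17/20) ^ k / 400"
    using d by (simp add: e_def pos_divide_le_eq mult.commute)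
  obtain c0 :: "'a \<Rightarrow> nat" and n0 where c0: "\<And>x. c0 x < n0"
    "\<And>x y. x \<in> X \<Longrightarrow> y \<in> Y \<Longrightarrow> d \<le> m x y \<Longrightarrow> mass ({x' \<in> X. c0 x' = c0 x} - {x}) y \<le> e"
    using separating_colouring[OF d e(1)] by auto
  define C where "C l = {x \<in> X. c0 x = l}" for l
  have CX: "C l \<subseteq> X" for l by (auto simp: C_def)
  have mass_C: "mass (C l - {x}) (f x) \<le> e" if "x \<in> C l" for x l
    using c0(2)[of x "f x"] f that by (auto simp: C_def)
  have inj: "inj_on f (C l)" for l
  proof (rule inj_onI, rule ccontr)
    fix x x' assume x: "x \<in> C l" "x' \<in> C l" "f x = f x'" "x \<noteq> x'"
    have x'X: "x' \<in> X" using x CX by blast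
    have "d\<^sup>2 \<le> (m x' (f x'))\<^sup>2" using f(2)[OF x'X] d by (intro power_mono) auto
    also have "\<dots> = mass {x'} (f x')" using x'X f(1) by (subst mass_finite) auto
    also have "\<dots> \<le> mass (C l - {x}) (f x')" using x by (intro mass_mono) auto
    also have "\<dots> \<le> e" using mass_C[OF x(1)] x(3) by simp
    finally show False using e(2) by simp
  qed
  have bC: "bessel K (C l) (defect f (C l))" for l
    unfolding K_def by (rule bessel_defect[OF d CX inj]) (use f CX in auto)
  have small: "(norm (defect f (C l) x))\<^sup>2 \<le> K * (17/20) ^ k / 400" if "x \<in> C l" for x l
  proof -
    have "x \<in> X" using that CX by blast
    then have "(norm (defect f (C l) x))\<^sup>2 \<le> mass (C l - {x}) (f x) / d\<^sup>2"
      by (intro norm_defect[OF d CX that] f)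
    also have "\<dots> \<le> e / d\<^sup>2" using mass_C[OF that] d by (intro divide_right_mono) auto
    finally show ?thesis using e2 by linarith
  qed
  have "\<exists>c :: 'a \<Rightarrow> nat. (\<forall>x. c x < 2 ^ k) \<and> (\<forall>j. bessel ((17/20) ^ k * K) {x \<in> C l. c x = j} (defect f (C l)))" for l
    by (rule bessel_paving[OF bC K small])
  then obtain c1 :: "nat \<Rightarrow> 'a \<Rightarrow> nat" where c1: "\<And>l x. c1 l x < 2 ^ k"
    "\<And>l j. bessel ((17/20) ^ k * K) {x \<in> C l. c1 l x = j} (defect f (C l))" by metis
  define c where "c x = c0 x * 2 ^ k + c1 (c0 x) x" for x
  have dm: "c x div 2 ^ k = c0 x" "c x mod 2 ^ k = c1 (c0 x) x" for x using c1(1)[of "c0 x" x] by (simp_all add: c_def)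
  have "c x < n0 * 2 ^ k" for x
  proof -
    have "c x < (c0 x + 1) * 2 ^ k" using c1(1)[of "c0 x" x] by (simp add: c_def)
    also have "\<dots> \<le> n0 * 2 ^ k" using c0(1)[of x] by (intro mult_right_mono) auto
    finally show ?thesis .
  qed
  moreover have "inj_on f {x \<in> X. c x = l} \<and> bessel (1 / 4) {x \<in> X. c x = l} (defect f {x \<in> X. c x = l})" for l
  proof
    define D where "D = {x \<in> X. c x = l}"
    have DC: "D \<subseteq> {x \<in> C (l div 2 ^ k). c1 (l div 2 ^ k) x = l mod 2 ^ k}"
      using dm by (auto simp: D_def C_def)
    then have DC': "D \<subseteq> C (l div 2 ^ k)" by blast
    show "inj_on f {x \<in> X. c x = l}" using inj_on_subset[OF inj DC'] by (simp only: D_def)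
    have "bessel (1 / 4) D (defect f (C (l div 2 ^ k)))"
    proof (rule besselI)
      fix F w assume F: "finite F" "F \<subseteq> D"
      have "(norm (\<Sum>x\<in>F. w x *\<^sub>C defect f (C (l div 2 ^ k)) x))\<^sup>2 \<le> (17/20) ^ k * K * (\<Sum>x\<in>F. (cmod (w x))\<^sup>2)"
        by (rule besselD[OF c1(2)[of "l div 2 ^ k" "l mod 2 ^ k"] F(1)]) (rule subset_trans[OF F(2) DC])
      also have "\<dots> \<le> 1 / 4 * (\<Sum>x\<in>F. (cmod (w x))\<^sup>2)" by (intro mult_right_mono kK sum_nonneg) simp
      finally show "(norm (\<Sum>x\<in>F. w x *\<^sub>C defect f (C (l div 2 ^ k)) x))\<^sup>2 \<le> 1 / 4 * (\<Sum>x\<in>F. (cmod (w x))\<^sup>2)" .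
    qed
    then have "bessel (1 / 4) D (defect f D)" by (rule bessel_defect_subset[OF _ DC' CX])
    then show "bessel (1 / 4) {x \<in> X. c x = l} (defect f {x \<in> X. c x = l})" by (simp only: D_def)
  qed
  ultimately show ?thesis by blast
qed

text \<open>If a finite set \<open>A\<close> had too few targets, the approximants would map some
  combination of its dual points to zero. But that image differs from the orthonormal combination of
  the \<open>xi x\<close>, of norm s, by at most s/2 for the defects and s/4 for the
  approximation.\<close>

theorem injection_near:
  assumes d: "d > 0" and f: "\<And>x. x \<in> X \<Longrightarrow> f x \<in> Y" "\<And>x. x \<in> X \<Longrightarrow> d \<le> m x (f x)"
  shows "\<exists>F\<in>\<F>. \<exists>\<phi>. inj_on \<phi> X \<and> (\<forall>x\<in>X. (\<phi> x, f x) \<in> F)"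
proof -
  obtain c :: "'a \<Rightarrow> nat" and n where c: "\<And>x. c x < n"
    "\<And>l. inj_on f {x \<in> X. c x = l}" "\<And>l. bessel (1 / 4) {x \<in> X. c x = l} (defect f {x \<in> X. c x = l})"
    using paved_colouring[OF d f] by blast
  define C where "C l = {x \<in> X. c x = l}" for l
  have CX: "C l \<subseteq> X" for l by (auto simp: C_def)
  have pC: "proj (C l) \<in> X.\<A>" for l by (rule X.proj_in_algebra[OF CX])
  have inj: "inj_on f (C l)" for l using c(2) by (simp only: C_def)
  have bes: "bessel (1 / 4) (C l) (defect f (C l))" for l using c(3) by (simp only: C_def)
  \<comment> \<open>There are n classes, and the combination of dual points in each has norm at most
    s / d, with s the norm of the coefficients; the total error is then at most s / 4.\<close>
  define e where "e = d / (4 * (real n + 1))"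
  have e: "e > 0" using d by (simp add: e_def)
  have ed: "e / d = 1 / (4 * (real n + 1))" using d by (simp add: e_def)
  have ne: "real n * (e / d) \<le> 1 / 4" unfolding ed by (simp add: field_simps)
  have "\<exists>b. b \<in> bounded_ops Y \<and> supp b \<in> \<F> \<and> norm (\<Phi> (proj (C l)) - b) < e" for l
    using Y.algebra_approx[OF Phi_in[OF pC] e] by metis
  then obtain b where b: "\<And>l. b l \<in> bounded_ops Y" "\<And>l. supp (b l) \<in> \<F>" "\<And>l. norm (\<Phi> (proj (C l)) - b l) < e"
    by metis
  define F0 where "F0 = (\<Union>l\<in>{..<n}. supp (b l))"
  have F0: "F0 \<in> \<F>" unfolding F0_def by (rule Y.finite_union_closed) (auto intro: b)
  \<comment> \<open>Support pairs are ordered as row and column, so column \<open>f x\<close> of an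
    operator supported in \<open>F0\<close> lives on the converse image of
    \<open>f x\<close>.\<close>
  define N where "N x = F0\<inverse> `` {f x}" for x
  have finN: "finite (N x)" if "x \<in> X" for x
    unfolding N_def by (rule Y.degree_bound[OF Y.converse_closed[OF F0]]) (use f(1)[OF that] in blast)
  have "card A \<le> card (\<Union>x\<in>A. N x)" if A: "finite A" "A \<subseteq> X" for A
  proof (rule ccontr)
    define B where "B = (\<Union>x\<in>A. N x)"
    define M where "M y x = coord (blinfun_apply (b (c x)) (dual_point f x)) y" for y x
    assume "\<not> card A \<le> card (\<Union>x\<in>A. N x)"
    then have lt: "card B < card A" by (simp add: B_def)
    have finB: "finite B" unfolding B_def using A finN by blast
    obtain w where w: "\<exists>a\<in>A. w a \<noteq> 0" "\<forall>y\<in>B. (\<Sum>a\<in>A. M y a * w a) = 0"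
      using underdetermined_system[OF finB A(1) lt, of M] by blast
    have M0: "M y x = 0" if "x \<in> A" "y \<notin> B" for x y
    proof -
      have "(y, f x) \<notin> F0" using that by (auto simp: B_def N_def)
      then have "(y, f x) \<notin> supp (b (c x))" using c(1) by (auto simp: F0_def)
      then show ?thesis
        by (simp add: supp_iff M_def dual_point_def clinear_opD[OF bounded_opsD(1)[OF b(1)]])
    qed
    have kernel: "(\<Sum>x\<in>A. M y x * w x) = 0" for y
      using w(2) M0 by (cases "y \<in> B") simp_all
    define s where "s = sqrt (\<Sum>x\<in>A. (cmod (w x))\<^sup>2)"
    have s2: "s\<^sup>2 = (\<Sum>x\<in>A. (cmod (w x))\<^sup>2)" by (simp add: s_def sum_nonneg)
    have "(\<Sum>x\<in>A. (cmod (w x))\<^sup>2) > 0"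
      using w(1) A(1) by (auto intro: sum_pos2)
    then have s: "s > 0" by (simp add: s_def)
    define A' where "A' l = {x \<in> A. c x = l}" for l
    have A': "finite (A' l)" "A' l \<subseteq> C l" for l using A by (auto simp: A'_def C_def)
    have decomp: "(\<Sum>l<n. \<Sum>x\<in>A' l. h x) = sum h A" for h :: "'a \<Rightarrow> 'b ell2"
      unfolding A'_def by (rule sum.group[OF A(1)]) (use c(1) in auto)
    have decompr: "(\<Sum>l<n. \<Sum>x\<in>A' l. h x) = sum h A" for h :: "'a \<Rightarrow> real"
      unfolding A'_def by (rule sum.group[OF A(1)]) (use c(1) in auto)
    define z where "z l = (\<Sum>x\<in>A' l. w x *\<^sub>C dual_point f x)" for l
    define g where "g l = (\<Sum>x\<in>A' l. w x *\<^sub>C defect f (C l) x)" for l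
    have g: "g l = blinfun_apply (\<Phi> (proj (C l))) (z l) - (\<Sum>x\<in>A' l. w x *\<^sub>C xi x)" for l
      unfolding g_def z_def by (rule sum_defect[OF CX])
    have gr: "g l = blinfun_apply (\<Phi> (proj (C l))) (g l)" for l
    proof -
      have "blinfun_apply (\<Phi> (proj (C l))) (xi x) = xi x" if "x \<in> A' l" for x
        using Phi_proj_xi[OF CX, of x l] that A'(2) CX by (auto simp: subset_iff)
      then have "blinfun_apply (\<Phi> (proj (C l))) (\<Sum>x\<in>A' l. w x *\<^sub>C xi x) = (\<Sum>x\<in>A' l. w x *\<^sub>C xi x)"
        by (simp add: blinfun.sum_right clinear_opD[OF Phi_clinear[OF pC]])
      moreover have "blinfun_apply (\<Phi> (proj (C l))) (blinfun_apply (\<Phi> (proj (C l))) h) = blinfun_apply (\<Phi> (proj (C l))) h" for h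
        by (simp only: blinfun_apply_blinfun_compose[symmetric] Phi_compose[OF pC pC, symmetric] proj_compose Int_absorb)
      ultimately show ?thesis unfolding g by (simp add: blinfun.diff_right)
    qed
    \<comment> \<open>The vectors \<open>g l\<close> lie in the ranges of mutually orthogonal
      projections. Their squared norms add up, so the estimate does not deteriorate with the number
      of colours.\<close>
    have "(norm (\<Sum>l<n. g l))\<^sup>2 = (\<Sum>l<n. (norm (g l))\<^sup>2)"
    proof (rule norm_sum_orthogonal)
      fix i j :: nat assume "i \<noteq> j"
      then have "C i \<inter> C j = {}" by (auto simp: C_def)
      then show "cinner (g i) (g j) = 0" by (subst gr, subst (2) gr) (rule Phi_proj_orthogonal[OF CX CX])
    qed simp
    also have "\<dots> \<le> (\<Sum>l<n. 1 / 4 * (\<Sum>x\<in>A' l. (cmod (w x))\<^sup>2))"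
      unfolding g_def by (intro sum_mono besselD[OF bes] A')
    also have "\<dots> = (s / 2)\<^sup>2" by (simp only: sum_distrib_left[symmetric] decompr s2 power_divide) simp
    finally have gs: "norm (\<Sum>l<n. g l) \<le> s / 2" by (rule power2_le_imp_le) (use s in simp)
    have "norm (\<Sum>x\<in>A. w x *\<^sub>C xi x) = s"
      unfolding s_def norm_sum_xi[OF A, symmetric] by simp
    moreover have "(\<Sum>l<n. blinfun_apply (\<Phi> (proj (C l))) (z l)) = (\<Sum>x\<in>A. w x *\<^sub>C xi x) + (\<Sum>l<n. g l)"
      unfolding g by (simp add: sum_subtractf decomp)
    ultimately have "s / 2 \<le> norm (\<Sum>l<n. blinfun_apply (\<Phi> (proj (C l))) (z l))"
      using gs norm_triangle_ineq4[of "(\<Sum>x\<in>A. w x *\<^sub>C xi x) + (\<Sum>l<n. g l)" "\<Sum>l<n. g l"] by simp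
    moreover have zero: "(\<Sum>l<n. blinfun_apply (b l) (z l)) = 0"
    proof (rule ell2_eqI)
      fix y
      have "coord (\<Sum>l<n. blinfun_apply (b l) (z l)) y = (\<Sum>l<n. \<Sum>x\<in>A' l. w x * coord (blinfun_apply (b l) (dual_point f x)) y)"
        unfolding coord_sum z_def by (intro sum.cong coord_blinfun_sum bounded_opsD(1)[OF b(1)]) simp
      also have "\<dots> = (\<Sum>l<n. \<Sum>x\<in>A' l. M y x * w x)"
        by (intro sum.cong refl) (simp add: M_def A'_def)
      also have "\<dots> = (\<Sum>x\<in>A. M y x * w x)"
        unfolding A'_def by (rule sum.group[OF A(1)]) (use c(1) in auto)
      finally show "coord (\<Sum>l<n. blinfun_apply (b l) (z l)) y = coord 0 y" by (simp add: kernel)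
    qed
    moreover have "norm ((\<Sum>l<n. blinfun_apply (\<Phi> (proj (C l))) (z l)) - (\<Sum>l<n. blinfun_apply (b l) (z l))) \<le> 1 / 4 * s"
    proof -
      have "norm ((\<Sum>l<n. blinfun_apply (\<Phi> (proj (C l))) (z l)) - (\<Sum>l<n. blinfun_apply (b l) (z l)))
          = norm (\<Sum>l<n. blinfun_apply (\<Phi> (proj (C l)) - b l) (z l))" by (simp add: blinfun.diff_left sum_subtractf)
      also have "\<dots> \<le> (\<Sum>l<n. norm (blinfun_apply (\<Phi> (proj (C l)) - b l) (z l)))" by (rule norm_sum)
      also have "\<dots> \<le> (\<Sum>l<n. e * (s / d))"
      proof (rule sum_mono)
        fix l
        have fd: "d \<le> m x (f x)" if "x \<in> A' l" for x
          by (rule f(2)) (use that A in \<open>auto simp: A'_def\<close>)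
        have "norm (z l) \<le> sqrt (\<Sum>x\<in>A' l. (cmod (w x))\<^sup>2) / d"
          unfolding z_def by (rule norm_sum_dual_point[OF d A'(1) inj_on_subset[OF inj A'(2)] fd])
        also have "\<dots> \<le> s / d"
          unfolding s_def using A d by (intro divide_right_mono real_sqrt_le_mono sum_mono2) (auto simp: A'_def)
        finally have z: "norm (z l) \<le> s / d" .
        have "norm (blinfun_apply (\<Phi> (proj (C l)) - b l) (z l)) \<le> norm (\<Phi> (proj (C l)) - b l) * norm (z l)"
          by (rule norm_blinfun)
        also have "\<dots> \<le> e * (s / d)" using b(3)[of l] z e by (intro mult_mono) auto
        finally show "norm (blinfun_apply (\<Phi> (proj (C l)) - b l) (z l)) \<le> e * (s / d)" .
      qed
      also have "\<dots> = real n * (e / d) * s" by simp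
      also have "\<dots> \<le> 1 / 4 * s" using s by (intro mult_right_mono ne) simp
      finally show ?thesis .
    qed
    ultimately show False using s by simp
  qed
  then obtain \<phi> where "inj_on \<phi> X" "\<forall>x\<in>X. \<phi> x \<in> N x"
    using hall[of X N] finN by blast
  then show ?thesis using F0 by (intro bexI[of _ F0] exI[of _ \<phi>]) (auto simp: N_def)
qed

theorem bijective_equivalence: "bijectively_coarsely_equivalent X \<E> Y \<F>"
proof -
  interpret I: roe_iso Y \<F> X \<E> \<Psi> by (rule inverse)
  have xi_I: "I.xi = eta" by (rule eta_eq)
  have sym: "I.m y x = m x y" if "x \<in> X" "y \<in> Y" for x y
    unfolding xi_I using that by (rule cmod_xi_eta)
  obtain d1 where d1: "d1 > 0" "\<forall>x\<in>X. \<exists>y\<in>Y. d1 \<le> m x y"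
    using I.rigidity_constant sym by metis
  obtain d2 where d2: "d2 > 0" "\<forall>y\<in>Y. \<exists>x\<in>X. d2 \<le> m x y"
    using rigidity_constant by blast
  define d where "d = min d1 d2"
  have d: "d > 0" using d1 d2 by (simp add: d_def)
  have "\<forall>x\<in>X. \<exists>y. y \<in> Y \<and> d \<le> m x y" using d1(2) unfolding d_def by (meson min.coboundedI1)
  then obtain f where f: "\<And>x. x \<in> X \<Longrightarrow> f x \<in> Y" "\<And>x. x \<in> X \<Longrightarrow> d \<le> m x (f x)" by metis
  have "\<forall>y\<in>Y. \<exists>x. x \<in> X \<and> d \<le> m x y" using d2(2) unfolding d_def by (meson min.coboundedI2)
  then obtain g where g: "\<And>y. y \<in> Y \<Longrightarrow> g y \<in> X" "\<And>y. y \<in> Y \<Longrightarrow> d \<le> m (g y) y" by metis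
  have gI: "d \<le> I.m y (g y)" if "y \<in> Y" for y using g[OF that] sym[OF g(1)[OF that] that] by simp
  obtain F0 \<phi> where F0: "F0 \<in> \<F>" "inj_on \<phi> X" "\<And>x. x \<in> X \<Longrightarrow> (\<phi> x, f x) \<in> F0"
    using injection_near[OF d f] by blast
  obtain E0 \<gamma> where E0: "E0 \<in> \<E>" "inj_on \<gamma> Y" "\<And>y. y \<in> Y \<Longrightarrow> (\<gamma> y, g y) \<in> E0"
    using I.injection_near[OF d g(1) gI] by blast
  \<comment> \<open>The injection \<phi> displaces points in Y and \<gamma> displaces points in X.
    With the diagonals added, one relation \<open>R\<close> covers both cases.\<close>
  define E1 where "E1 = E0 \<union> Id_on X"
  define F1 where "F1 = F0 \<union> Id_on Y"
  have E1: "E1 \<in> \<E>" unfolding E1_def by (intro X.union_closed E0(1) X.diagonal)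
  have F1: "F1 \<in> \<F>" unfolding F1_def by (intro Y.union_closed F0(1) Y.diagonal)
  define R where "R x y \<longleftrightarrow> (\<exists>x0 y0. (x, x0) \<in> E1 \<and> (y, y0) \<in> F1 \<and> d \<le> m x0 y0)" for x y
  have "\<exists>b. bij_betw b X Y \<and> (\<forall>x\<in>X. R x (b x))"
  proof (rule schroeder_bernstein_relation[OF F0(2) _ _ E0(2)])
    show "\<phi> x \<in> Y" if "x \<in> X" for x using F0(3)[OF that] Y.entourage_subset[OF F0(1)] by blast
    show "\<gamma> y \<in> X" if "y \<in> Y" for y using E0(3)[OF that] X.entourage_subset[OF E0(1)] by blast
    show "R x (\<phi> x)" if "x \<in> X" for x
      unfolding R_def by (rule exI[of _ x], rule exI[of _ "f x"]) (use F0(3)[OF that] f(2)[OF that] that in \<open>auto simp: E1_def F1_def\<close>)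
    show "R (\<gamma> y) y" if "y \<in> Y" for y
      unfolding R_def by (rule exI[of _ "g y"], rule exI[of _ y]) (use E0(3)[OF that] g(2)[OF that] that in \<open>auto simp: E1_def F1_def\<close>)
  qed
  then obtain b where b: "bij_betw b X Y" "\<And>x. x \<in> X \<Longrightarrow> R x (b x)" by blast
  have E1X: "x \<in> X \<and> x0 \<in> X" if "(x, x0) \<in> E1" for x x0 using X.entourage_subset[OF E1] that by blast
  have F1Y: "y \<in> Y \<and> y0 \<in> Y" if "(y, y0) \<in> F1" for y y0 using Y.entourage_subset[OF F1] that by blast
  have forward: "map_prod b b ` E \<in> \<F>" if E: "E \<in> \<E>" for E
  proof -
    \<comment> \<open>From b x one moves by \<open>F1\<close> to a point y0 paired with a point x0
      near x. So G collects the pairs (y0, y1) whose partners lie in the enlarged entourage, and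
      \<open>F1\<close> on both sides leads back to b x and b x'.\<close>
    define G where "G = {(y, y'). y \<in> Y \<and> y' \<in> Y \<and> (\<exists>(x, x')\<in>E1\<inverse> O E O E1. d \<le> m x y \<and> d \<le> m x' y')}"
    have "G \<in> \<F>" unfolding G_def
      by (intro controlled_relation X.comp_closed X.converse_closed E1 E d)
    then have "F1 O G O F1\<inverse> \<in> \<F>" by (intro Y.comp_closed Y.converse_closed F1)
    moreover have "map_prod b b ` E \<subseteq> F1 O G O F1\<inverse>"
    proof (rule image_subsetI, unfold split_paired_all)
      fix x x' assume x: "(x, x') \<in> E"
      then have xX: "x \<in> X" "x' \<in> X" using X.entourage_subset[OF E] by auto
      obtain x0 y0 where 1: "(x, x0) \<in> E1" "(b x, y0) \<in> F1" "d \<le> m x0 y0" using b(2)[OF xX(1)] unfolding R_def by blast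
      obtain x1 y1 where 2: "(x', x1) \<in> E1" "(b x', y1) \<in> F1" "d \<le> m x1 y1" using b(2)[OF xX(2)] unfolding R_def by blast
      have "(x0, x1) \<in> E1\<inverse> O E O E1" using 1(1) x 2(1) by blast
      then have "(y0, y1) \<in> G" unfolding G_def using 1 2 F1Y by blast
      then show "map_prod b b (x, x') \<in> F1 O G O F1\<inverse>" unfolding map_prod_simp using 1(2) 2(2) by blast
    qed
    ultimately show ?thesis by (rule Y.subset_closed)
  qed
  have backward: "map_prod (inv_into X b) (inv_into X b) ` F \<in> \<E>" if F: "F \<in> \<F>" for F
  proof -
    define G where "G = {(x, x'). x \<in> X \<and> x' \<in> X \<and> (\<exists>(y, y')\<in>F1\<inverse> O F O F1. d \<le> I.m y x \<and> d \<le> I.m y' x')}"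
    have "G \<in> \<E>" unfolding G_def
      by (intro I.controlled_relation Y.comp_closed Y.converse_closed F1 F d)
    then have "E1 O G O E1\<inverse> \<in> \<E>" by (intro X.comp_closed X.converse_closed E1)
    moreover have "map_prod (inv_into X b) (inv_into X b) ` F \<subseteq> E1 O G O E1\<inverse>"
    proof (rule image_subsetI, unfold split_paired_all)
      fix y y' assume y: "(y, y') \<in> F"
      then have yY: "y \<in> Y" "y' \<in> Y" using Y.entourage_subset[OF F] by auto
      define x where "x = inv_into X b y"
      define x' where "x' = inv_into X b y'"
      have x: "x \<in> X" "b x = y" "x' \<in> X" "b x' = y'"
        using b(1) yY by (auto simp: x_def x'_def bij_betw_def inv_into_into f_inv_into_f)
      obtain x0 y0 where 1: "(x, x0) \<in> E1" "(y, y0) \<in> F1" "d \<le> m x0 y0" using b(2)[OF x(1)] unfolding R_def x(2) by blast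
      obtain x1 y1 where 2: "(x', x1) \<in> E1" "(y', y1) \<in> F1" "d \<le> m x1 y1" using b(2)[OF x(3)] unfolding R_def x(4) by blast
      have "(y0, y1) \<in> F1\<inverse> O F O F1" using 1(2) y 2(2) by blast
      moreover have "d \<le> I.m y0 x0" "d \<le> I.m y1 x1" using 1 2 E1X F1Y sym by auto
      ultimately have "(x0, x1) \<in> G" unfolding G_def using 1(1) 2(1) E1X by blast
      then show "map_prod (inv_into X b) (inv_into X b) (y, y') \<in> E1 O G O E1\<inverse>"
        unfolding map_prod_simp x_def[symmetric] x'_def[symmetric] using 1(1) 2(1) by blast
    qed
    ultimately show ?thesis by (rule X.subset_closed)
  qed
  show ?thesis
    unfolding bijectively_coarsely_equivalent_def controlled_def using b(1) forward backward by blast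
qed

end

theorem theorem1p2:
  fixes X :: "'a set" and \<E> :: "('a \<times> 'a) set set"
    and Y :: "'b set" and \<F> :: "('b \<times> 'b) set set"
  assumes "coarse_space X \<E>" and "uniformly_locally_finite X \<E>"
    and "coarse_space Y \<F>" and "uniformly_locally_finite Y \<F>"
    and "cstar_isomorphic (uniform_Roe_algebra X \<E>) (uniform_Roe_algebra Y \<F>)"
  shows "bijectively_coarsely_equivalent X \<E> Y \<F>"
proof -
  obtain \<Phi> where "star_isomorphism \<Phi> (uniform_Roe_algebra X \<E>) (uniform_Roe_algebra Y \<F>)"
    using assms(5) unfolding cstar_isomorphic_def by blast
  then interpret roe_iso X \<E> Y \<F> \<Phi>
    by (intro roe_iso.intro roe_iso_axioms.intro ulf_space.intro ulf_space_axioms.intro assms)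
  show ?thesis by (rule bijective_equivalence)
qed

end
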